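(* Let $\Delta$ be a two-dimensional lattice polygon. Then $\mathrm{ls}_\Sigma(\Delta) = \mathrm{ls}_\Sigma(\Delta^{(1)}) + 3$, except in the following situations, where the values are as stated. 1. $\Delta \simeq \mathrm{conv}\{(0,0),(a,0),(0,1),(b,1)\}$ with either $a=b=1$, or $a \ge 2$ and $a \ge b \ge 0$. Then $\mathrm{ls}_\Sigma(\Delta^{(1)}) = -2$. Moreover $\mathrm{ls}_\Sigma(\Delta) = a+1$ if $a=b$, and $\mathrm{ls}_\Sigma(\Delta) = a$ if $a>b$. 2. $\Delta \simeq \mathrm{conv}\{(0,0),(2,0),(0,2)\}$. Then $\mathrm{ls}_\Sigma(\Delta^{(1)}) = -2$ and $\mathrm{ls}_\Sigma(\Delta) = 2$. 3. $\Delta \simeq \mathrm{conv}\{(0,0),(4,0),(0,2)\}$. Then $\mathrm{ls}_\Sigma(\Delta^{(1)}) = 0$ and $\mathrm{ls}_\Sigma(\Delta) = 4$. 4. $\Delta \simeq [0,a]\times[0,b]$ for some integers $a,b \ge 2$. Then $\mathrm{ls}_\Sigma(\Delta^{(1)}) = a+b-4$ and $\mathrm{ls}_\Sigma(\Delta) = a+b$. 5. There exist an edge $\tau$ of $\Delta$ and an edge $\tau'$ of $\Delta^{(1)}$ that are parallel, whose supporting lines are at integral distance $1$ from each other, and such that $\sharp(\tau\cap\mathbb{Z}^2) - \sharp(\tau'\cap\mathbb{Z}^2) \ge 4$. Then $\mathrm{ls}_\Sigma(\Delta^{(1)}) = \sharp(\tau'\cap\mathbb{Z}^2) - 1$ and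 $\mathrm{ls}_\Sigma(\Delta) = \sharp(\tau\cap\mathbb{Z}^2) - 1$; that is, both lattice sizes equal the integral lengths of $\tau'$ and $\tau$ respectively.
   Context: A lattice polygon is the convex hull of finitely many points of $\mathbb{Z}^2$; it may be empty, a point or a segment. $\Delta^{(1)}$ is the convex hull of the lattice points in the interior of $\Delta$. A unimodular transformation is an affine map $v \mapsto Av+w$ with $A \in \mathrm{GL}_2(\mathbb{Z})$ and $w \in \mathbb{Z}^2$; $\Delta \simeq \Delta'$ means $\Delta' = \varphi(\Delta)$ for such a $\varphi$. Let $\Sigma = \mathrm{conv}\{(0,0),(1,0),(0,1)\}$. For a non-empty lattice polygon $\Gamma$, $\mathrm{ls}_\Sigma(\Gamma)$ is the smallest integer $d \ge 0$ with $\varphi(\Gamma) \subset d\Sigma$ for some unimodular $\varphi$; by convention $\mathrm{ls}_\Sigma(\emptyset) = -2$. An edge is a one-dimensional face; a one-dimensional polygon is an edge of itself. Two parallel lines $aX+bY=c$ and $aX+bY=c'$, with $a,b$ coprime integers and $c,c' \in \mathbb{Z}$, are at integral distance $|c-c'|$. *)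

theory Defs
  imports "HOL-Analysis.Analysis"
begin

definition int_points :: "(real \<times> real) set" where
  "int_points = \<int> \<times> \<int>"

definition lattice_polygon :: "(real \<times> real) set \<Rightarrow> bool" where
  "lattice_polygon P \<longleftrightarrow> (\<exists>S. finite S \<and> S \<subseteq> int_points \<and> P = convex hull S)"

definition interior_polygon :: "(real \<times> real) set \<Rightarrow> (real \<times> real) set" where
  "interior_polygon P = convex hull (interior P \<inter> int_points)"

(* Invertibility of A is taken over the integers, i.e. A is an element of GL_2(Z). *)
definition unimodular :: "(real \<times> real \<Rightarrow> real \<times> real) \<Rightarrow> bool" where
  "unimodular \<phi> \<longleftrightarrow>
     (\<exists>(A :: int^2^2) (w :: int^2). invertible A \<and>
        \<phi> = (\<lambda>(x, y). (of_int (A$1$1) * x + of_int (A$1$2) * y + of_int (w$1),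
                        of_int (A$2$1) * x + of_int (A$2$2) * y + of_int (w$2))))"

definition unimodular_equiv ::
    "(real \<times> real) set \<Rightarrow> (real \<times> real) set \<Rightarrow> bool"  (infix "\<simeq>" 50) where
  "P \<simeq> Q \<longleftrightarrow> (\<exists>\<phi>. unimodular \<phi> \<and> Q = \<phi> ` P)"

definition std_simplex :: "(real \<times> real) set" where
  "std_simplex = convex hull {(0, 0), (1, 0), (0, 1)}"

definition lattice_size :: "(real \<times> real) set \<Rightarrow> int" where
  "lattice_size P =
     (if P = {} then -2
      else int (LEAST d :: nat. \<exists>\<phi>. unimodular \<phi> \<and> \<phi> ` P \<subseteq> (\<lambda>v. real d *\<^sub>R v) ` std_simplex))"

definition int_line :: "int \<Rightarrow> int \<Rightarrow> int \<Rightarrow> (real \<times> real) set" where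
  "int_line a b c = {(x, y). of_int a * x + of_int b * y = of_int c}"

(* The common normal vector (a, b) makes the two lines parallel. *)
definition at_integral_distance ::
    "(real \<times> real) set \<Rightarrow> (real \<times> real) set \<Rightarrow> int \<Rightarrow> bool" where
  "at_integral_distance L L' d \<longleftrightarrow>
     (\<exists>a b c c'. coprime a b \<and> L = int_line a b c \<and> L' = int_line a b c' \<and> d = \<bar>c - c'\<bar>)"

definition num_int_points :: "(real \<times> real) set \<Rightarrow> int" where
  "num_int_points S = int (card (S \<inter> int_points))"

definition is_trapezoid :: "(real \<times> real) set \<Rightarrow> int \<Rightarrow> int \<Rightarrow> bool" where
  "is_trapezoid P a b \<longleftrightarrow>
     ((a = 1 \<and> b = 1) \<or> (a \<ge> 2 \<and> a \<ge> b \<and> b \<ge> 0)) \<and>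
     P \<simeq> convex hull {(0, 0), (of_int a, 0), (0, 1), (of_int b, 1)}"

definition is_rectangle :: "(real \<times> real) set \<Rightarrow> int \<Rightarrow> int \<Rightarrow> bool" where
  "is_rectangle P a b \<longleftrightarrow> a \<ge> 2 \<and> b \<ge> 2 \<and> P \<simeq> {0..of_int a} \<times> {0..of_int b}"

(* The supporting line of an edge is its affine hull. *)
definition long_edge_pair ::
    "(real \<times> real) set \<Rightarrow> (real \<times> real) set \<Rightarrow> (real \<times> real) set \<Rightarrow> bool" where
  "long_edge_pair P \<tau> \<tau>' \<longleftrightarrow>
     \<tau> edge_of P \<and> \<tau>' edge_of interior_polygon P \<and>
     at_integral_distance (affine hull \<tau>) (affine hull \<tau>') 1 \<and>
     num_int_points \<tau> - num_int_points \<tau>' \<ge> 4"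

end

theory Submission
  imports Defs
begin

text \<open>
  Write \<open>D\<close> and \<open>I\<close> for the lattice points of the polygon and of its interior, and \<open>d\<close> for the
  lattice size of \<open>I\<close>. Interior points of \<open>e\<Sigma>\<close> lie in a translate of \<open>(e - 3)\<Sigma>\<close>, so the lattice size of
  \<open>D\<close> is at least \<open>d + 3\<close>. For the converse choose, among all frames in which \<open>I\<close> fits into a simplex
  of size \<open>d\<close>, one in which the size \<open>e\<close> of the circumscribed simplex of \<open>D\<close> is minimal. If
  \<open>e \<ge> d + 4\<close>, then \<open>D\<close> reaches at least two units beyond \<open>I\<close> on some side, say at \<open>v \<in> D\<close>, while
  \<open>p \<in> I\<close> is closest to that side. Since no lattice point other than points of \<open>I\<close> may be a convex
  combination of \<open>p\<close>, \<open>v\<close> and further points of \<open>D\<close> with positive weight on \<open>I\<close>, the vector \<open>p - v\<close> is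
  the sum of a lattice basis \<open>Q, R\<close> such that \<open>D\<close> lies in the cone spanned by \<open>Q, R\<close> at \<open>v\<close>. The frame
  \<open>(v, Q, R)\<close> is again optimal for \<open>I\<close>, and minimality of \<open>e\<close> leaves two possibilities: a long lattice
  segment on one of its axes (the exceptional edge, or the triangle with vertices
  \<open>(0,0), (4,0), (0,2)\<close>), or a second extreme point opposite to \<open>v\<close>; the two cones then cut out a
  rectangle. If \<open>I\<close> is empty, the polygon is classified by its longest lattice segment.
\<close>

subsection \<open>Integer unimodular maps and lattice sizes of point sets\<close>

text \<open>The obstacle is that a frame that is best for \<open>I\<close> may be bad for
  \<open>D\<close>, so frames must be changed without losing optimality for \<open>I\<close>. The
  frame at \<open>v\<close> keeps it because the functional of the violated side becomes
  \<open>m * x + n * y\<close> with \<open>m\<close> and \<open>n\<close> at least 1, so that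
  \<open>x + y\<close> varies on \<open>I\<close> no more than this functional does. The same
  formula yields the two outcomes: minimality of \<open>e\<close> forces a point of \<open>D\<close>
  with \<open>x + y\<close> at least \<open>e\<close>, while \<open>m * x + n * y\<close> is at most
  \<open>e\<close> on \<open>D\<close>; hence either \<open>m = n = 1\<close>, or that point lies on
  an axis. All that this argument needs to know about convexity is the closure property
  \<open>absorbs\<close>, so it runs over the integers alone; real convex sets enter only when that
  property is established and when the results are translated back. The constant 3 counts one unit
  for each side of the simplex, because a lattice point in the interior satisfies every integral
  side inequality with slack at least 1. The convention -2 for the empty set makes the formula true
  for the unimodular triangle, of size 1.\<close>

definition aff_map ::
    "'a::comm_ring_1 \<Rightarrow> 'a \<Rightarrow> 'a \<Rightarrow> 'a \<Rightarrow> 'a \<Rightarrow> 'a \<Rightarrow> 'a \<times> 'a \<Rightarrow> 'a \<times> 'a" where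
  "aff_map a b c d e f z = (a * fst z + b * snd z + e, c * fst z + d * snd z + f)"

definition int_unimodular :: "(int \<times> int \<Rightarrow> int \<times> int) \<Rightarrow> bool" where
  "int_unimodular U \<longleftrightarrow> (\<exists>a b c d e f. (a * d - b * c = 1 \<or> a * d - b * c = -1) \<and> U = aff_map a b c d e f)"

lemma int_unimodular_aff_map: "a * d - b * c = 1 \<or> a * d - b * c = -1 \<Longrightarrow> int_unimodular (aff_map a b c d e f)"
  unfolding int_unimodular_def by blast

lemma aff_map_apply [simp]: "aff_map a b c d e f (x, y) = (a * x + b * y + e, c * x + d * y + f)"
  by (simp add: aff_map_def)

text \<open>The inverse is the adjugate matrix times \<delta>: since \<delta> is 1 or -1, dividing
  by the determinant is multiplying by it. The ring is left general so that an integer map and its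
  real extension share one inverse formula.\<close>

lemma aff_map_inverse:
  fixes a b c d e f \<delta> :: "'a::comm_ring_1"
  assumes "\<delta> = a * d - b * c" "\<delta> = 1 \<or> \<delta> = -1"
  defines "V \<equiv> aff_map (\<delta> * d) (- \<delta> * b) (- \<delta> * c) (\<delta> * a) (\<delta> * (b * f - d * e)) (\<delta> * (c * e - a * f))"
  shows "V (aff_map a b c d e f z) = z" "aff_map a b c d e f (V z) = z"
proof -
  have dd: "\<delta> * \<delta> = 1" using assms(2) by auto
  obtain x y where z: "z = (x, y)" by (cases z)
  have 1: "\<delta> * d * (a * x + b * y + e) + - \<delta> * b * (c * x + d * y + f) + \<delta> * (b * f - d * e) = \<delta> * \<delta> * x"
    unfolding assms(1) by (simp add: algebra_simps)
  have 2: "- \<delta> * c * (a * x + b * y + e) + \<delta> * a * (c * x + d * y + f) + \<delta> * (c * e - a * f) = \<delta> * \<delta> * y"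
    unfolding assms(1) by (simp add: algebra_simps)
  show "V (aff_map a b c d e f z) = z" unfolding V_def z using 1 2 dd by simp
  have 3: "a * (\<delta> * d * x + - \<delta> * b * y + \<delta> * (b * f - d * e)) + b * (- \<delta> * c * x + \<delta> * a * y + \<delta> * (c * e - a * f)) + e
     = \<delta> * \<delta> * x - \<delta> * \<delta> * e + e"
    unfolding assms(1) by (simp add: algebra_simps)
  have 4: "c * (\<delta> * d * x + - \<delta> * b * y + \<delta> * (b * f - d * e)) + d * (- \<delta> * c * x + \<delta> * a * y + \<delta> * (c * e - a * f)) + f
     = \<delta> * \<delta> * y - \<delta> * \<delta> * f + f"
    unfolding assms(1) by (simp add: algebra_simps)
  show "aff_map a b c d e f (V z) = z" unfolding V_def z using 3 4 dd by simp
qed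

lemma int_unimodular_aff_map_inverse:
  fixes a b c d e f \<delta> :: int
  assumes "\<delta> = a * d - b * c" "\<delta> = 1 \<or> \<delta> = -1"
  shows "int_unimodular (aff_map (\<delta> * d) (- \<delta> * b) (- \<delta> * c) (\<delta> * a) (\<delta> * (b * f - d * e)) (\<delta> * (c * e - a * f)))"
proof (rule int_unimodular_aff_map)
  have "(\<delta> * d) * (\<delta> * a) - (- \<delta> * b) * (- \<delta> * c) = \<delta> * \<delta> * (a * d - b * c)"
    by (simp add: algebra_simps)
  moreover have "\<delta> * \<delta> = 1" using assms(2) by auto
  ultimately show "(\<delta> * d) * (\<delta> * a) - (- \<delta> * b) * (- \<delta> * c) = 1 \<or> (\<delta> * d) * (\<delta> * a) - (- \<delta> * b) * (- \<delta> * c) = -1"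
    using assms by auto
qed

lemma int_unimodular_inverse:
  assumes "int_unimodular U"
  shows "\<exists>V. int_unimodular V \<and> (\<forall>z. V (U z) = z) \<and> (\<forall>z. U (V z) = z)"
proof -
  obtain a b c d e f where *: "a * d - b * c = 1 \<or> a * d - b * c = -1" and U: "U = aff_map a b c d e f"
    using assms unfolding int_unimodular_def by blast
  show ?thesis unfolding U
    using aff_map_inverse[OF refl *] int_unimodular_aff_map_inverse[OF refl *] by blast
qed

lemma int_unimodular_inj:
  assumes "int_unimodular U" "U z = U w"
  shows "z = w"
proof -
  obtain V where "\<forall>z. V (U z) = z" using int_unimodular_inverse[OF assms(1)] by blast
  then show ?thesis using assms(2) by metis
qed

lemma int_unimodular_comp:
  assumes "int_unimodular U" "int_unimodular V"
  shows "int_unimodular (\<lambda>z. V (U z))"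
proof -
  obtain a b c d e f where U: "a * d - b * c = 1 \<or> a * d - b * c = -1" "U = aff_map a b c d e f"
    using assms(1) unfolding int_unimodular_def by blast
  obtain a' b' c' d' e' f' where V: "a' * d' - b' * c' = 1 \<or> a' * d' - b' * c' = -1" "V = aff_map a' b' c' d' e' f'"
    using assms(2) unfolding int_unimodular_def by blast
  have "(a'*a+b'*c) * (c'*b+d'*d) - (a'*b+b'*d) * (c'*a+d'*c) = (a' * d' - b' * c') * (a * d - b * c)"
    by (simp add: algebra_simps)
  then have "int_unimodular (aff_map (a'*a+b'*c) (a'*b+b'*d) (c'*a+d'*c) (c'*b+d'*d) (a'*e+b'*f+e') (c'*e+d'*f+f'))"
    using U(1) V(1) by (intro int_unimodular_aff_map) auto
  moreover have "(\<lambda>z. V (U z)) = aff_map (a'*a+b'*c) (a'*b+b'*d) (c'*a+d'*c) (c'*b+d'*d) (a'*e+b'*f+e') (c'*e+d'*f+f')"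
    unfolding U V by (auto simp: fun_eq_iff aff_map_def algebra_simps)
  ultimately show ?thesis by simp
qed

lemma int_unimodular_image_image:
  assumes "int_unimodular U" "int_unimodular V"
  shows "\<exists>W. int_unimodular W \<and> (\<forall>S. W ` S = V ` U ` S)"
  using int_unimodular_comp[OF assms] by (intro exI[of _ "\<lambda>z. V (U z)"]) (simp add: image_image)

text \<open>The bound is an integer and the set may be empty, so expressions such as
  \<open>d - 1\<close> and \<open>e - 3\<close> need no case split: a nonempty set fits no negative
  bound, the empty set fits every bound.\<close>

definition fits :: "(int \<times> int) set \<Rightarrow> int \<Rightarrow> bool" where
  "fits D d \<longleftrightarrow> (\<exists>U. int_unimodular U \<and> (\<forall>z\<in>D. 0 \<le> fst (U z) \<and> 0 \<le> snd (U z) \<and> fst (U z) + snd (U z) \<le> d))"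

lemma fitsI:
  assumes "int_unimodular U" "\<And>x y. (x, y) \<in> U ` D \<Longrightarrow> 0 \<le> x \<and> 0 \<le> y \<and> x + y \<le> d"
  shows "fits D d"
  unfolding fits_def
proof (intro exI[of _ U] conjI ballI)
  fix z assume "z \<in> D"
  then have "(fst (U z), snd (U z)) \<in> U ` D" by simp
  then show "0 \<le> fst (U z)" "0 \<le> snd (U z)" "fst (U z) + snd (U z) \<le> d"
    using assms(2) by blast+
qed (rule assms(1))

lemma fits_image_iff:
  assumes "int_unimodular U"
  shows "fits (U ` D) d \<longleftrightarrow> fits D d"
proof
  assume "fits (U ` D) d"
  then obtain W where W: "int_unimodular W" "\<forall>z\<in>U ` D. 0 \<le> fst (W z) \<and> 0 \<le> snd (W z) \<and> fst (W z) + snd (W z) \<le> d"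
    unfolding fits_def by blast
  show "fits D d" unfolding fits_def
    using int_unimodular_comp[OF assms W(1)] W(2) by (intro exI[of _ "\<lambda>z. W (U z)"]) simp
next
  assume "fits D d"
  then obtain W where W: "int_unimodular W" "\<forall>z\<in>D. 0 \<le> fst (W z) \<and> 0 \<le> snd (W z) \<and> fst (W z) + snd (W z) \<le> d"
    unfolding fits_def by blast
  obtain V where V: "int_unimodular V" "\<forall>z. V (U z) = z" using int_unimodular_inverse[OF assms] by blast
  show "fits (U ` D) d" unfolding fits_def
    using int_unimodular_comp[OF V(1) W(1)] W(2) V(2) by (intro exI[of _ "\<lambda>z. W (V z)"]) (simp del: split_paired_All)
qed

text \<open>Moving the corner \<open>(A, B)\<close> to the origin turns the three inequalities into
  those of a simplex of size \<open>C - A - B\<close>.\<close>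

lemma fits_simplexI:
  assumes "\<And>x y. (x, y) \<in> D \<Longrightarrow> A \<le> x \<and> B \<le> y \<and> x + y \<le> C" "C - A - B \<le> d"
  shows "fits D d"
proof (rule fitsI[of "aff_map 1 0 0 1 (-A) (-B)"])
  show "int_unimodular (aff_map 1 0 0 1 (-A) (-B))" by (rule int_unimodular_aff_map) simp
next
  fix x y assume "(x, y) \<in> aff_map 1 0 0 1 (- A) (- B) ` D"
  then show "0 \<le> x \<and> 0 \<le> y \<and> x + y \<le> d" using assms by force
qed

text \<open>An integral form of a fact about interiors: a convex combination with positive weight on
  an interior point is interior. The weights are integers \<open>s\<close>, \<open>t\<close>,
  \<open>r\<close> over the common denominator \<open>s + t + r\<close>, which keeps the condition
  free of division.\<close>

definition absorbs :: "(int \<times> int) set \<Rightarrow> (int \<times> int) set \<Rightarrow> bool" where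
  "absorbs D I \<longleftrightarrow> I \<subseteq> D \<and>
    (\<forall>i\<in>I. \<forall>u\<in>D. \<forall>w\<in>D. \<forall>q s t r. 0 < s \<longrightarrow> 0 \<le> t \<longrightarrow> 0 \<le> r \<longrightarrow>
       (s + t + r) * fst q = s * fst i + t * fst u + r * fst w \<longrightarrow>
       (s + t + r) * snd q = s * snd i + t * snd u + r * snd w \<longrightarrow> q \<in> I)"

lemma absorbsD:
  assumes "absorbs D I" "(i1, i2) \<in> I" "(u1, u2) \<in> D" "(w1, w2) \<in> D" "0 < s" "0 \<le> t" "0 \<le> r"
    "(s + t + r) * q1 = s * i1 + t * u1 + r * w1" "(s + t + r) * q2 = s * i2 + t * u2 + r * w2"
  shows "(q1, q2) \<in> I"
  using assms unfolding absorbs_def by (metis fst_conv snd_conv)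

lemma absorbs_image:
  assumes "int_unimodular U" "absorbs D I"
  shows "absorbs (U ` D) (U ` I)"
proof -
  obtain V where V: "int_unimodular V" "\<forall>z. V (U z) = z" "\<forall>z. U (V z) = z" using int_unimodular_inverse[OF assms(1)] by blast
  obtain a b c d e f where Veq: "V = aff_map a b c d e f" using V(1) unfolding int_unimodular_def by blast
  have "q \<in> U ` I" if H: "i \<in> U ` I" "u \<in> U ` D" "w \<in> U ` D" "0 < s" "0 \<le> t" "0 \<le> r"
     "(s + t + r) * fst q = s * fst i + t * fst u + r * fst w"
     "(s + t + r) * snd q = s * snd i + t * snd u + r * snd w" for q i u w s t r
  proof -
    have m: "V i \<in> I" "V u \<in> D" "V w \<in> D" using H V by auto
    \<comment> \<open>An affine form respects weighted means once its constant term is counted with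
      the total weight.\<close>
    have V_lin: "(s + t + r) * (k * fst q + l * snd q + j) = s * (k * fst i + l * snd i + j)
       + t * (k * fst u + l * snd u + j) + r * (k * fst w + l * snd w + j)" for k l j
    proof -
      have "(s + t + r) * (k * fst q + l * snd q + j)
          = k * ((s + t + r) * fst q) + l * ((s + t + r) * snd q) + (s + t + r) * j"
        by (simp add: algebra_simps)
      then show ?thesis unfolding H(7,8) by (simp add: algebra_simps)
    qed
    have "(s + t + r) * fst (V q) = s * fst (V i) + t * fst (V u) + r * fst (V w)"
      unfolding Veq aff_map_def fst_conv by (rule V_lin)
    moreover have "(s + t + r) * snd (V q) = s * snd (V i) + t * snd (V u) + r * snd (V w)"
      unfolding Veq aff_map_def snd_conv by (rule V_lin)
    ultimately have "V q \<in> I" using m H(4-6) assms(2) unfolding absorbs_def by blast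
    then show ?thesis using V(3) by (metis image_eqI)
  qed
  then show ?thesis using assms(2) unfolding absorbs_def by blast
qed

text \<open>Here \<open>v\<close> is the origin and \<open>p\<close> is \<open>(1, 1)\<close>. The
  points \<open>(1, 0)\<close> and \<open>(0, 1)\<close> have values \<open>m\<close> and
  \<open>n\<close>, below the minimum \<open>m + n\<close> on \<open>I\<close>, so they are not in
  \<open>I\<close>. A point on the wrong side of an axis would, together with \<open>(1, 1)\<close>
  and the origin, have one of them as a convex combination with positive weight on \<open>I\<close>.
  For \<open>D\<close> that weight falls on \<open>(1, 1)\<close>, for \<open>I\<close> on the
  offending point itself.\<close>

lemma corner_coords:
  assumes "absorbs D I" "(1, 1) \<in> I" "(0, 0) \<in> D" "1 \<le> m" "1 \<le> n"
    and I: "\<And>x y. (x, y) \<in> I \<Longrightarrow> m + n \<le> m * x + n * y"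
    and D: "\<And>x y. (x, y) \<in> D \<Longrightarrow> 0 \<le> m * x + n * y"
  shows "(x, y) \<in> I \<Longrightarrow> 1 \<le> x \<and> 1 \<le> y" "(x, y) \<in> D \<Longrightarrow> 0 \<le> x \<and> 0 \<le> y"
proof -
  have no: "(1, 0) \<notin> I" "(0, 1) \<notin> I" using I[of 1 0] I[of 0 1] assms(4,5) by auto
  have ID: "I \<subseteq> D" using assms(1) unfolding absorbs_def by blast
  have pos: "0 < x \<or> 0 < y \<or> (x = 0 \<and> y = 0)" if "0 \<le> m * x + n * y" for x y
    using that assms(4,5)
    by (smt (verit, best) mult_nonneg_nonpos mult_pos_neg)
  show "0 \<le> x \<and> 0 \<le> y" if "(x, y) \<in> D"
  proof (rule ccontr)
    assume "\<not> ?thesis"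
    then consider "x < 0" | "y < 0" by linarith
    then show False
    proof cases
      case 1
      then have "1 \<le> y" using pos[OF D[OF that]] by auto
      then show False
        using absorbsD[OF assms(1,2) that assms(3), of "-x" 1 "y - 1" 0 1] 1 no by (simp add: algebra_simps)
    next
      case 2
      then have "1 \<le> x" using pos[OF D[OF that]] by auto
      then show False
        using absorbsD[OF assms(1,2) that assms(3), of "-y" 1 "x - 1" 1 0] 2 no by (simp add: algebra_simps)
    qed
  qed
  show "1 \<le> x \<and> 1 \<le> y" if "(x, y) \<in> I"
  proof (rule ccontr)
    assume "\<not> ?thesis"
    then consider "x \<le> 0" | "y \<le> 0" by linarith
    then show False
    proof cases
      case 1
      then have "1 \<le> y" using pos[of x y] I[OF that] assms(4,5) by auto
      then show False
        using absorbsD[OF assms(1) that subsetD[OF ID assms(2)] assms(3), of 1 "-x" "y - 1" 0 1] 1 no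
        by (simp add: algebra_simps)
    next
      case 2
      then have "1 \<le> x" using pos[of x y] I[OF that] assms(4,5) by auto
      then show False
        using absorbsD[OF assms(1) that subsetD[OF ID assms(2)] assms(3), of 1 "-y" "x - 1" 1 0] 2 no
        by (simp add: algebra_simps)
    qed
  qed
qed

lemma corner:
  assumes ab: "absorbs D I" and cop: "coprime h1 h2" and h: "\<And>z. h z = h1 * fst z + h2 * snd z"
    and p: "p \<in> I" and v: "v \<in> D" and pmin: "\<And>z. z \<in> I \<Longrightarrow> h p \<le> h z"
    and vmin: "\<And>z. z \<in> D \<Longrightarrow> h v \<le> h z" and A: "h p - h v \<ge> 2"
  shows "\<exists>U m n. int_unimodular U \<and> 1 \<le> m \<and> 1 \<le> n \<and> m + n = h p - h v \<and> U v = (0, 0) \<and> U p = (1, 1) \<and>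
    (\<forall>z. h z - h v = m * fst (U z) + n * snd (U z)) \<and>
    (\<forall>x y. (x, y) \<in> U ` I \<longrightarrow> 1 \<le> x \<and> 1 \<le> y) \<and> (\<forall>x y. (x, y) \<in> U ` D \<longrightarrow> 0 \<le> x \<and> 0 \<le> y)"
proof -
  obtain p1 p2 v1 v2 where pv: "p = (p1, p2)" "v = (v1, v2)" by (metis surj_pair)
  define P1 P2 where P: "P1 = p1 - v1" "P2 = p2 - v2"
  define A where "A = h1 * P1 + h2 * P2"
  have A_eq: "A = h p - h v" unfolding A_def P h pv by (simp add: algebra_simps)
  define g where "g = gcd P1 P2"
  obtain k1 k2 where k: "P1 = g * k1" "P2 = g * k2" unfolding g_def by (meson dvdE gcd_dvd1 gcd_dvd2)
  have "g \<noteq> 0" using A A_eq k A_def by auto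
  then have g0: "g > 0" unfolding g_def by (metis gcd_ge_0_int less_le)
  \<comment> \<open>If \<open>p - v\<close> were \<open>g\<close> times a lattice vector, the first
    lattice point after \<open>v\<close> on the way to \<open>p\<close> would be in \<open>I\<close>
    and closer to the side than \<open>p\<close>. So \<open>p - v\<close> is primitive and extends
    to a lattice basis.\<close>
  have "(v1 + k1, v2 + k2) \<in> I"
  proof (rule absorbsD[OF ab])
    show "(p1, p2) \<in> I" "(v1, v2) \<in> D" "(v1, v2) \<in> D" using p v pv by auto
    show "(0::int) < 1" "0 \<le> g - 1" "(0::int) \<le> 0" using g0 by auto
    show "(1 + (g - 1) + 0) * (v1 + k1) = 1 * p1 + (g - 1) * v1 + 0 * v1"
      using k P by (simp add: algebra_simps)
    show "(1 + (g - 1) + 0) * (v2 + k2) = 1 * p2 + (g - 1) * v2 + 0 * v2"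
      using k P by (simp add: algebra_simps)
  qed
  from pmin[OF this] have "A \<le> h1 * k1 + h2 * k2"
    unfolding A_eq using h pv by (simp add: algebra_simps)
  moreover have gA: "g * (h1 * k1 + h2 * k2) = A" unfolding A_def k by (simp add: algebra_simps)
  ultimately have "g = 1" using g0 A A_eq
    by (smt (verit) mult_le_cancel_right2 zero_less_mult_pos)
  then obtain a b where ab1: "a * P1 + b * P2 = 1" using bezout_int[of P1 P2] unfolding g_def by auto
  \<comment> \<open>The second basis vector is determined only up to multiples of \<open>P\<close>.
    Since \<open>h\<close> takes the value \<open>A\<close> on \<open>P\<close>, subtracting
    \<open>k\<close> copies brings its value \<open>m\<close> on \<open>Q\<close> into the range
    from 0 to \<open>A - 1\<close>.\<close>
  define k where "k = (h2 * a - h1 * b) div A"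
  define Q1 Q2 where Q: "Q1 = - b - k * P1" "Q2 = a - k * P2"
  have detPQ: "P1 * Q2 - P2 * Q1 = 1" unfolding Q using ab1 by algebra
  define m where "m = h1 * Q1 + h2 * Q2"
  have "m = (h2 * a - h1 * b) - k * A" unfolding m_def Q A_def by (simp add: algebra_simps)
  then have m_mod: "m = (h2 * a - h1 * b) mod A" unfolding k_def by (simp add: minus_div_mult_eq_mod)
  then have m: "0 \<le> m" "m < A" using A A_eq by auto
  define R1 R2 where R: "R1 = P1 - Q1" "R2 = P2 - Q2"
  define n where "n = h1 * R1 + h2 * R2"
  have mn: "m + n = A" unfolding m_def n_def R A_def by (simp add: algebra_simps)
  \<comment> \<open>By Cramer's rule \<open>h1\<close> and \<open>h2\<close> are combinations of
    \<open>A\<close> and \<open>m\<close>; if \<open>m\<close> vanished, \<open>A\<close>, which is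
    at least 2, would divide both, against coprimality.\<close>
  have "m \<noteq> 0"
  proof
    assume "m = 0"
    have "h1 = A * Q2 - P2 * m" unfolding A_def m_def using detPQ by algebra
    moreover have "h2 = P1 * m - A * Q1" unfolding A_def m_def using detPQ by algebra
    ultimately have "A dvd h1" "A dvd h2" using \<open>m = 0\<close> by auto
    then have "is_unit A" using cop coprime_common_divisor by blast
    then show False using A A_eq by auto
  qed
  with m have m1: "1 \<le> m" and n1: "1 \<le> n" using mn by auto
  \<comment> \<open>Coordinates of \<open>z - v\<close> in the basis \<open>Q\<close>,
    \<open>R\<close>, by Cramer's rule; \<open>p\<close> becomes \<open>(1, 1)\<close> because
    \<open>P = Q + R\<close>.\<close>
  define U where "U = aff_map (- R2) R1 Q2 (- Q1) (R2 * v1 - R1 * v2) (Q1 * v2 - Q2 * v1)"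
  have U: "int_unimodular U" unfolding U_def R by (intro int_unimodular_aff_map) (use detPQ in algebra)
  have Uv: "U v = (0, 0)" unfolding U_def pv by (simp add: algebra_simps)
  have "- R2 * p1 + R1 * p2 + (R2 * v1 - R1 * v2) = P1 * Q2 - P2 * Q1"
    "Q2 * p1 + - Q1 * p2 + (Q1 * v2 - Q2 * v1) = P1 * Q2 - P2 * Q1" unfolding R P by (simp_all add: algebra_simps)
  then have Up: "U p = (1, 1)" unfolding U_def pv using detPQ by simp
  have hU: "h z - h v = m * fst (U z) + n * snd (U z)" for z
  proof -
    have "m * fst (U z) + n * snd (U z) = (P1 * Q2 - P2 * Q1) * (h z - h v)"
      unfolding U_def aff_map_def m_def n_def R h pv fst_conv snd_conv by (simp add: algebra_simps)
    then show ?thesis using detPQ by simp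
  qed
  have ab': "absorbs (U ` D) (U ` I)" by (rule absorbs_image[OF U ab])
  have 1: "(1, 1) \<in> U ` I" "(0, 0) \<in> U ` D" using Up Uv p v by (metis image_eqI)+
  have 2: "m + n \<le> m * x + n * y" if xy: "(x, y) \<in> U ` I" for x y
  proof -
    from xy obtain z where "z \<in> I" "U z = (x, y)" by (metis imageE)
    then show ?thesis using hU[of z] pmin[of z] A_eq mn by simp
  qed
  have 3: "0 \<le> m * x + n * y" if "(x, y) \<in> U ` D" for x y
  proof -
    from that obtain z where "z \<in> D" "U z = (x, y)" by (metis imageE)
    then show ?thesis using hU[of z] vmin[of z] by simp
  qed
  show ?thesis
    by (intro exI[of _ U] exI[of _ m] exI[of _ n] conjI allI impI U m1 n1 mn[unfolded A_eq] Uv Up hU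
        corner_coords[OF ab' 1 m1 n1 2 3])
qed

subsection \<open>Extremal frames\<close>

text \<open>The numbers \<open>A, B, C\<close> bound how far \<open>D\<close> reaches beyond the three sides of the simplex of
  size \<open>d\<close> that contains \<open>I\<close>.\<close>

definition co_fits :: "(int \<times> int) set \<Rightarrow> (int \<times> int) set \<Rightarrow> int \<Rightarrow> int \<Rightarrow> bool" where
  "co_fits D I d e \<longleftrightarrow> (\<exists>U A B C. int_unimodular U \<and>
     (\<forall>x y. (x, y) \<in> U ` I \<longrightarrow> 1 \<le> x \<and> 1 \<le> y \<and> x + y \<le> d + 2) \<and>
     (\<forall>x y. (x, y) \<in> U ` D \<longrightarrow> 1 - A \<le> x \<and> 1 - B \<le> y \<and> x + y \<le> d + 2 + C) \<and>
     e = d + A + B + C)"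

lemma co_fitsI:
  assumes "int_unimodular U" "\<And>x y. (x, y) \<in> U ` I \<Longrightarrow> 1 \<le> x \<and> 1 \<le> y \<and> x + y \<le> d + 2"
    "\<And>x y. (x, y) \<in> U ` D \<Longrightarrow> 1 - A \<le> x \<and> 1 - B \<le> y \<and> x + y \<le> d + 2 + C" "e = d + A + B + C"
  shows "co_fits D I d e"
  unfolding co_fits_def using assms by blast

lemma co_fits_image:
  assumes "int_unimodular W" "co_fits (W ` D) (W ` I) d e"
  shows "co_fits D I d e"
proof -
  obtain U A B C where U: "int_unimodular U"
     "\<And>x y. (x, y) \<in> U ` W ` I \<Longrightarrow> 1 \<le> x \<and> 1 \<le> y \<and> x + y \<le> d + 2"
     "\<And>x y. (x, y) \<in> U ` W ` D \<Longrightarrow> 1 - A \<le> x \<and> 1 - B \<le> y \<and> x + y \<le> d + 2 + C"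
     "e = d + A + B + C"
    using assms(2) unfolding co_fits_def by blast
  obtain V where "int_unimodular V \<and> (\<forall>S. V ` S = U ` W ` S)"
    using int_unimodular_image_image[OF assms(1) U(1)] by blast
  then have V: "int_unimodular V" "\<And>S. V ` S = U ` W ` S" by auto
  show ?thesis by (rule co_fitsI[OF V(1)]) (use U V(2) in auto)
qed

lemma int_unimodular_swap: "int_unimodular (aff_map 0 1 1 0 0 0)"
  by (rule int_unimodular_aff_map) simp

lemma mem_swap_image: "(x::int, y) \<in> aff_map 0 1 1 0 0 0 ` S \<longleftrightarrow> (y, x) \<in> S"
  by (force simp: aff_map_def image_iff)

text \<open>Row 0 of \<open>D\<close> then has at least \<open>d + 5\<close> lattice points and row
  1 of \<open>I\<close> at most \<open>d + 1\<close>. This is the common source of the exceptional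
  edge (\<open>d\<close> positive) and of the triangle with legs 4 and 2
  (\<open>d = 0\<close>).\<close>

definition long_axis :: "(int \<times> int) set \<Rightarrow> (int \<times> int) set \<Rightarrow> int \<Rightarrow> bool" where
  "long_axis D I d \<longleftrightarrow> (\<exists>U L. int_unimodular U \<and> d + 4 \<le> L \<and> (0, 0) \<in> U ` D \<and> (L, 0) \<in> U ` D \<and> (1, 1) \<in> U ` I \<and>
     (\<forall>x y. (x, y) \<in> U ` D \<longrightarrow> 0 \<le> x \<and> 0 \<le> y) \<and>
     (\<forall>x y. (x, y) \<in> U ` I \<longrightarrow> 1 \<le> x \<and> 1 \<le> y \<and> x + y \<le> d + 2))"

definition rectangular :: "(int \<times> int) set \<Rightarrow> bool" where
  "rectangular D \<longleftrightarrow> (\<exists>U a b. int_unimodular U \<and> 2 \<le> a \<and> 2 \<le> b \<and> {(0, 0), (a, 0), (0, b), (a, b)} \<subseteq> U ` D \<and>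
     (\<forall>x y. (x, y) \<in> U ` D \<longrightarrow> 0 \<le> x \<and> x \<le> a \<and> 0 \<le> y \<and> y \<le> b))"

lemma long_axisI:
  assumes "int_unimodular U" "d + 4 \<le> L" "(0, 0) \<in> U ` D" "(L, 0) \<in> U ` D" "(1, 1) \<in> U ` I"
     "\<And>x y. (x, y) \<in> U ` D \<Longrightarrow> 0 \<le> x \<and> 0 \<le> y"
     "\<And>x y. (x, y) \<in> U ` I \<Longrightarrow> 1 \<le> x \<and> 1 \<le> y \<and> x + y \<le> d + 2"
   shows "long_axis D I d"
  using assms unfolding long_axis_def by blast

lemma long_axis_swapI:
  assumes "int_unimodular U" "d + 4 \<le> L" "(0, 0) \<in> U ` D" "(0, L) \<in> U ` D" "(1, 1) \<in> U ` I"
     "\<And>x y. (x, y) \<in> U ` D \<Longrightarrow> 0 \<le> x \<and> 0 \<le> y"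
     "\<And>x y. (x, y) \<in> U ` I \<Longrightarrow> 1 \<le> x \<and> 1 \<le> y \<and> x + y \<le> d + 2"
   shows "long_axis D I d"
proof -
  obtain V where "int_unimodular V \<and> (\<forall>S. V ` S = aff_map 0 1 1 0 0 0 ` U ` S)"
    using int_unimodular_image_image[OF assms(1) int_unimodular_swap] by blast
  then have V: "int_unimodular V" "\<And>S. V ` S = aff_map 0 1 1 0 0 0 ` U ` S" by auto
  show ?thesis
  proof (rule long_axisI[OF V(1) assms(2)])
    show "0 \<le> x \<and> 0 \<le> y" if "(x, y) \<in> V ` D" for x y
      using that assms(6)[of y x] unfolding V(2) mem_swap_image by simp
    show "1 \<le> x \<and> 1 \<le> y \<and> x + y \<le> d + 2" if "(x, y) \<in> V ` I" for x y
      using that assms(7)[of y x] unfolding V(2) mem_swap_image by simp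
  qed (use assms in \<open>simp_all add: V(2) mem_swap_image\<close>)
qed

lemma long_axis_image:
  assumes "int_unimodular W" "long_axis (W ` D) (W ` I) d"
  shows "long_axis D I d"
proof -
  obtain U L where U: "int_unimodular U" "d + 4 \<le> L" "(0, 0) \<in> U ` W ` D" "(L, 0) \<in> U ` W ` D" "(1, 1) \<in> U ` W ` I"
     "\<And>x y. (x, y) \<in> U ` W ` D \<Longrightarrow> 0 \<le> x \<and> 0 \<le> y"
     "\<And>x y. (x, y) \<in> U ` W ` I \<Longrightarrow> 1 \<le> x \<and> 1 \<le> y \<and> x + y \<le> d + 2"
    using assms(2) unfolding long_axis_def by blast
  obtain V where "int_unimodular V \<and> (\<forall>S. V ` S = U ` W ` S)"
    using int_unimodular_image_image[OF assms(1) U(1)] by blast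
  then have V: "int_unimodular V" "\<And>S. V ` S = U ` W ` S" by auto
  show ?thesis by (rule long_axisI[OF V(1) U(2)]) (use U V(2) in auto)
qed

lemma rectangular_image:
  assumes "int_unimodular W" "rectangular (W ` D)"
  shows "rectangular D"
proof -
  obtain U a b where U: "int_unimodular U" "2 \<le> a" "2 \<le> b" "{(0, 0), (a, 0), (0, b), (a, b)} \<subseteq> U ` W ` D"
     "\<forall>x y. (x, y) \<in> U ` W ` D \<longrightarrow> 0 \<le> x \<and> x \<le> a \<and> 0 \<le> y \<and> y \<le> b"
    using assms(2) unfolding rectangular_def by blast
  obtain V where "int_unimodular V \<and> (\<forall>S. V ` S = U ` W ` S)"
    using int_unimodular_image_image[OF assms(1) U(1)] by blast
  then have V: "int_unimodular V" "\<And>S. V ` S = U ` W ` S" by auto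
  show ?thesis unfolding rectangular_def
    by (rule exI[of _ V], rule exI[of _ a], rule exI[of _ b]) (use U V in auto)
qed

text \<open>The functional \<open>h\<close> belongs to a side beyond which \<open>D\<close> reaches
  at least two units further than \<open>I\<close>. Its range on \<open>I\<close> is at most
  \<open>d\<close>, so the corner frame still encloses \<open>I\<close> in size \<open>d\<close> and
  competes in the minimization of \<open>e\<close>. As long axes are excluded, it must have
  \<open>m = n = 1\<close>, and then the gap is exactly 2 and \<open>D\<close> touches the side
  opposite to \<open>v\<close>.\<close>

lemma corner_step:
  assumes ab: "absorbs D I" and mine: "\<not> co_fits D I d (e - 1)" and e: "d + 4 \<le> e"
    and cop: "coprime h1 h2" and h: "\<And>z. h z = h1 * fst z + h2 * snd z"
    and p: "p \<in> I" and v: "v \<in> D" and pmin: "\<And>z. z \<in> I \<Longrightarrow> h p \<le> h z"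
    and vmin: "\<And>z. z \<in> D \<Longrightarrow> h v \<le> h z" and A: "h p - h v \<ge> 2"
    and prange: "\<And>z. z \<in> I \<Longrightarrow> h z \<le> h p + d" and vrange: "\<And>z. z \<in> D \<Longrightarrow> h z \<le> h v + e"
    and notlong: "\<not> long_axis D I d"
  shows "\<exists>U u. int_unimodular U \<and> U v = (0, 0) \<and> (1, 1) \<in> U ` I \<and> h p - h v = 2 \<and>
    (\<forall>z. fst (U z) + snd (U z) = h z - h v) \<and>
    (\<forall>x y. (x, y) \<in> U ` I \<longrightarrow> 1 \<le> x \<and> 1 \<le> y \<and> x + y \<le> d + 2) \<and>
    (\<forall>x y. (x, y) \<in> U ` D \<longrightarrow> 0 \<le> x \<and> 0 \<le> y \<and> x + y \<le> e) \<and>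
    u \<in> D \<and> fst (U u) + snd (U u) = e"
proof -
  obtain U m n where U: "int_unimodular U" "1 \<le> m" "1 \<le> n" "m + n = h p - h v" "U v = (0, 0)" "U p = (1, 1)"
    and hU: "\<forall>z. h z - h v = m * fst (U z) + n * snd (U z)"
    and UI: "\<forall>x y. (x, y) \<in> U ` I \<longrightarrow> 1 \<le> x \<and> 1 \<le> y"
    and UD: "\<forall>x y. (x, y) \<in> U ` D \<longrightarrow> 0 \<le> x \<and> 0 \<le> y"
    using corner[OF ab cop h p v pmin vmin A] by blast
  note hU = hU[rule_format] and UI = UI[rule_format] and UD = UD[rule_format]
  have UI': "1 \<le> x \<and> 1 \<le> y \<and> x + y \<le> d + 2" if xy: "(x, y) \<in> U ` I" for x y
  proof -
    obtain z where z: "z \<in> I" "U z = (x, y)" using xy by (metis imageE)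
    have "m * x + n * y \<le> m + n + d" using hU[of z] prange[OF z(1)] z(2) U(4) by simp
    then have "m * (x - 1) + n * (y - 1) \<le> d" by (simp add: algebra_simps)
    moreover have "1 * (x - 1) + 1 * (y - 1) \<le> m * (x - 1) + n * (y - 1)"
      using UI[OF xy] U(2,3) by (intro add_mono mult_right_mono) simp_all
    ultimately have "1 * (x - 1) + 1 * (y - 1) \<le> d" by (rule order_trans[rotated])
    then show ?thesis using UI[OF xy] by simp
  qed
  have 00: "(0, 0) \<in> U ` D" and 11: "(1, 1) \<in> U ` I" using U(5,6) p v by (metis image_eqI)+
  have "\<exists>u\<in>D. e \<le> fst (U u) + snd (U u)"
  proof (rule ccontr)
    assume "\<not> ?thesis"
    then have lt: "\<forall>u\<in>D. fst (U u) + snd (U u) < e" by auto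
    have "x + y < e" if "(x, y) \<in> U ` D" for x y
      using that lt by (metis fst_conv imageE snd_conv)
    \<comment> \<open>With offsets 1, 1 and \<open>e - d - 3\<close> the three bounds on
      \<open>D\<close> read \<open>0 \<le> x\<close>, \<open>0 \<le> y\<close> and
      \<open>x + y \<le> e - 1\<close>, contradicting the minimality of \<open>e\<close>.\<close>
    then have "co_fits D I d (e - 1)"
      using UI' UD by (intro co_fitsI[OF U(1), where A = 1 and B = 1 and C = "e - d - 3"]) force+
    then show False using mine by simp
  qed
  then obtain u where u: "u \<in> D" "e \<le> fst (U u) + snd (U u)" by blast
  obtain x y where xy: "U u = (x, y)" by fastforce
  then have xyD: "(x, y) \<in> U ` D" using u(1) by (metis image_eqI)
  have "m * x + n * y \<le> e" using hU[of u] vrange[OF u(1)] xy by simp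
  \<comment> \<open>Compares the upper bound \<open>e\<close> for \<open>m * x + n * y\<close> with
    the lower bound \<open>e\<close> for \<open>x + y\<close>. Both summands are nonnegative, so
    they vanish, and an excess of \<open>m\<close> or \<open>n\<close> over 1 puts \<open>u\<close>
    on an axis.\<close>
  then have "(m - 1) * x + (n - 1) * y \<le> 0" using u(2) xy by (simp add: algebra_simps)
  moreover have "0 \<le> (m - 1) * x" "0 \<le> (n - 1) * y" using UD[OF xyD] U(2,3) by auto
  ultimately have 0: "(m - 1) * x = 0" "(n - 1) * y = 0" by linarith+
  have "m = 1 \<and> n = 1"
  proof (rule ccontr)
    assume "\<not> ?thesis"
    then have "x = 0 \<or> y = 0" using 0 by auto
    then show False
    proof
      assume "x = 0"
      then show False using long_axis_swapI[OF U(1) _ 00 _ 11 UD UI', of y] xyD u(2) e xy notlong by auto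
    next
      assume "y = 0"
      then show False using long_axisI[OF U(1) _ 00 _ 11 UD UI', of x] xyD u(2) e xy notlong by auto
    qed
  qed
  then have mn: "m = 1" "n = 1" by auto
  have sum: "fst (U z) + snd (U z) = h z - h v" for z using hU[of z] mn by simp
  have UD': "0 \<le> x \<and> 0 \<le> y \<and> x + y \<le> e" if xy: "(x, y) \<in> U ` D" for x y
  proof -
    obtain z where z: "z \<in> D" "U z = (x, y)" using xy by (metis imageE)
    then show ?thesis using UD[OF xy] sum[of z] vrange[of z] by simp
  qed
  have "fst (U u) + snd (U u) = e" using u(2) UD'[of x y] xyD xy by simp
  moreover have "h p - h v = 2" using U(4) mn by simp
  ultimately show ?thesis using U(1,5) 11 sum UI' UD' u(1) by blast
qed

text \<open>The opposite side \<open>x + y = e\<close> is also a side with large gap, so the corner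
  argument applies at \<open>(a, b)\<close> too. Its frame turns out to be the half turn exchanging
  the origin with \<open>(a, b)\<close>, possibly followed by a swap; the cones at the two corners
  then intersect in the box with sides \<open>a\<close> and \<open>b\<close>.\<close>

lemma two_corners:
  assumes ab: "absorbs D I" and mine: "\<not> co_fits D I d (e - 1)" and e: "d + 4 \<le> e"
    and ID: "\<And>x y. (x, y) \<in> I \<Longrightarrow> 1 \<le> x \<and> 1 \<le> y \<and> x + y \<le> d + 2"
    and DD: "\<And>x y. (x, y) \<in> D \<Longrightarrow> 0 \<le> x \<and> 0 \<le> y \<and> x + y \<le> e"
    and I1: "\<not> fits I (d - 1)" and D3: "\<not> fits D (d + 3)"
    and D0: "(0, 0) \<in> D" and I11: "(1, 1) \<in> I" and u: "(a, b) \<in> D" "a + b = e"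
    and notlong: "\<not> long_axis D I d"
  shows "rectangular D"
proof -
  have id: "int_unimodular (aff_map 1 0 0 1 0 0)" by (rule int_unimodular_aff_map) simp
  have idim: "aff_map 1 0 0 1 0 0 ` S = S" for S :: "(int \<times> int) set" by (auto simp: aff_map_def image_iff)
  define h where "h = (\<lambda>z::int \<times> int. (-1) * fst z + (-1) * snd z)"
  obtain p where p: "p \<in> I" "d + 2 = fst p + snd p"
  proof -
    have "\<not> (\<forall>x y. (x, y) \<in> I \<longrightarrow> x + y \<le> d + 1)"
      using I1 ID fits_simplexI[of I 1 1 "d + 1" "d - 1"] by auto
    then obtain x y where "(x, y) \<in> I" "d + 1 < x + y" by auto
    then show thesis using that[of "(x, y)"] ID[of x y] by auto
  qed
  have I0: "1 \<le> fst z \<and> 1 \<le> snd z \<and> fst z + snd z \<le> d + 2" if "z \<in> I" for z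
    using ID[of "fst z" "snd z"] that by simp
  have DD0: "0 \<le> fst z \<and> 0 \<le> snd z \<and> fst z + snd z \<le> e" if "z \<in> D" for z
    using DD[of "fst z" "snd z"] that by simp
  have "\<exists>U u. int_unimodular U \<and> U (a, b) = (0, 0) \<and> (1, 1) \<in> U ` I \<and> h p - h (a, b) = 2 \<and>
    (\<forall>z. fst (U z) + snd (U z) = h z - h (a, b)) \<and>
    (\<forall>x y. (x, y) \<in> U ` I \<longrightarrow> 1 \<le> x \<and> 1 \<le> y \<and> x + y \<le> d + 2) \<and>
    (\<forall>x y. (x, y) \<in> U ` D \<longrightarrow> 0 \<le> x \<and> 0 \<le> y \<and> x + y \<le> e) \<and>
    u \<in> D \<and> fst (U u) + snd (U u) = e"
  proof (rule corner_step[OF ab mine e _ _ p(1) u(1) _ _ _ _ _ notlong, of "-1" "-1" h])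
    show "h z = - 1 * fst z + - 1 * snd z" for z by (simp add: h_def)
    show "h p \<le> h z" if "z \<in> I" for z using I0[OF that] p by (simp add: h_def)
    show "h (a, b) \<le> h z" if "z \<in> D" for z using DD0[OF that] u by (simp add: h_def)
    show "2 \<le> h p - h (a, b)" using p u e by (simp add: h_def)
    show "h z \<le> h p + d" if "z \<in> I" for z using I0[OF that] p by (simp add: h_def)
    show "h z \<le> h (a, b) + e" if "z \<in> D" for z using DD0[OF that] u by (simp add: h_def)
  qed simp
  then obtain U where U: "int_unimodular U" "U (a, b) = (0, 0)" "h p - h (a, b) = 2"
    and 11: "(1, 1) \<in> U ` I"
    and sum: "\<forall>z. fst (U z) + snd (U z) = h z - h (a, b)"
    and UI: "\<forall>x y. (x, y) \<in> U ` I \<longrightarrow> 1 \<le> x \<and> 1 \<le> y \<and> x + y \<le> d + 2"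
    and UD: "\<forall>x y. (x, y) \<in> U ` D \<longrightarrow> 0 \<le> x \<and> 0 \<le> y \<and> x + y \<le> e"
    by blast
  note sum = sum[rule_format] and UI = UI[rule_format] and UD = UD[rule_format]
  \<comment> \<open>At the opposite side the gap between \<open>D\<close> and \<open>I\<close> is
    \<open>e - (d + 2)\<close>, and the second corner frame forces it to be 2.\<close>
  have ed: "e = d + 4" using U(3) p(2) u(2) by (simp add: h_def)
  obtain k l m n X Y where det: "k * n - l * m = 1 \<or> k * n - l * m = -1" and Ueq: "U = aff_map k l m n X Y"
    using U(1) unfolding int_unimodular_def by blast
  have U00: "(0, 0) \<in> U ` D" using U(2) u(1) by (metis image_eqI)
  have XYD: "(X, Y) \<in> U ` D" using D0 by (rule rev_image_eqI) (simp add: Ueq)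
  have XY: "X + Y = e" using sum[of "(0, 0)"] u(2) by (simp add: h_def Ueq)
  \<comment> \<open>The coordinate sum of \<open>U\<close> is \<open>e - x - y\<close>. This
    expresses the second matrix row by the first and reduces the determinant to
    \<open>l - k\<close>.\<close>
  have "k + X + (m + Y) = e - 1" using sum[of "(1, 0)"] u(2) by (simp add: h_def Ueq)
  then have m: "m = - 1 - k" using XY by simp
  have "l + X + (n + Y) = e - 1" using sum[of "(0, 1)"] u(2) by (simp add: h_def Ueq)
  then have n: "n = - 1 - l" using XY by simp
  have "k * n - l * m = l - k" unfolding m n by (simp add: algebra_simps)
  then have lk: "l = k + 1 \<or> l = k - 1" using det by auto
  have Uab: "k * a + l * b + X = 0" using U(2) by (simp add: Ueq)
  have dge: "0 \<le> d" using ID[OF I11] by simp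
  \<comment> \<open>The origin is mapped to \<open>(X, Y)\<close> with \<open>X + Y = e\<close>; on
    an axis it would form, with the image \<open>(0, 0)\<close> of \<open>(a, b)\<close>, a long
    axis.\<close>
  have Y0: "Y \<noteq> 0"
  proof
    assume "Y = 0"
    then have "long_axis D I d"
      using long_axisI[OF U(1) _ U00 _ 11 _ UI, of X] UD XYD XY ed by auto
    then show False using notlong by simp
  qed
  have X0: "X \<noteq> 0"
  proof
    assume "X = 0"
    then have "long_axis D I d"
      using long_axis_swapI[OF U(1) _ U00 _ 11 _ UI, of Y] UD XYD XY ed by auto
    then show False using notlong by simp
  qed
  have Xb: "0 < X" "X < e" using X0 Y0 UD[OF XYD] XY by auto
  have ab0: "0 \<le> a" "0 \<le> b" using DD[OF u(1)] by auto
  have e0: "0 < e" using ed dge by simp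
  \<comment> \<open>The first coordinate of \<open>U (a, b) = (0, 0)\<close> makes
    \<open>k * e\<close> equal to \<open>- (b + X)\<close>, strictly between \<open>-2 * e\<close>
    and 0, or to \<open>b - X\<close>, strictly between \<open>- e\<close> and \<open>e\<close>. So
    \<open>k\<close> is -1 in the first case and 0 in the second.\<close>
  have "(k = -1 \<and> l = 0 \<and> b = Y) \<or> (k = 0 \<and> l = -1 \<and> b = X)"
    using lk
  proof
    assume l: "l = k + 1"
    have "k * e + b + X = 0" using Uab u(2) unfolding l by (simp add: algebra_simps flip: u(2))
    moreover have "k < 0"
    proof (rule ccontr)
      assume "\<not> k < 0"
      then have "0 \<le> k * e" using e0 by simp
      then show False using calculation ab0 Xb by linarith
    qed
    moreover have "-2 < k"
    proof (rule ccontr)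
      assume "\<not> -2 < k"
      then have "k * e \<le> (-2) * e" using e0 by (intro mult_right_mono) auto
      then show False using calculation(1) ab0 Xb u(2) by linarith
    qed
    ultimately have "k = -1" by simp
    then show ?thesis using l \<open>k * e + b + X = 0\<close> XY by simp
  next
    assume l: "l = k - 1"
    have eq: "k * e - b + X = 0" using Uab u(2) unfolding l by (simp add: algebra_simps flip: u(2))
    have "k < 1"
    proof (rule ccontr)
      assume "\<not> k < 1"
      then have "1 * e \<le> k * e" using e0 by (intro mult_right_mono) auto
      then show False using eq ab0 Xb u(2) by linarith
    qed
    moreover have "-1 < k"
    proof (rule ccontr)
      assume "\<not> -1 < k"
      then have "k * e \<le> (-1) * e" using e0 by (intro mult_right_mono) auto
      then show False using eq ab0 Xb u(2) by linarith
    qed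
    ultimately have "k = 0" by simp
    then show ?thesis using l eq XY by simp
  qed
  then have Uform: "(\<forall>x y. U (x, y) = (a - x, b - y)) \<or> (\<forall>x y. U (x, y) = (b - y, a - x))"
    using XY u(2) unfolding Ueq m n by auto
  have box: "0 \<le> x \<and> x \<le> a \<and> 0 \<le> y \<and> y \<le> b" if "(x, y) \<in> D" for x y
  proof -
    have "U (x, y) \<in> U ` D" using that by (rule imageI)
    moreover have "U (x, y) = (a - x, b - y) \<or> U (x, y) = (b - y, a - x)" using Uform by blast
    ultimately show ?thesis using UD[of "a - x" "b - y"] UD[of "b - y" "a - x"] DD[OF that] by auto
  qed
  have "U (1, 1) \<in> U ` I" using I11 by (rule imageI)
  moreover have "U (1, 1) = (a - 1, b - 1) \<or> U (1, 1) = (b - 1, a - 1)" using Uform by blast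
  ultimately have ab2: "2 \<le> a" "2 \<le> b"
    using UI[of "a - 1" "b - 1"] UI[of "b - 1" "a - 1"] by auto
  \<comment> \<open>After reflecting the box in its horizontal midline, \<open>(a, 0)\<close> is the
    only point with coordinate sum \<open>a + b = d + 4\<close>. If it were missing from
    \<open>D\<close>, then \<open>D\<close> would fit size \<open>d + 3\<close>. The corner
    \<open>(0, b)\<close> is treated alike.\<close>
  have "(a, 0) \<in> D"
  proof (rule ccontr)
    assume no: "(a, 0) \<notin> D"
    have "fits D (d + 3)"
    proof (rule fitsI[of "aff_map 1 0 0 (-1) 0 b"])
      fix x y assume "(x, y) \<in> aff_map 1 0 0 (-1) 0 b ` D"
      then obtain x' y' where D': "(x', y') \<in> D" "x = x'" "y = b - y'" by auto
      moreover have "x' \<noteq> a \<or> y' \<noteq> 0" using D' no by auto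
      ultimately show "0 \<le> x \<and> 0 \<le> y \<and> x + y \<le> d + 3" using box[OF D'(1)] u(2) ed by auto
    qed (rule int_unimodular_aff_map, simp)
    then show False using D3 by simp
  qed
  moreover have "(0, b) \<in> D"
  proof (rule ccontr)
    assume no: "(0, b) \<notin> D"
    have "fits D (d + 3)"
    proof (rule fitsI[of "aff_map (-1) 0 0 1 a 0"])
      fix x y assume "(x, y) \<in> aff_map (-1) 0 0 1 a 0 ` D"
      then obtain x' y' where D': "(x', y') \<in> D" "x = a - x'" "y = y'" by auto
      moreover have "x' \<noteq> 0 \<or> y' \<noteq> b" using D' no by auto
      ultimately show "0 \<le> x \<and> 0 \<le> y \<and> x + y \<le> d + 3" using box[OF D'(1)] u(2) ed by auto
    qed (rule int_unimodular_aff_map, simp)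
    then show False using D3 by simp
  qed
  ultimately show ?thesis unfolding rectangular_def
    by (intro exI[of _ "aff_map 1 0 0 1 0 0"] exI[of _ a] exI[of _ b] conjI id)
       (use D0 u box ab2 in \<open>auto simp: idim\<close>)
qed

lemma co_fits_imp_fits:
  assumes "co_fits D I d e"
  shows "fits D e"
proof -
  obtain U A B C where U: "int_unimodular U"
     "\<And>x y. (x, y) \<in> U ` D \<Longrightarrow> 1 - A \<le> x \<and> 1 - B \<le> y \<and> x + y \<le> d + 2 + C" "e = d + A + B + C"
    using assms unfolding co_fits_def by blast
  have "fits (U ` D) e" by (rule fits_simplexI[OF U(2)]) (use U(3) in auto)
  then show ?thesis using fits_image_iff[OF U(1)] by simp
qed

lemma fits_imp_nonneg: "fits D e \<Longrightarrow> D \<noteq> {} \<Longrightarrow> 0 \<le> e"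
  unfolding fits_def by fastforce

text \<open>The offsets may be arbitrary integers, but \<open>e\<close> is the size of a simplex
  around the nonempty set \<open>D\<close> and hence nonnegative, so a least value exists.\<close>

lemma minimal_co_fits:
  assumes "finite D" "D \<noteq> {}" "fits I d"
  obtains e where "co_fits D I d e" "\<not> co_fits D I d (e - 1)"
proof -
  obtain W where W: "int_unimodular W" "\<forall>z\<in>I. 0 \<le> fst (W z) \<and> 0 \<le> snd (W z) \<and> fst (W z) + snd (W z) \<le> d"
    using assms(3) unfolding fits_def by blast
  have sh: "int_unimodular (aff_map 1 0 0 1 1 1)" by (rule int_unimodular_aff_map) simp
  define U where "U = (\<lambda>z. aff_map 1 0 0 1 1 1 (W z))"
  have U: "int_unimodular U" "\<And>z. U z = aff_map 1 0 0 1 1 1 (W z)"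
    unfolding U_def using int_unimodular_comp[OF W(1) sh] by auto
  define N where "N = Max ((\<lambda>z. \<bar>fst (U z)\<bar> + \<bar>snd (U z)\<bar>) ` D)"
  have N: "\<bar>fst (U z)\<bar> + \<bar>snd (U z)\<bar> \<le> N" if "z \<in> D" for z
    unfolding N_def using assms(1) that by (intro Max_ge) auto
  have N': "\<bar>x\<bar> + \<bar>y\<bar> \<le> N" if "(x, y) \<in> U ` D" for x y
    using that N by (metis fst_conv imageE snd_conv)
  have UI: "1 \<le> x \<and> 1 \<le> y \<and> x + y \<le> d + 2" if xy: "(x, y) \<in> U ` I" for x y
  proof -
    obtain z where z: "z \<in> I" "U z = (x, y)" using xy by (metis imageE)
    then show ?thesis using W(2) U(2)[of z] by (auto simp: aff_map_def)
  qed
  \<comment> \<open>Offsets for which the three bounds on \<open>D\<close> become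
    \<open>- N \<le> x\<close>, \<open>- N \<le> y\<close> and \<open>x + y \<le> N\<close>.\<close>
  define e0 where "e0 = d + (1 + N) + (1 + N) + (N - d - 2)"
  have co: "co_fits D I d e0"
    by (rule co_fitsI[OF U(1), where A = "1 + N" and B = "1 + N" and C = "N - d - 2"])
       (use UI N' in \<open>force simp: e0_def\<close>)+
  have pos: "0 \<le> e" if "co_fits D I d e" for e
    using fits_imp_nonneg[OF co_fits_imp_fits[OF that] assms(2)] .
  define k where "k = (LEAST k::nat. co_fits D I d (int k))"
  have ex: "co_fits D I d (int (nat e0))" using co pos[OF co] by simp
  have "co_fits D I d (int k)" unfolding k_def by (rule LeastI[of "\<lambda>k. co_fits D I d (int k)", OF ex])
  moreover have "\<not> co_fits D I d (int k - 1)"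
  proof
    assume c: "co_fits D I d (int k - 1)"
    then have "0 \<le> int k - 1" by (rule pos)
    then have "co_fits D I d (int (k - 1))" "k \<ge> 1" using c by (auto simp: of_nat_diff)
    then have "k \<le> k - 1" unfolding k_def by (intro Least_le) (auto simp: k_def)
    then show False using \<open>k \<ge> 1\<close> by simp
  qed
  ultimately show thesis by (rule that)
qed

theorem axis_or_rectangle:
  assumes ab: "absorbs D I" and fin: "finite D" and I0: "I \<noteq> {}"
    and fI: "fits I d" and I1: "\<not> fits I (d - 1)" and D3: "\<not> fits D (d + 3)"
  shows "long_axis D I d \<or> rectangular D"
proof (rule ccontr)
  assume contr: "\<not> ?thesis"
  have "I \<subseteq> D" using ab unfolding absorbs_def by blast
  then have "D \<noteq> {}" using I0 by blast
  then obtain e where e: "co_fits D I d e" "\<not> co_fits D I d (e - 1)"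
    using minimal_co_fits[OF fin _ fI] by blast
  obtain V A B C where V: "int_unimodular V"
     "\<And>x y. (x, y) \<in> V ` I \<Longrightarrow> 1 \<le> x \<and> 1 \<le> y \<and> x + y \<le> d + 2"
     "\<And>x y. (x, y) \<in> V ` D \<Longrightarrow> 1 - A \<le> x \<and> 1 - B \<le> y \<and> x + y \<le> d + 2 + C"
     "e = d + A + B + C"
    using e(1) unfolding co_fits_def by blast
  define D' I' where D': "D' = V ` D" and I': "I' = V ` I"
  have ab': "absorbs D' I'" unfolding D' I' by (rule absorbs_image[OF V(1) ab])
  have mine: "\<not> co_fits D' I' d (e - 1)" using co_fits_image[OF V(1)] e(2) unfolding D' I' by blast
  have nl: "\<not> long_axis D' I' d" using long_axis_image[OF V(1)] contr unfolding D' I' by blast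
  have nr: "\<not> rectangular D'" using rectangular_image[OF V(1)] contr unfolding D' I' by blast
  have nI: "\<not> fits I' (d - 1)" using fits_image_iff[OF V(1)] I1 unfolding I' by blast
  have nD: "\<not> fits D' (d + 3)" using fits_image_iff[OF V(1)] D3 unfolding D' by blast
  have id: "int_unimodular (aff_map 1 0 0 1 0 0)" by (rule int_unimodular_aff_map) simp
  have idim: "aff_map 1 0 0 1 0 0 ` S = S" for S :: "(int \<times> int) set" by (auto simp: aff_map_def image_iff)
  have VI: "1 \<le> fst z \<and> 1 \<le> snd z \<and> fst z + snd z \<le> d + 2" if "z \<in> I'" for z
    using V(2)[of "fst z" "snd z"] that unfolding I' by simp
  have VD: "1 - A \<le> fst z \<and> 1 - B \<le> snd z \<and> fst z + snd z \<le> d + 2 + C" if "z \<in> D'" for z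
    using V(3)[of "fst z" "snd z"] that unfolding D' by simp
  have e4: "d + 4 \<le> e"
  proof (rule ccontr)
    assume "\<not> ?thesis"
    then have "fits D' (d + 3)"
      using VD V(4) by (intro fits_simplexI[of D' "1 - A" "1 - B" "d + 2 + C"]) force+
    then show False using nD by simp
  qed
  have coI: "co_fits D' I' d (e - 1)"
    if "\<And>z. z \<in> D' \<Longrightarrow> 1 - A' \<le> fst z \<and> 1 - B' \<le> snd z \<and> fst z + snd z \<le> d + 2 + C'"
       "A' + B' + C' = A + B + C - 1" for A' B' C'
    by (rule co_fitsI[OF id, where A = A' and B = B' and C = C'])
       (use VI that V(4) in \<open>force simp: idim\<close>)+
  have fI': "fits I' (d - 1)"
    if "\<And>z. z \<in> I' \<Longrightarrow> A' \<le> fst z \<and> B' \<le> snd z \<and> fst z + snd z \<le> C'" "C' - A' - B' = d - 1" for A' B' C'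
    by (rule fits_simplexI[where A = A' and B = B' and C = C']) (use that in force)+
  \<comment> \<open>One argument for all three sides: \<open>h\<close> increases inwards from the
    side under consideration. A single corner step provides the first corner and a point on the
    opposite side, which is the starting position of \<open>two_corners\<close>.\<close>
  have key: False
    if "coprime h1 h2" and h: "\<And>z. h z = h1 * fst z + h2 * snd z"
      and p: "p \<in> I'" and v: "v \<in> D'" and pmin: "\<And>z. z \<in> I' \<Longrightarrow> h p \<le> h z"
      and vmin: "\<And>z. z \<in> D' \<Longrightarrow> h v \<le> h z" and 2: "h p - h v \<ge> 2"
      and prange: "\<And>z. z \<in> I' \<Longrightarrow> h z \<le> h p + d" and vrange: "\<And>z. z \<in> D' \<Longrightarrow> h z \<le> h v + e"
    for h1 h2 h p v
  proof -
    note step = corner_step[OF ab' mine e4 that nl]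
    obtain U u where U: "int_unimodular U" "U v = (0, 0)" "(1, 1) \<in> U ` I'"
      and UI: "\<forall>x y. (x, y) \<in> U ` I' \<longrightarrow> 1 \<le> x \<and> 1 \<le> y \<and> x + y \<le> d + 2"
      and UD: "\<forall>x y. (x, y) \<in> U ` D' \<longrightarrow> 0 \<le> x \<and> 0 \<le> y \<and> x + y \<le> e"
      and u: "u \<in> D'" "fst (U u) + snd (U u) = e"
      using step by blast
    note UI = UI[rule_format] and UD = UD[rule_format]
    have "rectangular (U ` D')"
    proof (rule two_corners[OF absorbs_image[OF U(1) ab'] _ e4 UI UD])
      show "\<not> co_fits (U ` D') (U ` I') d (e - 1)" using co_fits_image[OF U(1)] mine by blast
      show "\<not> fits (U ` I') (d - 1)" "\<not> fits (U ` D') (d + 3)" using fits_image_iff[OF U(1)] nI nD by blast+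
      show "(0, 0) \<in> U ` D'" using U(2) v by (metis image_eqI)
      show "(1, 1) \<in> U ` I'" by (rule U(3))
      show "(fst (U u), snd (U u)) \<in> U ` D'" using u(1) by simp
      show "fst (U u) + snd (U u) = e" by (rule u(2))
      show "\<not> long_axis (U ` D') (U ` I') d" using long_axis_image[OF U(1)] nl by blast
    qed
    then show False using rectangular_image[OF U(1)] nr by blast
  qed
  \<comment> \<open>If no offset exceeded 1, \<open>e\<close> would be at most
    \<open>d + 3\<close>.\<close>
  have "2 \<le> A \<or> 2 \<le> B \<or> 2 \<le> C" using e4 V(4) by linarith
  then show False
  proof (elim disjE)
    assume A: "2 \<le> A"
    \<comment> \<open>Both bounds at this side are attained: otherwise the simplex around
      \<open>I'\<close> or the one around \<open>D'\<close> could be shrunk here alone, against the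
      minimality of \<open>d\<close> or \<open>e\<close>. The other two sides are handled in the
      same way.\<close>
    have "\<exists>p\<in>I'. fst p = 1"
    proof (rule ccontr)
      assume ne: "\<not> ?thesis"
      have "fits I' (d - 1)"
      proof (rule fI'[of 2 1 "d + 2"])
        fix z assume z: "z \<in> I'"
        then have "fst z \<noteq> 1" using ne by blast
        then show "2 \<le> fst z \<and> 1 \<le> snd z \<and> fst z + snd z \<le> d + 2" using VI[OF z] by simp
      qed simp
      then show False using nI by simp
    qed
    then obtain p where p: "p \<in> I'" "fst p = 1" by blast
    have "\<exists>v\<in>D'. fst v = 1 - A"
    proof (rule ccontr)
      assume ne: "\<not> ?thesis"
      have "co_fits D' I' d (e - 1)"
      proof (rule coI[of "A - 1" B C])
        fix z assume z: "z \<in> D'"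
        then have "fst z \<noteq> 1 - A" using ne by blast
        then show "1 - (A - 1) \<le> fst z \<and> 1 - (B) \<le> snd z \<and> fst z + snd z \<le> d + 2 + (C)"
          using VD[OF z] by simp
      qed simp
      then show False using mine by simp
    qed
    then obtain v where v: "v \<in> D'" "fst v = 1 - A" by blast
    show False
    proof (rule key[of 1 0 fst p v, OF _ _ p(1) v(1)])
      fix z assume "z \<in> I'"
      from VI[OF this] show "(fst) p \<le> (fst) z" "(fst) z \<le> (fst) p + d"
        using p(2) by auto
    next
      fix z assume "z \<in> D'"
      from VD[OF this] show "(fst) v \<le> (fst) z" "(fst) z \<le> (fst) v + e"
        using v(2) V(4) by auto
    qed (use p(2) v(2) A in auto)
  next
    assume A: "2 \<le> B"
    have "\<exists>p\<in>I'. snd p = 1"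
    proof (rule ccontr)
      assume ne: "\<not> ?thesis"
      have "fits I' (d - 1)"
      proof (rule fI'[of 1 2 "d + 2"])
        fix z assume z: "z \<in> I'"
        then have "snd z \<noteq> 1" using ne by blast
        then show "1 \<le> fst z \<and> 2 \<le> snd z \<and> fst z + snd z \<le> d + 2" using VI[OF z] by simp
      qed simp
      then show False using nI by simp
    qed
    then obtain p where p: "p \<in> I'" "snd p = 1" by blast
    have "\<exists>v\<in>D'. snd v = 1 - B"
    proof (rule ccontr)
      assume ne: "\<not> ?thesis"
      have "co_fits D' I' d (e - 1)"
      proof (rule coI[of A "B - 1" C])
        fix z assume z: "z \<in> D'"
        then have "snd z \<noteq> 1 - B" using ne by blast
        then show "1 - (A) \<le> fst z \<and> 1 - (B - 1) \<le> snd z \<and> fst z + snd z \<le> d + 2 + (C)"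
          using VD[OF z] by simp
      qed simp
      then show False using mine by simp
    qed
    then obtain v where v: "v \<in> D'" "snd v = 1 - B" by blast
    show False
    proof (rule key[of 0 1 snd p v, OF _ _ p(1) v(1)])
      fix z assume "z \<in> I'"
      from VI[OF this] show "(snd) p \<le> (snd) z" "(snd) z \<le> (snd) p + d"
        using p(2) by auto
    next
      fix z assume "z \<in> D'"
      from VD[OF this] show "(snd) v \<le> (snd) z" "(snd) z \<le> (snd) v + e"
        using v(2) V(4) by auto
    qed (use p(2) v(2) A in auto)
  next
    assume A: "2 \<le> C"
    have "\<exists>p\<in>I'. fst p + snd p = d + 2"
    proof (rule ccontr)
      assume ne: "\<not> ?thesis"
      have "fits I' (d - 1)"
      proof (rule fI'[of 1 1 "d + 1"])
        fix z assume z: "z \<in> I'"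
        then have "fst z + snd z \<noteq> d + 2" using ne by blast
        then show "1 \<le> fst z \<and> 1 \<le> snd z \<and> fst z + snd z \<le> d + 1" using VI[OF z] by simp
      qed simp
      then show False using nI by simp
    qed
    then obtain p where p: "p \<in> I'" "fst p + snd p = d + 2" by blast
    have "\<exists>v\<in>D'. fst v + snd v = d + 2 + C"
    proof (rule ccontr)
      assume ne: "\<not> ?thesis"
      have "co_fits D' I' d (e - 1)"
      proof (rule coI[of A B "C - 1"])
        fix z assume z: "z \<in> D'"
        then have "fst z + snd z \<noteq> d + 2 + C" using ne by blast
        then show "1 - (A) \<le> fst z \<and> 1 - (B) \<le> snd z \<and> fst z + snd z \<le> d + 2 + (C - 1)"
          using VD[OF z] by simp
      qed simp
      then show False using mine by simp
    qed
    then obtain v where v: "v \<in> D'" "fst v + snd v = d + 2 + C" by blast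
    show False
    proof (rule key[of "-1" "-1" "\<lambda>z. - fst z - snd z" p v, OF _ _ p(1) v(1)])
      fix z assume "z \<in> I'"
      from VI[OF this] show "(\<lambda>z. - fst z - snd z) p \<le> (\<lambda>z. - fst z - snd z) z" "(\<lambda>z. - fst z - snd z) z \<le> (\<lambda>z. - fst z - snd z) p + d"
        using p(2) by auto
    next
      fix z assume "z \<in> D'"
      from VD[OF this] show "(\<lambda>z. - fst z - snd z) v \<le> (\<lambda>z. - fst z - snd z) z" "(\<lambda>z. - fst z - snd z) z \<le> (\<lambda>z. - fst z - snd z) v + e"
        using v(2) V(4) by auto
    qed (use p(2) v(2) A in auto)
  qed
qed

subsection \<open>Lattice points of convex sets\<close>

definition emb :: "int \<times> int \<Rightarrow> real \<times> real" where
  "emb z = (of_int (fst z), of_int (snd z))"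

definition lattice_of :: "(real \<times> real) set \<Rightarrow> (int \<times> int) set" where
  "lattice_of S = {z. emb z \<in> S}"

lemma emb_apply: "emb (x, y) = (of_int x, of_int y)"
  by (simp add: emb_def)

lemma inj_emb: "inj emb"
  by (rule injI) (simp add: emb_def prod_eq_iff)

lemma Int_int_points: "S \<inter> int_points = emb ` lattice_of S"
proof -
  have "int_points = range emb"
    unfolding int_points_def emb_def Ints_def by (auto simp: image_iff)
  moreover have "lattice_of S = emb -` S" by (auto simp: lattice_of_def)
  ultimately show ?thesis by (simp add: image_vimage_eq)
qed

text \<open>One list of integer coefficients defines both maps, so each real unimodular map comes
  with its action on integer pairs.\<close>

definition realizes :: "(real \<times> real \<Rightarrow> real \<times> real) \<Rightarrow> (int \<times> int \<Rightarrow> int \<times> int) \<Rightarrow> bool" where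
  "realizes \<phi> U \<longleftrightarrow> (\<exists>a b c d e f :: int. (a * d - b * c = 1 \<or> a * d - b * c = -1) \<and> U = aff_map a b c d e f \<and>
     \<phi> = aff_map (of_int a) (of_int b) (of_int c) (of_int d) (of_int e) (of_int f))"

lemma realizes_exists: "int_unimodular U \<Longrightarrow> \<exists>\<phi>. realizes \<phi> U"
  unfolding int_unimodular_def realizes_def by blast

lemma realizes_int_unimodular: "realizes \<phi> U \<Longrightarrow> int_unimodular U"
  unfolding int_unimodular_def realizes_def by blast

lemma invertible_int_2x2:
  fixes A :: "int^2^2"
  shows "invertible A \<longleftrightarrow> A$1$1 * A$2$2 - A$1$2 * A$2$1 = 1 \<or> A$1$1 * A$2$2 - A$1$2 * A$2$1 = -1"
proof
  assume "invertible A"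
  then obtain B where "A ** B = mat 1" unfolding invertible_def by blast
  then have "det A * det B = 1" by (metis det_I det_mul)
  then have "det A = 1 \<or> det A = -1" by (auto simp: zmult_eq_1_iff)
  then show "A$1$1 * A$2$2 - A$1$2 * A$2$1 = 1 \<or> A$1$1 * A$2$2 - A$1$2 * A$2$1 = -1"
    by (simp add: det_2)
next
  define \<delta> where "\<delta> = A$1$1 * A$2$2 - A$1$2 * A$2$1"
  assume "A$1$1 * A$2$2 - A$1$2 * A$2$1 = 1 \<or> A$1$1 * A$2$2 - A$1$2 * A$2$1 = -1"
  then have \<delta>: "\<delta> * \<delta> = 1" unfolding \<delta>_def by auto
  define B :: "int^2^2" where "B = vector [vector [\<delta> * A$2$2, - \<delta> * A$1$2], vector [- \<delta> * A$2$1, \<delta> * A$1$1]]"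
  have B: "B$1$1 = \<delta> * A$2$2" "B$1$2 = - \<delta> * A$1$2" "B$2$1 = - \<delta> * A$2$1" "B$2$2 = \<delta> * A$1$1"
    unfolding B_def by (simp_all add: vector_2)
  have d: "\<delta> * (A$1$1 * A$2$2 - A$1$2 * A$2$1) = 1" using \<delta> unfolding \<delta>_def .
  have "A ** B = mat 1" "B ** A = mat 1"
    using d by (simp_all add: vec_eq_iff forall_2 matrix_matrix_mult_def sum_2 mat_def B algebra_simps)
  then show "invertible A" unfolding invertible_def by blast
qed

lemma unimodular_iff_realizes: "unimodular \<phi> \<longleftrightarrow> (\<exists>U. realizes \<phi> U)"
proof
  assume "unimodular \<phi>"
  then obtain A :: "int^2^2" and w :: "int^2" where A: "invertible A" and
    \<phi>: "\<phi> = (\<lambda>(x, y). (of_int (A$1$1) * x + of_int (A$1$2) * y + of_int (w$1),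
                        of_int (A$2$1) * x + of_int (A$2$2) * y + of_int (w$2)))"
    unfolding unimodular_def by blast
  have "\<phi> = aff_map (of_int (A$1$1)) (of_int (A$1$2)) (of_int (A$2$1)) (of_int (A$2$2)) (of_int (w$1)) (of_int (w$2))"
    unfolding \<phi> by (auto simp: fun_eq_iff)
  then have "realizes \<phi> (aff_map (A$1$1) (A$1$2) (A$2$1) (A$2$2) (w$1) (w$2))"
    unfolding realizes_def using A[unfolded invertible_int_2x2] by blast
  then show "\<exists>U. realizes \<phi> U" by blast
next
  assume "\<exists>U. realizes \<phi> U"
  then obtain a b c d e f :: int where det: "a * d - b * c = 1 \<or> a * d - b * c = -1"
    and \<phi>: "\<phi> = aff_map (of_int a) (of_int b) (of_int c) (of_int d) (of_int e) (of_int f)"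
    unfolding realizes_def by blast
  define A :: "int^2^2" where "A = vector [vector [a, b], vector [c, d]]"
  define w :: "int^2" where "w = vector [e, f]"
  have A: "A$1$1 = a" "A$1$2 = b" "A$2$1 = c" "A$2$2 = d" "w$1 = e" "w$2 = f"
    unfolding A_def w_def by (simp_all add: vector_2)
  show "unimodular \<phi>" unfolding unimodular_def
  proof (intro exI conjI)
    show "invertible A" unfolding invertible_int_2x2 A by (rule det)
    show "\<phi> = (\<lambda>(x, y). (of_int (A$1$1) * x + of_int (A$1$2) * y + of_int (w$1),
                        of_int (A$2$1) * x + of_int (A$2$2) * y + of_int (w$2)))"
      unfolding A \<phi> by (auto simp: fun_eq_iff)
  qed
qed

lemma realizes_emb: "realizes \<phi> U \<Longrightarrow> \<phi> (emb z) = emb (U z)"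
  unfolding realizes_def emb_def aff_map_def by auto

lemma realizes_inverse:
  assumes "realizes \<phi> U"
  shows "\<exists>\<psi> V. realizes \<psi> V \<and> (\<forall>v. \<psi> (\<phi> v) = v) \<and> (\<forall>v. \<phi> (\<psi> v) = v) \<and> (\<forall>z. V (U z) = z) \<and> (\<forall>z. U (V z) = z)"
proof -
  obtain a b c d e f :: int where det: "a * d - b * c = 1 \<or> a * d - b * c = -1" and U: "U = aff_map a b c d e f"
    and \<phi>: "\<phi> = aff_map (of_int a) (of_int b) (of_int c) (of_int d) (of_int e) (of_int f)"
    using assms unfolding realizes_def by blast
  define \<delta> where "\<delta> = a * d - b * c"
  define V where "V = aff_map (\<delta> * d) (- \<delta> * b) (- \<delta> * c) (\<delta> * a) (\<delta> * (b * f - d * e)) (\<delta> * (c * e - a * f))"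
  define \<psi> :: "real \<times> real \<Rightarrow> real \<times> real" where
    "\<psi> = aff_map (of_int (\<delta> * d)) (of_int (- \<delta> * b)) (of_int (- \<delta> * c)) (of_int (\<delta> * a))
        (of_int (\<delta> * (b * f - d * e))) (of_int (\<delta> * (c * e - a * f)))"
  have \<delta>: "\<delta> = 1 \<or> \<delta> = -1" unfolding \<delta>_def by (rule det)
  then have \<delta>': "(of_int \<delta> :: real) = 1 \<or> (of_int \<delta> :: real) = - 1" by auto
  have \<delta>r: "(of_int \<delta> :: real) = of_int a * of_int d - of_int b * of_int c" unfolding \<delta>_def by simp
  have 1: "realizes \<psi> V" unfolding realizes_def
  proof (intro exI conjI)
    have "(\<delta> * d) * (\<delta> * a) - (- \<delta> * b) * (- \<delta> * c) = \<delta> * \<delta> * \<delta>"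
      unfolding \<delta>_def by (simp add: algebra_simps)
    then show "(\<delta> * d) * (\<delta> * a) - (- \<delta> * b) * (- \<delta> * c) = 1 \<or> (\<delta> * d) * (\<delta> * a) - (- \<delta> * b) * (- \<delta> * c) = -1"
      using \<delta> by auto
  qed (rule V_def \<psi>_def)+
  have 2: "V (U z) = z" "U (V z) = z" for z
    unfolding U V_def by (rule aff_map_inverse[OF \<delta>_def \<delta>])+
  have 3: "\<psi> (\<phi> v) = v" "\<phi> (\<psi> v) = v" for v
    using aff_map_inverse[OF \<delta>r \<delta>'] unfolding \<phi> \<psi>_def by simp_all
  show ?thesis using 1 2 3 by blast
qed

text \<open>Splitting off the translation makes the library facts on hulls and interiors under
  injective linear maps applicable.\<close>

lemma realizes_affine:
  assumes "realizes \<phi> U"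
  shows "\<exists>L w. linear L \<and> inj L \<and> (\<forall>S. \<phi> ` S = (+) w ` L ` S)"
proof -
  obtain a b c d e f :: int where \<phi>: "\<phi> = aff_map (of_int a) (of_int b) (of_int c) (of_int d) (of_int e) (of_int f)"
    using assms unfolding realizes_def by blast
  define L where "L = (aff_map (of_int a) (of_int b) (of_int c) (of_int d) 0 0 :: real \<times> real \<Rightarrow> _)"
  define w :: "real \<times> real" where "w = (of_int e, of_int f)"
  have \<phi>L: "\<phi> v = w + L v" for v unfolding \<phi> L_def w_def aff_map_def by simp
  have "linear L" unfolding L_def aff_map_def by (rule linearI) (auto simp: algebra_simps)
  moreover have "inj L"
  proof (rule injI)
    fix u v assume "L u = L v"
    then have "\<phi> u = \<phi> v" by (simp add: \<phi>L)
    moreover obtain \<psi> V where "\<forall>v. \<psi> (\<phi> v) = v" using realizes_inverse[OF assms] by blast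
    ultimately show "u = v" by metis
  qed
  moreover have "\<phi> ` S = (+) w ` L ` S" for S by (auto simp: \<phi>L image_image)
  ultimately show ?thesis by blast
qed

lemma realizes_convex_hull:
  assumes "realizes \<phi> U"
  shows "\<phi> ` (convex hull S) = convex hull (\<phi> ` S)"
proof -
  obtain L w where "linear L" "inj L" and L: "\<forall>S. \<phi> ` S = (+) w ` L ` S"
    using realizes_affine[OF assms] by blast
  then show ?thesis by (simp add: L convex_hull_translation flip: convex_hull_linear_image)
qed

lemma realizes_interior:
  assumes "realizes \<phi> U"
  shows "interior (\<phi> ` S) = \<phi> ` interior S"
proof -
  obtain L w where "linear L" "inj L" and L: "\<forall>S. \<phi> ` S = (+) w ` L ` S"
    using realizes_affine[OF assms] by blast
  then show ?thesis by (simp add: L interior_translation interior_injective_linear_image)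
qed

lemma realizes_lattice_of:
  assumes "realizes \<phi> U"
  shows "lattice_of (\<phi> ` S) = U ` lattice_of S"
proof (intro set_eqI iffI)
  fix z assume "z \<in> U ` lattice_of S"
  then obtain w where "z = U w" "emb w \<in> S" unfolding lattice_of_def by blast
  then show "z \<in> lattice_of (\<phi> ` S)"
    unfolding lattice_of_def by (simp flip: realizes_emb[OF assms])
next
  fix z assume z: "z \<in> lattice_of (\<phi> ` S)"
  obtain \<psi> V where V: "realizes \<psi> V" "\<forall>v. \<psi> (\<phi> v) = v" "\<forall>z. U (V z) = z"
    using realizes_inverse[OF assms] by blast
  obtain s where s: "s \<in> S" "emb z = \<phi> s" using z unfolding lattice_of_def by blast
  have "s = \<psi> (\<phi> s)" using V(2) by metis
  also have "\<dots> = emb (V z)" unfolding s(2)[symmetric] by (rule realizes_emb[OF V(1)])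
  finally have "s = emb (V z)" .
  then have "V z \<in> lattice_of S" using s(1) unfolding lattice_of_def by simp
  then show "z \<in> U ` lattice_of S" using V(3) by (metis image_eqI)
qed

lemma realizes_convex:
  assumes "realizes \<phi> U" "convex S"
  shows "convex (\<phi> ` S)"
  using realizes_convex_hull[OF assms(1), of S] assms(2) by (metis convex_convex_hull convex_hull_eq)

lemma realizes_image_emb:
  assumes "realizes \<phi> U"
  shows "\<phi> ` emb ` D = emb ` U ` D"
  using realizes_emb[OF assms] by (simp add: image_image)

section \<open>Convex combinations and supporting lines at lattice points\<close>

lemma lattice_of_convex_comb:
  assumes "convex S" "(u1, u2) \<in> lattice_of S" "(w1, w2) \<in> lattice_of S" "(z1, z2) \<in> lattice_of S"
    "0 \<le> s" "0 \<le> t" "0 \<le> r" "0 < s + t + r"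
    "(s + t + r) * q1 = s * u1 + t * w1 + r * z1" "(s + t + r) * q2 = s * u2 + t * w2 + r * z2"
  shows "(q1, q2) \<in> lattice_of S"
proof -
  define n where "n = real_of_int (s + t + r)"
  have n: "0 < n" using assms(8) unfolding n_def by linarith
  have "n * of_int q1 = of_int s * of_int u1 + of_int t * of_int w1 + of_int r * of_int z1"
    using arg_cong[OF assms(9), of real_of_int] by (simp add: n_def)
  moreover have "n * of_int q2 = of_int s * of_int u2 + of_int t * of_int w2 + of_int r * of_int z2"
    using arg_cong[OF assms(10), of real_of_int] by (simp add: n_def)
  ultimately have "emb (q1, q2) = (of_int s / n) *\<^sub>R emb (u1, u2) + (of_int t / n) *\<^sub>R emb (w1, w2) + (of_int r / n) *\<^sub>R emb (z1, z2)"
    using n by (simp add: emb_def field_simps)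
  moreover have "of_int s / n + of_int t / n + of_int r / n = 1"
    using n by (simp add: n_def flip: add_divide_distrib)
  moreover have "0 \<le> of_int s / n" "0 \<le> of_int t / n" "0 \<le> of_int r / n" using n assms(5-7) by auto
  ultimately have "emb (q1, q2) \<in> convex hull {emb (u1, u2), emb (w1, w2), emb (z1, z2)}"
    unfolding convex_hull_3 by blast
  also have "\<dots> \<subseteq> S" using assms(1-4) by (intro hull_minimal) (auto simp: lattice_of_def)
  finally show ?thesis by (simp add: lattice_of_def)
qed

text \<open>If \<open>S\<close> has empty interior it lies in a line, whose normal is constant on
  \<open>S\<close>. Otherwise relative interior and interior agree, and a supporting line at a
  relative frontier point exists.\<close>

lemma supporting_functional:
  fixes S :: "(real \<times> real) set"
  assumes "convex S" "q \<in> S" "q \<notin> interior S"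
  obtains a where "a \<noteq> 0" "\<And>y. y \<in> S \<Longrightarrow> a \<bullet> q \<le> a \<bullet> y"
proof (cases "interior S = {}")
  case True
  then obtain a b where "a \<noteq> 0" "S \<subseteq> {x. a \<bullet> x = b}"
    using empty_interior_subset_hyperplane[OF assms(1)] by metis
  then have "a \<bullet> y = b" if "y \<in> S" for y using that by blast
  then show thesis using assms(2) \<open>a \<noteq> 0\<close> by (intro that[of a]) simp_all
next
  case False
  then have "rel_interior S = interior S" using rel_interior_nonempty_interior by blast
  then show thesis
    using supporting_hyperplane_relative_frontier[OF assms(1), of q] assms(2,3) closure_subset that
    by (metis subsetD)
qed

lemma lattice_supporting_functional:
  assumes "convex S" "(q1, q2) \<in> lattice_of S" "(q1, q2) \<notin> lattice_of (interior S)"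
  obtains a b :: real where "a \<noteq> 0 \<or> b \<noteq> 0"
    "\<And>x y. (x, y) \<in> lattice_of S \<Longrightarrow> 0 \<le> a * of_int (x - q1) + b * of_int (y - q2)"
proof -
  obtain c where c: "c \<noteq> 0" "\<And>y. y \<in> S \<Longrightarrow> c \<bullet> emb (q1, q2) \<le> c \<bullet> y"
    using supporting_functional[OF assms(1)] assms(2,3) unfolding lattice_of_def by blast
  have "fst c \<noteq> 0 \<or> snd c \<noteq> 0" using c(1) by (auto simp: prod_eq_iff)
  moreover have "0 \<le> fst c * of_int (x - q1) + snd c * of_int (y - q2)" if "(x, y) \<in> lattice_of S" for x y
    using c(2)[of "emb (x, y)"] that
    by (simp add: lattice_of_def emb_def inner_prod_def algebra_simps)
  ultimately show thesis by (rule that)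
qed

lemma absorbs_lattice_of:
  assumes "convex S"
  shows "absorbs (lattice_of S) (lattice_of (interior S))"
proof -
  have "q \<in> lattice_of (interior S)" if H: "i \<in> lattice_of (interior S)" "u \<in> lattice_of S" "w \<in> lattice_of S"
     "0 < s" "0 \<le> t" "0 \<le> r"
     "(s + t + r) * fst q = s * fst i + t * fst u + r * fst w"
     "(s + t + r) * snd q = s * snd i + t * snd u + r * snd w" for q i u w s t r
  proof (cases "t + r = 0")
    case True
    then have "t = 0" "r = 0" using H(5,6) by auto
    then have "q = i" using H(4,7,8) by (simp add: prod_eq_iff)
    then show ?thesis using H(1) by simp
  next
    case False
    define m where "m = real_of_int (t + r)"
    define n where "n = real_of_int (s + t + r)"
    have m: "0 < m" and n: "0 < n" using False H(4-6) unfolding m_def n_def by linarith+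
    \<comment> \<open>\<open>q\<close> lies on the segment from the mean \<open>x\<close> of
      \<open>u\<close> and \<open>w\<close> to the interior point \<open>i\<close>, and differs from
      \<open>x\<close> in that it carries positive weight \<open>s\<close> on
      \<open>i\<close>.\<close>
    define x where "x = (of_int t / m) *\<^sub>R emb u + (of_int r / m) *\<^sub>R emb w"
    have "x \<in> S" unfolding x_def
      using assms H(2,3,5,6) m by (intro convexD) (simp_all add: lattice_of_def m_def flip: add_divide_distrib)
    then have "x - (of_int s / n) *\<^sub>R (x - emb i) \<in> interior S"
      using H(1,4-6) n m by (intro mem_interior_convex_shrink[OF assms]) (auto simp: lattice_of_def n_def)
    moreover have "emb q = x - (of_int s / n) *\<^sub>R (x - emb i)"
    proof -
      have 1: "n * of_int (fst q) = of_int s * of_int (fst i) + of_int t * of_int (fst u) + of_int r * of_int (fst w)"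
        using arg_cong[OF H(7), of real_of_int] by (simp add: n_def)
      have 2: "n * of_int (snd q) = of_int s * of_int (snd i) + of_int t * of_int (snd u) + of_int r * of_int (snd w)"
        using arg_cong[OF H(8), of real_of_int] by (simp add: n_def)
      have nm: "n = of_int s + m" unfolding n_def m_def by simp
      have aux: "Q = X - (of_int s / n) * (X - I)"
        if "n * Q = of_int s * I + T" "X = T / m" for Q X I T
      proof -
        have "n * (X - (of_int s / n) * (X - I)) = n * X - of_int s * (X - I)" using n by (simp add: field_simps)
        also have "\<dots> = m * X + of_int s * I" unfolding nm by (simp add: algebra_simps)
        also have "\<dots> = n * Q" using that m by simp
        finally show ?thesis using n by simp
      qed
      have "real_of_int (fst q) = fst x - (of_int s / n) * (fst x - of_int (fst i))"
        by (rule aux[where T = "of_int t * of_int (fst u) + of_int r * of_int (fst w)"])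
           (use 1 in \<open>simp_all add: x_def emb_def add_divide_distrib\<close>)
      moreover have "real_of_int (snd q) = snd x - (of_int s / n) * (snd x - of_int (snd i))"
        by (rule aux[where T = "of_int t * of_int (snd u) + of_int r * of_int (snd w)"])
           (use 2 in \<open>simp_all add: x_def emb_def add_divide_distrib\<close>)
      ultimately show ?thesis by (simp add: prod_eq_iff emb_def)
    qed
    ultimately show ?thesis by (simp add: lattice_of_def)
  qed
  moreover have "lattice_of (interior S) \<subseteq> lattice_of S"
    unfolding lattice_of_def using interior_subset by blast
  ultimately show ?thesis unfolding absorbs_def by blast
qed

section \<open>The lattice size in terms of integer points\<close>

lemma scaled_std_simplex:
  "(\<lambda>v. real d *\<^sub>R v) ` std_simplex = {(x, y). 0 \<le> x \<and> 0 \<le> y \<and> x + y \<le> real d}" (is "?L = ?R")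
proof -
  have s: "std_simplex = {(x, y). 0 \<le> x \<and> 0 \<le> y \<and> x + y \<le> 1}" (is "_ = ?S")
  proof (intro set_eqI iffI)
    fix v assume "v \<in> std_simplex"
    then show "v \<in> ?S" unfolding std_simplex_def convex_hull_3 by auto
  next
    fix v assume v: "v \<in> ?S"
    then have "v = (1 - fst v - snd v) *\<^sub>R (0, 0) + fst v *\<^sub>R (1, 0) + snd v *\<^sub>R (0, 1)"
      by (auto simp: prod_eq_iff)
    moreover have "0 \<le> 1 - fst v - snd v" "0 \<le> fst v" "0 \<le> snd v" "1 - fst v - snd v + fst v + snd v = 1"
      using v by auto
    ultimately show "v \<in> std_simplex" unfolding std_simplex_def convex_hull_3 by blast
  qed
  show ?thesis
  proof (intro set_eqI iffI)
    fix v assume "v \<in> ?L"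
    then obtain w where w: "v = real d *\<^sub>R w" "w \<in> ?S" unfolding s by blast
    define x y where "x = fst w" and "y = snd w"
    have "v = (real d * x, real d * y)" and "0 \<le> x" "0 \<le> y" "x + y \<le> 1"
      using w unfolding x_def y_def by auto
    moreover have "real d * (x + y) \<le> real d * 1" using \<open>x + y \<le> 1\<close> by (intro mult_left_mono) auto
    ultimately show "v \<in> ?R" by (auto simp: algebra_simps)
  next
    fix v assume v: "v \<in> ?R"
    show "v \<in> ?L"
    proof (cases "d = 0")
      case True
      then have "v = (0, 0)" using v by auto
      then show ?thesis using True unfolding s by (intro image_eqI[of _ _ "(0, 0)"]) auto
    next
      case False
      then show ?thesis using v unfolding s
        by (intro image_eqI[of _ _ "(fst v / real d, snd v / real d)"]) (auto simp: field_simps)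
    qed
  qed
qed

lemma convex_scaled_std_simplex: "convex ((\<lambda>v. real d *\<^sub>R v) ` std_simplex)"
  unfolding std_simplex_def by (intro convex_scaling convex_convex_hull)

lemma fits_iff_unimodular:
  "fits D (int d) \<longleftrightarrow>
     (\<exists>\<phi>. unimodular \<phi> \<and> \<phi> ` (convex hull (emb ` D)) \<subseteq> (\<lambda>v. real d *\<^sub>R v) ` std_simplex)"
proof -
  have key: "\<phi> ` (convex hull (emb ` D)) \<subseteq> (\<lambda>v. real d *\<^sub>R v) ` std_simplex \<longleftrightarrow>
      (\<forall>z\<in>D. 0 \<le> fst (U z) \<and> 0 \<le> snd (U z) \<and> fst (U z) + snd (U z) \<le> int d)"
    if "realizes \<phi> U" for \<phi> U
  proof -
    have "\<phi> ` (convex hull (emb ` D)) = convex hull (emb ` U ` D)"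
      using realizes_convex_hull[OF that] realizes_image_emb[OF that] by simp
    then have "\<phi> ` (convex hull (emb ` D)) \<subseteq> (\<lambda>v. real d *\<^sub>R v) ` std_simplex \<longleftrightarrow>
       emb ` U ` D \<subseteq> (\<lambda>v. real d *\<^sub>R v) ` std_simplex"
      using convex_scaled_std_simplex by (metis subset_hull)
    also have "\<dots> \<longleftrightarrow> (\<forall>z\<in>D. 0 \<le> fst (U z) \<and> 0 \<le> snd (U z) \<and> fst (U z) + snd (U z) \<le> int d)"
    proof -
      have "real_of_int x + real_of_int y \<le> real d \<longleftrightarrow> x + y \<le> int d" for x y by linarith
      then show ?thesis unfolding scaled_std_simplex image_subset_iff ball_simps by (simp add: emb_def)
    qed
    finally show ?thesis .
  qed
  show ?thesis
  proof
    assume "fits D (int d)"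
    then obtain U where "int_unimodular U"
      and U: "\<forall>z\<in>D. 0 \<le> fst (U z) \<and> 0 \<le> snd (U z) \<and> fst (U z) + snd (U z) \<le> int d"
      unfolding fits_def by blast
    then obtain \<phi> where \<phi>: "realizes \<phi> U" using realizes_exists by blast
    then have "unimodular \<phi>" unfolding unimodular_iff_realizes by blast
    then show "\<exists>\<phi>. unimodular \<phi> \<and> \<phi> ` (convex hull (emb ` D)) \<subseteq> (\<lambda>v. real d *\<^sub>R v) ` std_simplex"
      using U[folded key[OF \<phi>]] by blast
  next
    assume "\<exists>\<phi>. unimodular \<phi> \<and> \<phi> ` (convex hull (emb ` D)) \<subseteq> (\<lambda>v. real d *\<^sub>R v) ` std_simplex"
    then obtain \<phi> where "unimodular \<phi>"
      and sub: "\<phi> ` (convex hull (emb ` D)) \<subseteq> (\<lambda>v. real d *\<^sub>R v) ` std_simplex" by blast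
    then obtain U where U: "realizes \<phi> U" unfolding unimodular_iff_realizes by blast
    show "fits D (int d)" unfolding fits_def
      using realizes_int_unimodular[OF U] sub[unfolded key[OF U]] by blast
  qed
qed

lemma fits_mono: "fits D d \<Longrightarrow> d \<le> e \<Longrightarrow> fits D e"
  unfolding fits_def by (meson order_trans)

lemma finite_fits:
  assumes "finite D"
  shows "\<exists>d::nat. fits D (int d)"
proof -
  define N where "N = Max (insert 0 ((\<lambda>z. \<bar>fst z\<bar> + \<bar>snd z\<bar>) ` D))"
  have N: "\<bar>x\<bar> + \<bar>y\<bar> \<le> N" if "(x, y) \<in> D" for x y
    unfolding N_def using assms that by (intro Max_ge) (auto intro!: rev_image_eqI[OF that])
  have "0 \<le> N" unfolding N_def using assms by (intro Max_ge) auto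
  have "fits D (3 * N)"
    by (rule fits_simplexI[where A = "- N" and B = "- N" and C = N]) (use N in force)+
  then show ?thesis using \<open>0 \<le> N\<close> by (intro exI[of _ "nat (3 * N)"]) simp
qed

text \<open>Replaces the least-number definition by a comparison valid for every integer
  \<open>e\<close>; for negative \<open>e\<close> both sides fail because \<open>D\<close> is
  nonempty.\<close>

lemma lattice_size_le_iff:
  assumes "finite D" "D \<noteq> {}"
  shows "lattice_size (convex hull (emb ` D)) \<le> e \<longleftrightarrow> fits D e"
proof -
  define k where "k = (LEAST d::nat. fits D (int d))"
  have ls: "lattice_size (convex hull (emb ` D)) = int k"
    unfolding lattice_size_def k_def fits_iff_unimodular using assms(2) by simp
  have k: "fits D (int k)" unfolding k_def using finite_fits[OF assms(1)] by (rule LeastI_ex)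
  show ?thesis
  proof
    assume "lattice_size (convex hull (emb ` D)) \<le> e"
    then show "fits D e" using fits_mono[OF k] ls by simp
  next
    assume e: "fits D e"
    then have "0 \<le> e" using fits_imp_nonneg assms(2) by blast
    then have "fits D (int (nat e))" using e by simp
    then have "k \<le> nat e" unfolding k_def by (rule Least_le)
    then show "lattice_size (convex hull (emb ` D)) \<le> e" using ls \<open>0 \<le> e\<close> by linarith
  qed
qed

lemma lattice_size_eqI:
  assumes "finite D" "fits D n" "\<And>e. fits D e \<Longrightarrow> n \<le> e" "D \<noteq> {}"
  shows "lattice_size (convex hull (emb ` D)) = n"
  using assms lattice_size_le_iff[OF assms(1,4)] by (metis order_antisym order_refl)

lemma lattice_size_empty: "lattice_size {} = -2"
  by (simp add: lattice_size_def)

lemma interior_polygon_eq: "interior_polygon P = convex hull (emb ` lattice_of (interior P))"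
  unfolding interior_polygon_def Int_int_points ..

lemma finite_lattice_of:
  assumes "bounded S"
  shows "finite (lattice_of S)"
proof -
  obtain B where B: "\<And>v. v \<in> S \<Longrightarrow> norm v \<le> B" using assms unfolding bounded_iff by blast
  define N where "N = \<lceil>B\<rceil>"
  have "lattice_of S \<subseteq> {-N..N} \<times> {-N..N}"
  proof
    fix z assume "z \<in> lattice_of S"
    then have "norm (emb z) \<le> B" using B unfolding lattice_of_def by blast
    then have "\<bar>real_of_int (fst z)\<bar> \<le> B" "\<bar>real_of_int (snd z)\<bar> \<le> B"
      using norm_fst_le[of "fst (emb z)" "snd (emb z)"] norm_snd_le[of "snd (emb z)" "fst (emb z)"]
      by (auto simp: emb_def)
    then have "\<bar>fst z\<bar> \<le> N" "\<bar>snd z\<bar> \<le> N" unfolding N_def by linarith+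
    then show "z \<in> {-N..N} \<times> {-N..N}" by (cases z) auto
  qed
  then show ?thesis by (rule finite_subset) simp
qed

lemma lattice_polygonD:
  assumes "lattice_polygon P"
  shows "P = convex hull (emb ` lattice_of P)" "finite (lattice_of P)" "convex P"
proof -
  obtain S where S: "finite S" "S \<subseteq> int_points" "P = convex hull S" using assms unfolding lattice_polygon_def by blast
  show conv: "convex P" unfolding S(3) by (rule convex_convex_hull)
  show "finite (lattice_of P)"
    unfolding S(3) by (intro finite_lattice_of finite_imp_bounded_convex_hull S(1))
  have "S \<subseteq> emb ` lattice_of P" unfolding Int_int_points[symmetric] using S(2,3) hull_subset[of S convex] by auto
  then have "P \<subseteq> convex hull (emb ` lattice_of P)" unfolding S(3) by (intro hull_mono)
  moreover have "convex hull (emb ` lattice_of P) \<subseteq> P"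
    using conv by (intro hull_minimal) (auto simp: lattice_of_def)
  ultimately show "P = convex hull (emb ` lattice_of P)" by blast
qed

subsection \<open>Lower bounds and rows\<close>

text \<open>By invertibility one of the two new coordinates involves \<open>x\<close>, so it changes
  by at least \<open>L\<close> along the segment, while both coordinates stay between 0 and
  \<open>e\<close>.\<close>

lemma fits_segment_le:
  assumes "fits D e" "(x, y) \<in> D" "(x + L, y) \<in> D" "0 \<le> L"
  shows "L \<le> e"
proof -
  obtain U where U: "int_unimodular U" "\<forall>z\<in>D. 0 \<le> fst (U z) \<and> 0 \<le> snd (U z) \<and> fst (U z) + snd (U z) \<le> e"
    using assms(1) unfolding fits_def by blast
  obtain a b c d k l where det: "a * d - b * c = 1 \<or> a * d - b * c = -1" and Ueq: "U = aff_map a b c d k l"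
    using U(1) unfolding int_unimodular_def by blast
  have 1: "0 \<le> a * x + b * y + k" "0 \<le> c * x + d * y + l" "a * x + b * y + k + (c * x + d * y + l) \<le> e"
    using U(2) assms(2) unfolding Ueq by force+
  have 2: "0 \<le> a * (x + L) + b * y + k" "0 \<le> c * (x + L) + d * y + l"
    "a * (x + L) + b * y + k + (c * (x + L) + d * y + l) \<le> e"
    using U(2) assms(3) unfolding Ueq by force+
  have "a \<noteq> 0 \<or> c \<noteq> 0" using det by auto
  then have "1 \<le> \<bar>a\<bar> \<or> 1 \<le> \<bar>c\<bar>" by auto
  moreover have "\<bar>a * L\<bar> \<le> e" "\<bar>c * L\<bar> \<le> e" using 1 2 by (auto simp: algebra_simps)
  ultimately show ?thesis
    using mult_right_mono[of 1 "\<bar>a\<bar>" L] mult_right_mono[of 1 "\<bar>c\<bar>" L] assms(4)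
    by (auto simp: abs_mult)
qed

text \<open>\<open>k\<close> and \<open>m\<close> are the coefficients of one old variable in the
  two new coordinates. The three inner side functionals of the simplex have coefficients
  \<open>k\<close>, \<open>m\<close> and \<open>- (k + m)\<close>, not all zero and with sum zero,
  so one is negative. The points \<open>p\<close>, \<open>q\<close>, \<open>r\<close> make that
  functional small and leave the others at the end 0.\<close>

lemma box_width_aux:
  fixes k m a :: int
  assumes "k \<noteq> 0 \<or> m \<noteq> 0" "0 \<le> a"
  obtains p q r where "p \<in> {0, a}" "q \<in> {0, a}" "r \<in> {0, a}" "a \<le> (k + m) * r - k * p - m * q"
proof -
  consider "k \<le> -1" | "m \<le> -1" | "1 \<le> k + m" using assms(1) by linarith
  then show thesis
  proof cases
    case 1
    then have "1 * a \<le> (- k) * a" using assms(2) by (intro mult_right_mono) auto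
    then show thesis by (intro that[of a 0 0]) auto
  next
    case 2
    then have "1 * a \<le> (- m) * a" using assms(2) by (intro mult_right_mono) auto
    then show thesis by (intro that[of 0 a 0]) auto
  next
    case 3
    then have "1 * a \<le> (k + m) * a" using assms(2) by (intro mult_right_mono) auto
    then show thesis by (intro that[of 0 0 a]) auto
  qed
qed

text \<open>Each of the three simplex inequalities is evaluated at its own corner of the box, with
  the two coordinates of the corner chosen independently. Adding them cancels the translation and
  the base point and leaves the widths \<open>a\<close> and \<open>b\<close>.\<close>

lemma fits_box_le:
  assumes "fits D e" "0 \<le> a" "0 \<le> b"
    and D: "\<And>p q. p \<in> {0, a} \<Longrightarrow> q \<in> {0, b} \<Longrightarrow> (x + p, y + q) \<in> D"
  shows "a + b \<le> e"
proof -
  obtain U where U: "int_unimodular U" "\<forall>z\<in>D. 0 \<le> fst (U z) \<and> 0 \<le> snd (U z) \<and> fst (U z) + snd (U z) \<le> e"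
    using assms(1) unfolding fits_def by blast
  obtain k l m n X Y where det: "k * n - l * m = 1 \<or> k * n - l * m = -1" and Ueq: "U = aff_map k l m n X Y"
    using U(1) unfolding int_unimodular_def by blast
  have km: "k \<noteq> 0 \<or> m \<noteq> 0" and ln: "l \<noteq> 0 \<or> n \<noteq> 0" using det by auto
  obtain p q r where p: "p \<in> {0, a}" "q \<in> {0, a}" "r \<in> {0, a}" "a \<le> (k + m) * r - k * p - m * q"
    using box_width_aux[OF km assms(2)] .
  obtain p' q' r' where p': "p' \<in> {0, b}" "q' \<in> {0, b}" "r' \<in> {0, b}" "b \<le> (l + n) * r' - l * p' - n * q'"
    using box_width_aux[OF ln assms(3)] .
  have "0 \<le> k * (x + p) + l * (y + p') + X" using U(2) D[OF p(1) p'(1)] unfolding Ueq by force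
  moreover have "0 \<le> m * (x + q) + n * (y + q') + Y" using U(2) D[OF p(2) p'(2)] unfolding Ueq by force
  moreover have "k * (x + r) + l * (y + r') + X + (m * (x + r) + n * (y + r') + Y) \<le> e"
    using U(2) D[OF p(3) p'(3)] unfolding Ueq by force
  ultimately have "((k + m) * r - k * p - m * q) + ((l + n) * r' - l * p' - n * q') \<le> e"
    by (simp add: algebra_simps)
  then show ?thesis using p(4) p'(4) by linarith
qed

text \<open>If row 0 is at least four longer than row 1 of the interior, the polygon narrows so fast
  that both rows alone determine the lattice sizes.\<close>

lemma row_bound_interior:
  assumes ab: "absorbs D I" and D: "(0, 0) \<in> D" "(L, 0) \<in> D"
    and I: "(1, 1) \<in> I" "(l + 1, 1) \<in> I" "(0, 1) \<notin> I" "(l + 2, 1) \<notin> I"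
    and L: "0 \<le> l" "l + 4 \<le> L" and xy: "(x, y) \<in> I" "1 \<le> y"
  shows "1 \<le> x \<and> x + y \<le> l + 2"
proof (intro conjI; rule ccontr)
  have ID: "I \<subseteq> D" using ab unfolding absorbs_def by blast
  {
    assume "\<not> 1 \<le> x"
    then have "(0, 1) \<in> I"
      using absorbsD[OF ab xy(1) subsetD[OF ID I(1)] D(1), of 1 "- x" "y - 1" 0 1] xy(2)
      by (simp add: algebra_simps)
    then show False using I(3) by simp
  next
    assume c: "\<not> x + y \<le> l + 2"
    \<comment> \<open>The horizontal distance of \<open>(x, y)\<close> beyond the line through
      \<open>(L, 0)\<close> and the missing point \<open>(l + 2, 1)\<close>. If it is nonnegative,
      that point is a combination of \<open>(x, y)\<close>, \<open>(l + 1, 1)\<close> and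
      \<open>(L, 0)\<close> with weights 1, \<open>s\<close> and \<open>y - 1\<close>.\<close>
    define s where "s = x + (y - 1) * L - (l + 2) * y"
    have "(y - 1) * (l + 4) \<le> (y - 1) * L" using L xy(2) by (intro mult_left_mono) auto
    then have "0 \<le> s" unfolding s_def using c xy(2) by (simp add: algebra_simps)
    then have "(l + 2, 1) \<in> I"
      using absorbsD[OF ab xy(1) subsetD[OF ID I(2)] D(2), of 1 s "y - 1" "l + 2" 1] xy(2)
      by (simp add: s_def algebra_simps)
    then show False using I(4) by simp
  }
qed

text \<open>Since \<open>(x, y)\<close> need not be in \<open>I\<close>, the positive weight must
  fall on \<open>(1, 1)\<close> or on \<open>(l + 1, 1)\<close>. So \<open>s\<close> has to be
  strictly positive, and the weaker bound \<open>L\<close> instead of \<open>l + 2\<close> makes it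
  so.\<close>

lemma row_bound:
  assumes ab: "absorbs D I" and D: "(0, 0) \<in> D" "(L, 0) \<in> D"
    and I: "(1, 1) \<in> I" "(l + 1, 1) \<in> I" "(0, 1) \<notin> I" "(l + 2, 1) \<notin> I"
    and L: "0 \<le> l" "l + 4 \<le> L" and xy: "(x, y) \<in> D" "1 \<le> y"
  shows "0 \<le> x \<and> x + y \<le> L"
proof (intro conjI; rule ccontr)
  assume "\<not> 0 \<le> x"
  then have "(0, 1) \<in> I"
    using absorbsD[OF ab I(1) xy(1) D(1), of "- x" 1 "y - 1" 0 1] xy(2)
    by (simp add: algebra_simps)
  then show False using I(3) by simp
next
  assume c: "\<not> x + y \<le> L"
  define s where "s = x + (y - 1) * L - (l + 2) * y"
  have "y * (l + 4) \<le> y * L" using L xy(2) by (intro mult_left_mono) auto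
  then have "0 < s" unfolding s_def using c xy(2) by (simp add: algebra_simps)
  then have "(l + 2, 1) \<in> I"
    using absorbsD[OF ab I(2) xy(1) D(2), of s 1 "y - 1" "l + 2" 1] xy(2)
    by (simp add: s_def algebra_simps)
  then show False using I(4) by simp
qed

text \<open>The case in which row 1 of \<open>I\<close> ends at \<open>(1, 1)\<close>. Any row-0
  point at distance at least 4 and any point of height at least 2 confine each other so strongly
  that they must be \<open>(4, 0)\<close> and \<open>(0, 2)\<close>.\<close>

lemma triangle_of_long_axis:
  assumes ab: "absorbs D I" and I: "(1, 1) \<in> I" "(2, 1) \<notin> I" and D: "(L, 0) \<in> D" "4 \<le> L"
    and pos: "\<And>x y. (x, y) \<in> D \<Longrightarrow> 0 \<le> x \<and> 0 \<le> y" and w: "(w, h) \<in> D" "2 \<le> h"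
  shows "(4, 0) \<in> D" "(0, 2) \<in> D" "(x, y) \<in> D \<Longrightarrow> x + 2 * y \<le> 4"
proof -
  have high: "l = 4 \<and> x = 0 \<and> y = 2" if l: "(l, 0) \<in> D" "4 \<le> l" and xy: "(x, y) \<in> D" "2 \<le> y" for l x y
  proof -
    \<comment> \<open>The excess of \<open>(x, y)\<close> over the line through
      \<open>(l, 0)\<close> and \<open>(2, 1)\<close>; if positive, it would be the weight of
      \<open>(1, 1)\<close> in a combination giving \<open>(2, 1)\<close>.\<close>
    define s where "s = x + (y - 1) * l - 2 * y"
    have "\<not> 0 < s"
    proof
      assume "0 < s"
      then have "(2, 1) \<in> I"
        using absorbsD[OF ab I(1) xy(1) l(1), of s 1 "y - 1" 2 1] xy(2)
        by (simp add: s_def algebra_simps)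
      then show False using I(2) by simp
    qed
    then have s: "x + (y - 1) * l \<le> 2 * y" unfolding s_def by simp
    have "(y - 1) * 4 \<le> (y - 1) * l" using l xy(2) by (intro mult_left_mono) auto
    then have "x + 2 * y \<le> 4" using s by (simp add: algebra_simps)
    then have "x = 0" "y = 2" using xy pos[OF xy(1)] by auto
    then show ?thesis using s l(2) by simp
  qed
  have "L = 4" "w = 0" "h = 2" using high[OF D w] by auto
  then show "(4, 0) \<in> D" "(0, 2) \<in> D" using D w by auto
  show "x + 2 * y \<le> 4" if xy: "(x, y) \<in> D"
  proof -
    consider "y = 0" | "y = 1" | "2 \<le> y" using pos[OF xy] by linarith
    then show ?thesis
    proof cases
      case 1
      then show ?thesis using high[of x w h] xy w by force
    next
      case 2
      have "\<not> 3 \<le> x"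
      proof
        assume "3 \<le> x"
        then have "(2, 1) \<in> I"
          using absorbsD[OF ab I(1) xy xy, of "x - 2" 1 0 2 1] 2 by (simp add: algebra_simps)
        then show False using I(2) by simp
      qed
      then show ?thesis using 2 by simp
    next
      case 3
      then show ?thesis using high[OF D xy] by simp
    qed
  qed
qed

section \<open>Lattice points of convex sets without interior lattice points\<close>

definition hollow :: "(int \<times> int) set \<Rightarrow> bool" where
  "hollow D \<longleftrightarrow> (\<exists>S. convex S \<and> D = lattice_of S \<and> lattice_of (interior S) = {})"

lemma hollow_image:
  assumes "int_unimodular U" "hollow D"
  shows "hollow (U ` D)"
proof -
  obtain S where S: "convex S" "D = lattice_of S" "lattice_of (interior S) = {}"
    using assms(2) unfolding hollow_def by blast
  obtain \<phi> where \<phi>: "realizes \<phi> U" using realizes_exists[OF assms(1)] by blast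
  show ?thesis unfolding hollow_def
    using realizes_convex[OF \<phi> S(1)] realizes_lattice_of[OF \<phi>] realizes_interior[OF \<phi>] S(2,3)
    by (intro exI[of _ "\<phi> ` S"]) simp
qed

lemma hollow_convex_comb:
  assumes "hollow D" "(u1, u2) \<in> D" "(w1, w2) \<in> D" "(z1, z2) \<in> D"
    "0 \<le> s" "0 \<le> t" "0 \<le> r" "0 < s + t + r"
    "(s + t + r) * q1 = s * u1 + t * w1 + r * z1" "(s + t + r) * q2 = s * u2 + t * w2 + r * z2"
  shows "(q1, q2) \<in> D"
  using assms lattice_of_convex_comb unfolding hollow_def by blast

lemma hollow_supporting:
  assumes "hollow D" "(q1, q2) \<in> D"
  obtains a b :: real where "a \<noteq> 0 \<or> b \<noteq> 0"
    "\<And>x y. (x, y) \<in> D \<Longrightarrow> 0 \<le> a * of_int (x - q1) + b * of_int (y - q2)"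
proof -
  obtain S where S: "convex S" "D = lattice_of S" "lattice_of (interior S) = {}"
    using assms(1) unfolding hollow_def by blast
  show thesis using lattice_supporting_functional[OF S(1), of q1 q2] assms(2) S(2,3) that by blast
qed

text \<open>A supporting functional at \<open>q\<close> is nonnegative at the three corners and has
  weighted sum zero there with positive weights. It vanishes at all of them, and a nonzero
  functional does so only on collinear points.\<close>

lemma hollow_triangle:
  assumes "hollow D" "(u1, u2) \<in> D" "(w1, w2) \<in> D" "(z1, z2) \<in> D"
    "0 < s" "0 < t" "0 < r"
    "(s + t + r) * q1 = s * u1 + t * w1 + r * z1" "(s + t + r) * q2 = s * u2 + t * w2 + r * z2"
  shows "(w1 - u1) * (z2 - u2) = (w2 - u2) * (z1 - u1)"
proof -
  have q: "(q1, q2) \<in> D" using hollow_convex_comb[OF assms(1-4) _ _ _ _ assms(8,9)] assms(5-7) by simp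
  obtain a b :: real where ab: "a \<noteq> 0 \<or> b \<noteq> 0"
    and sup: "\<And>x y. (x, y) \<in> D \<Longrightarrow> 0 \<le> a * of_int (x - q1) + b * of_int (y - q2)"
    using hollow_supporting[OF assms(1) q] by blast
  define f where "f = (\<lambda>x y :: int. a * of_int (x - q1) + b * of_int (y - q2))"
  have f0: "0 \<le> f u1 u2" "0 \<le> f w1 w2" "0 \<le> f z1 z2" using sup assms(2-4) unfolding f_def by auto
  have "of_int s * f u1 u2 + of_int t * f w1 w2 + of_int r * f z1 z2
      = a * of_int (s * u1 + t * w1 + r * z1 - (s + t + r) * q1) + b * of_int (s * u2 + t * w2 + r * z2 - (s + t + r) * q2)"
    unfolding f_def by (simp add: algebra_simps)
  also have "\<dots> = 0" using assms(8,9) by simp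
  finally have sum: "of_int s * f u1 u2 + of_int t * f w1 w2 + of_int r * f z1 z2 = 0" .
  have nn: "0 \<le> of_int s * f u1 u2" "0 \<le> of_int t * f w1 w2" "0 \<le> of_int r * f z1 z2"
    using f0 assms(5-7) by auto
  have "of_int s * f u1 u2 = 0" "of_int t * f w1 w2 = 0" "of_int r * f z1 z2 = 0"
    using sum nn by linarith+
  then have f: "f u1 u2 = 0" "f w1 w2 = 0" "f z1 z2 = 0" using assms(5-7) by auto
  have 1: "a * of_int (w1 - u1) + b * of_int (w2 - u2) = 0"
    using f(1,2) unfolding f_def by (simp add: algebra_simps)
  have 2: "a * of_int (z1 - u1) + b * of_int (z2 - u2) = 0"
    using f(1,3) unfolding f_def by (simp add: algebra_simps)
  have "a * (of_int (w1 - u1) * of_int (z2 - u2) - of_int (w2 - u2) * of_int (z1 - u1)) = 0"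
    using 1 2 by algebra
  moreover have "b * (of_int (w1 - u1) * of_int (z2 - u2) - of_int (w2 - u2) * of_int (z1 - u1)) = 0"
    using 1 2 by algebra
  ultimately have "real_of_int (w1 - u1) * of_int (z2 - u2) - of_int (w2 - u2) * of_int (z1 - u1) = 0"
    using ab by auto
  then have "real_of_int ((w1 - u1) * (z2 - u2)) = of_int ((w2 - u2) * (z1 - u1))" by simp
  then show ?thesis by (simp only: of_int_eq_iff)
qed

text \<open>A lattice point strictly inside a segment has a supporting line, which must contain the
  segment; hence all of \<open>D\<close> lies on one side of it.\<close>

lemma hollow_segment:
  assumes "hollow D" "(u1, u2) \<in> D" "(w1, w2) \<in> D" "0 < s" "0 < t"
    "(s + t) * q1 = s * u1 + t * w1" "(s + t) * q2 = s * u2 + t * w2"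
    "(x, y) \<in> D" "(x', y') \<in> D"
    "0 < (w1 - u1) * (y - u2) - (w2 - u2) * (x - u1)"
  shows "0 \<le> (w1 - u1) * (y' - u2) - (w2 - u2) * (x' - u1)"
proof (rule ccontr)
  assume neg: "\<not> ?thesis"
  have q: "(q1, q2) \<in> D"
    using hollow_convex_comb[OF assms(1,2,3,2), of s t 0] assms(4-7) by simp
  obtain a b :: real where ab: "a \<noteq> 0 \<or> b \<noteq> 0"
    and sup: "\<And>x y. (x, y) \<in> D \<Longrightarrow> 0 \<le> a * of_int (x - q1) + b * of_int (y - q2)"
    using hollow_supporting[OF assms(1) q] by blast
  define f where "f = (\<lambda>x y :: int. a * of_int (x - q1) + b * of_int (y - q2))"
  have f0: "0 \<le> f u1 u2" "0 \<le> f w1 w2" "0 \<le> f x y" "0 \<le> f x' y'"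
    using sup assms(2,3,8,9) unfolding f_def by auto
  have "of_int s * f u1 u2 + of_int t * f w1 w2
      = a * of_int (s * u1 + t * w1 - (s + t) * q1) + b * of_int (s * u2 + t * w2 - (s + t) * q2)"
    unfolding f_def by (simp add: algebra_simps)
  also have "\<dots> = 0" using assms(6,7) by simp
  finally have sum: "of_int s * f u1 u2 + of_int t * f w1 w2 = 0" .
  have nn: "0 \<le> of_int s * f u1 u2" "0 \<le> of_int t * f w1 w2" using f0 assms(4,5) by auto
  have "of_int s * f u1 u2 = 0" "of_int t * f w1 w2 = 0" using sum nn by linarith+
  then have f: "f u1 u2 = 0" "f w1 w2 = 0" using assms(4,5) by auto
  define A B where "A = real_of_int (w1 - u1)" and "B = real_of_int (w2 - u2)"
  define F where "F = (\<lambda>x y :: int. A * of_int (y - u2) - B * of_int (x - u1))"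
  have orth: "a * A + b * B = 0"
    using f unfolding f_def A_def B_def by (simp add: algebra_simps)
  have fF: "f x y = a * of_int (x - u1) + b * of_int (y - u2)" for x y
    using f(1) unfolding f_def by (simp add: algebra_simps)
  have F1: "0 < F x y" and F2: "F x' y' < 0"
  proof -
    have "F x y = of_int ((w1 - u1) * (y - u2) - (w2 - u2) * (x - u1))" for x y
      unfolding F_def A_def B_def by simp
    note F = this
    show "0 < F x y" unfolding F of_int_0_less_iff by (rule assms(10))
    show "F x' y' < 0" unfolding F of_int_less_0_iff using neg by linarith
  qed
  have Af: "A * f x y = b * F x y" "B * f x y = - a * F x y" for x y
    unfolding fF F_def using orth by algebra+
  \<comment> \<open>At the two given points \<open>f\<close> has values of equal sign while
    \<open>F\<close> changes sign, so a relation \<open>C * f = c * F\<close> is possible only with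
    \<open>c = 0\<close>.\<close>
  have zero: "c = 0" if c: "\<And>x y. C * f x y = c * F x y" for C c :: real
  proof (rule ccontr)
    assume "c \<noteq> 0"
    have "0 \<le> C\<^sup>2 * (f x y * f x' y')" using f0 by simp
    also have "\<dots> = (C * f x y) * (C * f x' y')" by (simp add: power2_eq_square)
    also have "\<dots> = c\<^sup>2 * (F x y * F x' y')" unfolding c by (simp add: power2_eq_square)
    also have "\<dots> < 0" using F1 F2 \<open>c \<noteq> 0\<close> by (simp add: mult_pos_neg)
    finally show False by simp
  qed
  have "b = 0" "- a = 0" by (rule zero[OF Af(1)], rule zero[OF Af(2)])
  then show False using ab by simp
qed

subsection \<open>Hollow polygons\<close>

definition equiv_to :: "((int \<times> int) set \<Rightarrow> bool) \<Rightarrow> (int \<times> int) set \<Rightarrow> bool" where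
  "equiv_to P D \<longleftrightarrow> (\<exists>U. int_unimodular U \<and> P (U ` D))"

lemma equiv_to_image:
  assumes "int_unimodular W" "equiv_to P (W ` D)"
  shows "equiv_to P D"
proof -
  obtain U where U: "int_unimodular U" "P (U ` W ` D)" using assms(2) unfolding equiv_to_def by blast
  obtain V where "int_unimodular V" "\<forall>S. V ` S = U ` W ` S" using int_unimodular_image_image[OF assms(1) U(1)] by blast
  then show ?thesis using U(2) unfolding equiv_to_def by metis
qed

lemma equiv_toI: "P D \<Longrightarrow> equiv_to P D"
  unfolding equiv_to_def
  by (intro exI[of _ "aff_map 1 0 0 1 0 0"] conjI int_unimodular_aff_map) (simp_all add: aff_map_def)

definition trapezoidal :: "int \<Rightarrow> int \<Rightarrow> (int \<times> int) set \<Rightarrow> bool" where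
  "trapezoidal a b D \<longleftrightarrow> {(0, 0), (a, 0), (0, 1), (b, 1)} \<subseteq> D \<and>
     (\<forall>x y. (x, y) \<in> D \<longrightarrow> 0 \<le> x \<and> (y = 0 \<and> x \<le> a \<or> y = 1 \<and> x \<le> b))"

definition double_simplex :: "(int \<times> int) set \<Rightarrow> bool" where
  "double_simplex D \<longleftrightarrow> {(0, 0), (2, 0), (0, 2)} \<subseteq> D \<and> (\<forall>x y. (x, y) \<in> D \<longrightarrow> 0 \<le> x \<and> 0 \<le> y \<and> x + y \<le> 2)"

text \<open>The integral form of two-dimensionality: no frame moves \<open>D\<close> into the line
  \<open>y = 0\<close>.\<close>

definition planar :: "(int \<times> int) set \<Rightarrow> bool" where
  "planar D \<longleftrightarrow> D \<noteq> {} \<and> (\<forall>U. int_unimodular U \<longrightarrow> (\<exists>z\<in>D. snd (U z) \<noteq> 0))"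

text \<open>Bezout coefficients of the direction vector form the first matrix row and its primitive
  normal the second, so the segment becomes horizontal with its lattice length as
  coordinate.\<close>

lemma segment_frame:
  fixes u w :: "int \<times> int"
  assumes "u \<noteq> w"
  shows "\<exists>U. int_unimodular U \<and> U u = (0, 0) \<and> U w = (gcd (fst w - fst u) (snd w - snd u), 0)"
proof -
  obtain u1 u2 w1 w2 where uw: "u = (u1, u2)" "w = (w1, w2)" by fastforce
  define g where "g = gcd (w1 - u1) (w2 - u2)"
  have g0: "g \<noteq> 0" using assms uw unfolding g_def by auto
  obtain k1 k2 where k: "w1 - u1 = g * k1" "w2 - u2 = g * k2" unfolding g_def by (meson dvdE gcd_dvd1 gcd_dvd2)
  obtain a b where ab: "a * (w1 - u1) + b * (w2 - u2) = g" using bezout_int unfolding g_def by blast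
  have "g * (a * k1 + b * k2) = g * 1" using ab unfolding k by (simp add: algebra_simps)
  then have det: "a * k1 + b * k2 = 1" using g0 by simp
  define U where "U = aff_map a b (- k2) k1 (- a * u1 - b * u2) (k2 * u1 - k1 * u2)"
  have "int_unimodular U" unfolding U_def using det by (intro int_unimodular_aff_map) (simp add: algebra_simps)
  moreover have "U u = (0, 0)" unfolding U_def uw by (simp add: algebra_simps)
  moreover have "U w = (g, 0)"
  proof -
    have "a * w1 + b * w2 + (- a * u1 - b * u2) = g" using ab by (simp add: algebra_simps)
    moreover have "- k2 * w1 + k1 * w2 + (k2 * u1 - k1 * u2) = k1 * (w2 - u2) - k2 * (w1 - u1)"
      by (simp add: algebra_simps)
    then have "- k2 * w1 + k1 * w2 + (k2 * u1 - k1 * u2) = 0" unfolding k by simp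
    ultimately show ?thesis unfolding U_def uw by simp
  qed
  ultimately show ?thesis unfolding g_def uw by auto
qed

text \<open>Every lattice segment starts at the origin and runs along the first axis in some frame,
  so ranging over all frames compares \<open>L\<close> with the lattice length of all segments of
  \<open>D\<close>.\<close>

definition longest_axis :: "(int \<times> int) set \<Rightarrow> int \<Rightarrow> bool" where
  "longest_axis D L \<longleftrightarrow> (0, 0) \<in> D \<and> (L, 0) \<in> D \<and>
     (\<forall>U m. int_unimodular U \<longrightarrow> (0, 0) \<in> U ` D \<longrightarrow> (m, 0) \<in> U ` D \<longrightarrow> m \<le> L)"

lemma longest_axisD:
  assumes "longest_axis D L" "int_unimodular U" "(0, 0) \<in> U ` D" "(m, 0) \<in> U ` D"
  shows "m \<le> L"
  using assms unfolding longest_axis_def by blast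

lemma longest_axis_row:
  assumes "longest_axis D L" "(x, y) \<in> D" "(x + m, y) \<in> D"
  shows "m \<le> L"
proof (rule longest_axisD[OF assms(1)])
  show "int_unimodular (aff_map 1 0 0 1 (- x) (- y))" by (rule int_unimodular_aff_map) simp
  show "(0, 0) \<in> aff_map 1 0 0 1 (- x) (- y) ` D" by (rule image_eqI[OF _ assms(2)]) simp
  show "(m, 0) \<in> aff_map 1 0 0 1 (- x) (- y) ` D" by (rule image_eqI[OF _ assms(3)]) simp
qed

lemma longest_axis_image:
  assumes "longest_axis D L" "int_unimodular W" "(0, 0) \<in> W ` D" "(L, 0) \<in> W ` D"
  shows "longest_axis (W ` D) L"
  unfolding longest_axis_def
proof (intro conjI allI impI assms(3,4))
  fix U m assume U: "int_unimodular U" "(0, 0) \<in> U ` W ` D" "(m, 0) \<in> U ` W ` D"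
  obtain V where V: "int_unimodular V" "\<forall>S. V ` S = U ` W ` S" using int_unimodular_image_image[OF assms(2) U(1)] by blast
  show "m \<le> L" by (rule longest_axisD[OF assms(1) V(1)]) (use U V(2) in simp_all)
qed

text \<open>Lengths are bounded because \<open>D\<close> fits some simplex, and planarity provides
  two distinct points, so the maximum is at least 1.\<close>

lemma exists_longest_axis:
  assumes "finite D" "planar D"
  obtains W L where "int_unimodular W" "1 \<le> L" "longest_axis (W ` D) L"
proof -
  define M where "M = {m::nat. \<exists>U. int_unimodular U \<and> (0, 0) \<in> U ` D \<and> (int m, 0) \<in> U ` D}"
  obtain e where e: "fits D (int e)" using finite_fits[OF assms(1)] by blast
  have "M \<subseteq> {..e}"
  proof
    fix m assume "m \<in> M"
    then obtain U where U: "int_unimodular U" "(0, 0) \<in> U ` D" "(int m, 0) \<in> U ` D" unfolding M_def by blast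
    have "fits (U ` D) (int e)" using e fits_image_iff[OF U(1)] by simp
    then show "m \<in> {..e}" using fits_segment_le[of "U ` D" "int e" 0 0 "int m"] U by simp
  qed
  then have fin: "finite M" by (rule finite_subset) simp
  obtain u where u: "u \<in> D" using assms(2) unfolding planar_def by blast
  have "int_unimodular (aff_map 1 0 0 1 0 (- snd u))" by (rule int_unimodular_aff_map) simp
  then obtain w where w: "w \<in> D" "snd (aff_map 1 0 0 1 0 (- snd u) w) \<noteq> 0" using assms(2) unfolding planar_def by blast
  then have "u \<noteq> w" by (auto simp: aff_map_def)
  define g where "g = gcd (fst w - fst u) (snd w - snd u)"
  have g1: "1 \<le> g" using \<open>u \<noteq> w\<close> unfolding g_def by (smt (verit) gcd_eq_0_iff gcd_ge_0_int prod_eq_iff)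
  obtain U where U: "int_unimodular U" "U u = (0, 0)" "U w = (g, 0)" using segment_frame[OF \<open>u \<noteq> w\<close>] unfolding g_def by blast
  have "(0, 0) \<in> U ` D" "(g, 0) \<in> U ` D" using U(2,3) u w(1) by (metis image_eqI)+
  then have gM: "nat g \<in> M" unfolding M_def using U(1) g1 by auto
  define L where "L = Max M"
  have "L \<in> M" unfolding L_def using fin gM by (intro Max_in) auto
  then obtain W where W: "int_unimodular W" "(0, 0) \<in> W ` D" "(int L, 0) \<in> W ` D" unfolding M_def by blast
  have "nat g \<le> L" unfolding L_def using fin gM by simp
  then have "1 \<le> int L" using g1 by linarith
  moreover have "longest_axis (W ` D) (int L)"
    unfolding longest_axis_def
  proof (intro conjI allI impI W)
    fix U m assume U: "int_unimodular U" "(0, 0) \<in> U ` W ` D" "(m, 0) \<in> U ` W ` D"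
    obtain V where V: "int_unimodular V" "\<forall>S. V ` S = U ` W ` S" using int_unimodular_image_image[OF W(1) U(1)] by blast
    show "m \<le> int L"
    proof (cases "0 \<le> m")
      case True
      then have "nat m \<in> M" unfolding M_def using V U(2,3) by auto
      then have "nat m \<le> L" unfolding L_def using fin by simp
      then show ?thesis by linarith
    qed simp
  qed
  ultimately show thesis using that W(1) by blast
qed

text \<open>Since \<open>L\<close> is at least 2, \<open>(1, 0)\<close> is strictly inside the axis
  segment and pushes \<open>D\<close> to one side of it. A point at height 2 or more forces the
  double simplex; otherwise \<open>D\<close> consists of two rows, of which row 0 is the longer by
  maximality.\<close>

lemma hollow_long:
  assumes h: "hollow D" and fin: "finite D" and L: "longest_axis D L" "2 \<le> L" and w: "(w1, w2) \<in> D" "0 < w2"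
  shows "(\<exists>b. 0 \<le> b \<and> b \<le> L \<and> equiv_to (trapezoidal L b) D) \<or> equiv_to double_simplex D"
proof -
  have D0: "(0, 0) \<in> D" "(L, 0) \<in> D" using L(1) unfolding longest_axis_def by auto
  have ypos: "0 \<le> y" if "(x, y) \<in> D" for x y
  proof -
    have "0 \<le> (L - 0) * (y - 0) - (0 - 0) * (x - 0)"
      by (rule hollow_segment[OF h D0, of "L - 1" 1 1 0 w1 w2]) (use L w that in auto)
    then show ?thesis using L(2) by (simp add: zero_le_mult_iff)
  qed
  have row0: "0 \<le> x \<and> x \<le> L" if "(x, 0) \<in> D" for x
    using longest_axis_row[OF L(1), of x 0 "L - x"] longest_axis_row[OF L(1), of 0 0 x] D0 that by auto
  show ?thesis
  proof (cases "\<exists>x y. (x, y) \<in> D \<and> 2 \<le> y")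
    case True
    then obtain x k where xk: "(x, k) \<in> D" "2 \<le> k" by blast
    \<comment> \<open>The least integer greater than \<open>x / k\<close>, where
      \<open>x / k\<close> is the left end at height 1 of the triangle with base from
      \<open>(0, 0)\<close> to \<open>(L, 0)\<close> and apex \<open>(x, k)\<close>.\<close>
    define j where "j = x div k + 1"
    have "j * k = x - x mod k + k" unfolding j_def by (simp add: algebra_simps minus_mod_eq_mult_div)
    moreover have "0 \<le> x mod k" "x mod k < k" using xk(2) by auto
    ultimately have j: "x < j * k" "j * k \<le> x + k" by linarith+
    \<comment> \<open>\<open>(j, 1)\<close> may not be strictly inside this triangle, so the right
      end \<open>(x + L * (k - 1)) / k\<close> is at most \<open>j\<close>. As \<open>j * k\<close>
      is at most \<open>x + k\<close>, this leaves only \<open>k = 2\<close> and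
      \<open>L = 2\<close>.\<close>
    have ge: "x + L * (k - 1) \<le> j * k"
    proof (rule ccontr)
      assume c: "\<not> ?thesis"
      have "(L - 0) * (k - 0) = (0 - 0) * (x - 0)"
      proof (rule hollow_triangle[OF h D0 xk(1)])
        show "0 < x + L * (k - 1) - j * k" "0 < j * k - x" "0 < L" using c j L by auto
        show "(x + L * (k - 1) - j * k + (j * k - x) + L) * j = (x + L * (k - 1) - j * k) * 0 + (j * k - x) * L + L * x"
          by (simp add: algebra_simps)
        show "(x + L * (k - 1) - j * k + (j * k - x) + L) * 1 = (x + L * (k - 1) - j * k) * 0 + (j * k - x) * 0 + L * k"
          by (simp add: algebra_simps)
      qed
      then show False using xk(2) L(2) by simp
    qed
    have "2 * (k - 1) \<le> L * (k - 1)" using L xk(2) by (intro mult_right_mono) auto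
    then have "x + 2 * (k - 1) \<le> x + k" using ge j(2) by linarith
    then have k2: "k = 2" using xk(2) by simp
    then have L2: "L = 2" and xe: "x = 2 * (j - 1)" using ge j(2) L(2) by auto
    define W where "W = aff_map 1 (1 - j) 0 1 0 0"
    have W: "int_unimodular W" unfolding W_def by (rule int_unimodular_aff_map) simp
    have hW: "hollow (W ` D)" by (rule hollow_image[OF W h])
    have c0: "(0, 0) \<in> W ` D" using D0(1) by (rule rev_image_eqI) (simp add: W_def)
    have c1: "(2, 0) \<in> W ` D" using D0(2) by (rule rev_image_eqI) (simp add: W_def L2)
    have c2: "(0, 2) \<in> W ` D" using xk(1) by (rule rev_image_eqI) (simp add: W_def k2 xe)
    \<comment> \<open>The midpoints \<open>(0, 1)\<close> and \<open>(1, 1)\<close> of the two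
      remaining sides are lattice points, so \<open>hollow_segment\<close> confines \<open>D\<close>
      along these sides as well.\<close>
    have "double_simplex (W ` D)"
      unfolding double_simplex_def
    proof (intro conjI allI impI)
      fix a b assume ab: "(a, b) \<in> W ` D"
      then show "0 \<le> b" using ypos unfolding W_def by auto
      have "0 \<le> (0 - 0) * (b - 2) - (0 - 2) * (a - 0)"
        by (rule hollow_segment[OF hW c2 c0, of 1 1 0 1 2 0 a b]) (use ab c1 in auto)
      then show "0 \<le> a" by simp
      have "0 \<le> (0 - 2) * (b - 0) - (2 - 0) * (a - 2)"
        by (rule hollow_segment[OF hW c1 c2, of 1 1 1 1 0 0 a b]) (use ab c0 in auto)
      then show "a + b \<le> 2" by simp
    qed (use c0 c1 c2 in auto)
    from equiv_to_image[OF W equiv_toI[of double_simplex, OF this]] show ?thesis ..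
  next
    case False
    then have y1: "y = 0 \<or> y = 1" if "(x, y) \<in> D" for x y using ypos[OF that] that by force
    define R where "R = {x. (x, 1) \<in> D}"
    have "(\<lambda>x. (x, 1)) ` R \<subseteq> D" unfolding R_def by auto
    then have finR: "finite R" using fin by (meson finite_subset finite_imageD inj_onI Pair_inject)
    have neR: "R \<noteq> {}" using w y1[OF w(1)] unfolding R_def by auto
    define c b where "c = Min R" and "b = Max R - Min R"
    have cR: "(c, 1) \<in> D" "(c + b, 1) \<in> D"
      using Min_in[OF finR neR] Max_in[OF finR neR] unfolding c_def b_def R_def by auto
    have R: "c \<le> x \<and> x \<le> c + b" if "(x, 1) \<in> D" for x
      using that finR unfolding c_def b_def R_def by auto
    have b: "0 \<le> b" "b \<le> L" using R[OF cR(1)] longest_axis_row[OF L(1) cR] by auto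
    define W where "W = aff_map 1 (- c) 0 1 0 0"
    have W: "int_unimodular W" unfolding W_def by (rule int_unimodular_aff_map) simp
    have "trapezoidal L b (W ` D)"
      unfolding trapezoidal_def
    proof (intro conjI allI impI)
      have "(0, 0) \<in> W ` D" using D0(1) by (rule rev_image_eqI) (simp add: W_def)
      moreover have "(L, 0) \<in> W ` D" using D0(2) by (rule rev_image_eqI) (simp add: W_def)
      moreover have "(0, 1) \<in> W ` D" using cR(1) by (rule rev_image_eqI) (simp add: W_def)
      moreover have "(b, 1) \<in> W ` D" using cR(2) by (rule rev_image_eqI) (simp add: W_def)
      ultimately show "{(0, 0), (L, 0), (0, 1), (b, 1)} \<subseteq> W ` D" by simp
    next
      fix x y assume "(x, y) \<in> W ` D"
      then obtain x' where x': "(x', y) \<in> D" "x = x' - c * y" unfolding W_def by auto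
      have "y = 0 \<or> y = 1" by (rule y1[OF x'(1)])
      then show "0 \<le> x" "y = 0 \<and> x \<le> L \<or> y = 1 \<and> x \<le> b"
        using row0[of x'] R[of x'] x' by auto
    qed
    from equiv_to_image[OF W equiv_toI[of "trapezoidal L b", OF this]] show ?thesis using b by blast
  qed
qed

text \<open>A point of \<open>D\<close> off the axis at least height \<open>k\<close> works: if
  \<open>k\<close> were greater than 1, the triangle over the unit segment would contain a lattice
  point of height 1.\<close>

lemma unimodular_triangle:
  assumes h: "hollow D" and w: "(w1, w2) \<in> D" "w2 \<noteq> 0" and D0: "(0, 0) \<in> D" "(1, 0) \<in> D"
  obtains W where "int_unimodular W" "(0, 0) \<in> W ` D" "(1, 0) \<in> W ` D" "(0, 1) \<in> W ` D"
proof -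
  define P where "P = (\<lambda>k::nat. 0 < k \<and> (\<exists>x y. (x, y) \<in> D \<and> nat \<bar>y\<bar> = k))"
  define k where "k = (LEAST k. P k)"
  have "P (nat \<bar>w2\<bar>)" unfolding P_def using w by auto
  then have "P k" unfolding k_def by (rule LeastI)
  then obtain x y where xy: "(x, y) \<in> D" "nat \<bar>y\<bar> = k" "0 < k" unfolding P_def by blast
  have kmin: "int k \<le> \<bar>b\<bar>" if "(a, b) \<in> D" "b \<noteq> 0" for a b
  proof -
    have "P (nat \<bar>b\<bar>)" unfolding P_def using that by auto
    then have "k \<le> nat \<bar>b\<bar>" unfolding k_def by (rule Least_le)
    then show ?thesis by linarith
  qed
  define \<sigma> where "\<sigma> = sgn y"
  have \<sigma>: "\<sigma> = 1 \<or> \<sigma> = -1" "\<sigma> * y = int k" using xy(2,3) unfolding \<sigma>_def by (auto simp: sgn_if)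
  define j where "j = x div int k"
  have j: "0 \<le> x - j * int k" "x - j * int k < int k"
    using xy(3) unfolding j_def by (simp_all add: minus_div_mult_eq_mod)
  define W where "W = aff_map 1 (- j * \<sigma>) 0 \<sigma> 0 0"
  have W: "int_unimodular W" unfolding W_def using \<sigma>(1) by (intro int_unimodular_aff_map) auto
  have hW: "hollow (W ` D)" by (rule hollow_image[OF W h])
  have c0: "(0, 0) \<in> W ` D" using D0(1) by (rule rev_image_eqI) (simp add: W_def)
  have c1: "(1, 0) \<in> W ` D" using D0(2) by (rule rev_image_eqI) (simp add: W_def)
  define x' where "x' = x - j * int k"
  have c2: "(x', int k) \<in> W ` D"
    using xy(1) by (rule rev_image_eqI) (use \<sigma>(2) in \<open>simp add: W_def x'_def algebra_simps\<close>)
  have small: "int k \<le> \<bar>b\<bar>" if ab: "(a, b) \<in> W ` D" "b \<noteq> 0" for a b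
  proof -
    obtain a' b' where "(a', b') \<in> D" "b = \<sigma> * b'" using ab(1) unfolding W_def by auto
    then show ?thesis using kmin[of a' b'] ab(2) \<sigma>(1) by auto
  qed
  \<comment> \<open>After the shear \<open>x'\<close> is a residue modulo \<open>k\<close>. The
    triangle with apex \<open>(x', int k)\<close> contains \<open>(0, 1)\<close> if the residue is
    0, and \<open>(1, 1)\<close> otherwise.\<close>
  have "int k = 1"
  proof (cases "x' = 0")
    case True
    have "(0, 1) \<in> W ` D"
      by (rule hollow_convex_comb[OF hW c0 c0 c2, of "int k - 1" 0 1]) (use xy(3) True in \<open>auto simp: algebra_simps\<close>)
    then show ?thesis using small[of 0 1] xy(3) by simp
  next
    case False
    have "(1, 1) \<in> W ` D"
      by (rule hollow_convex_comb[OF hW c0 c1 c2, of "x' - 1" "int k - x'" 1])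
         (use xy(3) False j in \<open>auto simp: algebra_simps x'_def\<close>)
    then show ?thesis using small[of 1 1] xy(3) by simp
  qed
  moreover from this have "x' = 0" using j unfolding x'_def by simp
  ultimately show thesis using that[OF W c0 c1] c2 by simp
qed

text \<open>Two points of \<open>D\<close> congruent modulo 2 would span a segment of length at
  least 2. So \<open>D\<close> has at most one point in each of the four parity classes; three are
  taken by the unimodular triangle, and a fourth point has both coordinates odd.\<close>

lemma hollow_short:
  assumes h: "hollow D" and L: "longest_axis D 1" and "(0, 1) \<in> D"
  shows "fits D 1 \<or> equiv_to (trapezoidal 1 1) D"
proof (cases "D = {(0, 0), (1, 0), (0, 1)}")
  case True
  then have "fits D 1" by (intro fits_simplexI[of D 0 0 1]) auto
  then show ?thesis ..
next
  case False
  have c: "(0, 0) \<in> D" "(1, 0) \<in> D" "(0, 1) \<in> D" using L assms(3) unfolding longest_axis_def by auto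
  have parity: "odd (x - x') \<or> odd (y - y')" if D: "(x, y) \<in> D" "(x', y') \<in> D" "(x, y) \<noteq> (x', y')" for x y x' y'
  proof (rule ccontr)
    assume "\<not> ?thesis"
    then have "2 dvd gcd (x - x') (y - y')" by simp
    moreover have "gcd (x - x') (y - y') \<noteq> 0" using D(3) by auto
    ultimately have g: "2 \<le> gcd (x - x') (y - y')"
      using gcd_ge_0_int[of "x - x'" "y - y'"] by (intro zdvd_imp_le) (simp_all only: less_le, simp)
    obtain U where U: "int_unimodular U" "U (x', y') = (0, 0)" "U (x, y) = (gcd (x - x') (y - y'), 0)"
      using segment_frame[of "(x', y')" "(x, y)"] D(3) by auto
    have "gcd (x - x') (y - y') \<le> 1"
      by (rule longest_axisD[OF L U(1)]) (use U(2,3) D(1,2) in \<open>metis image_eqI\<close>)+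
    then show False using g by simp
  qed
  have "{(0, 0), (1, 0), (0, 1)} \<subseteq> D" using c by simp
  then obtain z where z: "z \<in> D" "z \<notin> {(0, 0), (1, 0), (0, 1)}" using False by blast
  obtain u v where "z = (u, v)" by fastforce
  then have uv: "(u, v) \<in> D" "(u, v) \<noteq> (0, 0)" "(u, v) \<noteq> (1, 0)" "(u, v) \<noteq> (0, 1)" using z by auto
  have odd: "odd u \<and> odd v" using parity[OF uv(1) c(1) uv(2)] parity[OF uv(1) c(2) uv(3)] parity[OF uv(1) c(3) uv(4)]
    by auto
  have same: "(x, y) = (u, v)" if "(x, y) \<in> D" "odd x" "odd y" for x y
    using parity[OF that(1) uv(1)] that odd by auto
  have four: "(x, y) = (0, 0) \<or> (x, y) = (1, 0) \<or> (x, y) = (0, 1) \<or> (x, y) = (u, v)" if "(x, y) \<in> D" for x y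
    using parity[OF that c(1)] parity[OF that c(2)] parity[OF that c(3)] same[OF that] by auto
  have tri: False if "(u1, u2) \<in> D" "(w1, w2) \<in> D" "(z1, z2) \<in> D"
    "0 < s" "0 < t" "0 < r"
    "(s + t + r) * q1 = s * u1 + t * w1 + r * z1" "(s + t + r) * q2 = s * u2 + t * w2 + r * z2"
    "(w1 - u1) * (z2 - u2) \<noteq> (w2 - u2) * (z1 - u1)" for u1 u2 w1 w2 z1 z2 s t r q1 q2
    using hollow_triangle[OF h that(1-8)] that(9) by simp
  have "(u, v) = (1, 1) \<or> (u, v) = (-1, 1) \<or> (u, v) = (1, -1)"
  proof -
    have nz: "u \<noteq> 0" "v \<noteq> 0" "u + v \<noteq> 1" using odd by (auto, presburger+)
    \<comment> \<open>In three regions the hull contains the odd point of the same region that is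
      nearest to the triangle, which by uniqueness is \<open>(u, v)\<close>. In the other three,
      \<open>(u, v)\<close> and two corners of the triangle enclose the third corner, contradicting
      hollowness.\<close>
    consider "0 < u" "0 < v" | "u < 0" "0 < v" "u + v \<le> 0" | "u < 0" "0 < v" "1 < u + v"
      | "0 < u" "v < 0" "u + v \<le> 0" | "0 < u" "v < 0" "1 < u + v" | "u < 0" "v < 0"
      using nz by linarith
    then show ?thesis
    proof cases
      case 1
      have "(1, 1) \<in> D"
        by (rule hollow_convex_comb[OF h c(2) c(3) uv(1), of "v - 1" "u - 1" 1])
           (use 1 in \<open>auto simp: algebra_simps\<close>)
      then show ?thesis using same[of 1 1] by simp
    next
      case 2
      have "(-1, 1) \<in> D"
        by (rule hollow_convex_comb[OF h c(1) c(3) uv(1), of "v - 1" "- u - v" 1])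
           (use 2 in \<open>auto simp: algebra_simps\<close>)
      then show ?thesis using same[of "-1" 1] by simp
    next
      case 3
      have False
        by (rule tri[OF c(1) c(2) uv(1), of "u + v - 1" "- u" 1 0 1]) (use 3 in \<open>auto simp: algebra_simps\<close>)
      then show ?thesis ..
    next
      case 4
      have "(1, -1) \<in> D"
        by (rule hollow_convex_comb[OF h c(1) c(2) uv(1), of "u - 1" "- u - v" 1])
           (use 4 in \<open>auto simp: algebra_simps\<close>)
      then show ?thesis using same[of 1 "-1"] by simp
    next
      case 5
      have False
        by (rule tri[OF c(1) c(3) uv(1), of "u + v - 1" "- v" 1 1 0]) (use 5 in \<open>auto simp: algebra_simps\<close>)
      then show ?thesis ..
    next
      case 6
      have False
        by (rule tri[OF c(2) c(3) uv(1), of "- u" "- v" 1 0 0]) (use 6 in \<open>auto simp: algebra_simps\<close>)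
      then show ?thesis ..
    qed
  qed
  moreover have D: "D = {(0, 0), (1, 0), (0, 1), (u, v)}" using four c uv(1) by auto
  ultimately consider "D = {(0, 0), (1, 0), (0, 1), (1, 1)}" | "D = {(0, 0), (1, 0), (0, 1), (-1, 1)}"
    | "D = {(0, 0), (1, 0), (0, 1), (1, -1)}" by auto
  then have "equiv_to (trapezoidal 1 1) D"
  proof cases
    case 1
    then show ?thesis by (intro equiv_toI) (auto simp: trapezoidal_def)
  next
    case 2
    have "int_unimodular (aff_map 1 1 0 1 0 0)" by (rule int_unimodular_aff_map) simp
    then show ?thesis by (rule equiv_to_image) (rule equiv_toI, auto simp: trapezoidal_def 2)
  next
    case 3
    have "int_unimodular (aff_map 1 0 1 1 0 0)" by (rule int_unimodular_aff_map) simp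
    then show ?thesis by (rule equiv_to_image) (rule equiv_toI, auto simp: trapezoidal_def 3)
  qed
  then show ?thesis ..
qed

theorem hollow_classification:
  assumes h: "hollow D" and fin: "finite D" and pl: "planar D"
  shows "fits D 1 \<or> (\<exists>a b. (a = 1 \<and> b = 1 \<or> 2 \<le> a \<and> b \<le> a \<and> 0 \<le> b) \<and> equiv_to (trapezoidal a b) D)
    \<or> equiv_to double_simplex D"
proof -
  obtain W L where W: "int_unimodular W" "1 \<le> L" "longest_axis (W ` D) L" using exists_longest_axis[OF fin pl] .
  have hW: "hollow (W ` D)" by (rule hollow_image[OF W(1) h])
  have D0: "(0, 0) \<in> W ` D" "(L, 0) \<in> W ` D" using W(3) unfolding longest_axis_def by auto
  obtain w1 w2 where w: "(w1, w2) \<in> W ` D" "w2 \<noteq> 0"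
    using pl W(1) unfolding planar_def by (metis image_eqI prod.collapse)
  show ?thesis
  proof (cases "L = 1")
    case True
    obtain V where V: "int_unimodular V" "(0, 0) \<in> V ` W ` D" "(1, 0) \<in> V ` W ` D" "(0, 1) \<in> V ` W ` D"
      using unimodular_triangle[OF hW w] D0 True by blast
    have "longest_axis (V ` W ` D) 1" using longest_axis_image[OF W(3) V(1,2)] V(3) True by simp
    from hollow_short[OF hollow_image[OF V(1) hW] this V(4)] show ?thesis
    proof
      assume "fits (V ` W ` D) 1"
      then show ?thesis using fits_image_iff[OF V(1)] fits_image_iff[OF W(1)] by simp
    next
      assume "equiv_to (trapezoidal 1 1) (V ` W ` D)"
      then have "equiv_to (trapezoidal 1 1) D" using equiv_to_image[OF V(1)] equiv_to_image[OF W(1)] by blast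
      then show ?thesis by blast
    qed
  next
    case False
    then have L2: "2 \<le> L" using W(2) by simp
    define V where "V = (aff_map 1 0 0 (sgn w2) 0 0 :: int \<times> int \<Rightarrow> _)"
    have V: "int_unimodular V" unfolding V_def using w(2) by (intro int_unimodular_aff_map) (auto simp: sgn_if)
    have V0: "(0, 0) \<in> V ` W ` D" using D0(1) by (rule rev_image_eqI) (simp add: V_def)
    have VL: "(L, 0) \<in> V ` W ` D" using D0(2) by (rule rev_image_eqI) (simp add: V_def)
    have Vw: "(w1, \<bar>w2\<bar>) \<in> V ` W ` D" using w(1) by (rule rev_image_eqI) (simp add: V_def abs_sgn mult.commute)
    have "finite (V ` W ` D)" using fin by simp
    moreover have "0 < \<bar>w2\<bar>" using w(2) by simp
    ultimately have "(\<exists>b. 0 \<le> b \<and> b \<le> L \<and> equiv_to (trapezoidal L b) (V ` W ` D)) \<or> equiv_to double_simplex (V ` W ` D)"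
      by (intro hollow_long[OF hollow_image[OF V hW] _ longest_axis_image[OF W(3) V V0 VL] L2 Vw])
    then show ?thesis using equiv_to_image[OF V] equiv_to_image[OF W(1)] L2 by meson
  qed
qed

subsection \<open>Values in the exceptional cases\<close>

lemma emb_functional_le_iff: "(of_int p, of_int q) \<bullet> emb (x, y) \<le> real_of_int r \<longleftrightarrow> p * x + q * y \<le> r"
proof -
  have "(of_int p, of_int q) \<bullet> emb (x, y) = real_of_int (p * x + q * y)" by (simp add: emb_apply)
  then show ?thesis by (simp only: of_int_le_iff)
qed

lemma emb_functional_less_iff: "(of_int p, of_int q) \<bullet> emb (x, y) < real_of_int r \<longleftrightarrow> p * x + q * y < r"
proof -
  have "(of_int p, of_int q) \<bullet> emb (x, y) = real_of_int (p * x + q * y)" by (simp add: emb_apply)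
  then show ?thesis by (simp only: of_int_less_iff)
qed

lemma convex_hull_emb_le:
  assumes "\<And>x y. (x, y) \<in> Z \<Longrightarrow> p * x + q * y \<le> (r::int)"
  shows "convex hull (emb ` Z) \<subseteq> {v. (of_int p, of_int q) \<bullet> v \<le> of_int r}"
proof (rule hull_minimal)
  show "emb ` Z \<subseteq> {v. (of_int p, of_int q) \<bullet> v \<le> of_int r}"
  proof
    fix v assume "v \<in> emb ` Z"
    then obtain x y where "(x, y) \<in> Z" "v = emb (x, y)" by auto
    then show "v \<in> {v. (of_int p, of_int q) \<bullet> v \<le> of_int r}"
      using assms by (simp add: emb_functional_le_iff)
  qed
qed (rule convex_halfspace_le)

lemma lattice_of_hull_le:
  assumes "\<And>x y. (x, y) \<in> Z \<Longrightarrow> p * x + q * y \<le> (r::int)" "(x, y) \<in> lattice_of (convex hull (emb ` Z))"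
  shows "p * x + q * y \<le> r"
  using convex_hull_emb_le[of Z p q r, OF assms(1)] assms(2) unfolding lattice_of_def
  by (auto simp: emb_functional_le_iff)

text \<open>The interior of a closed half-plane is the open one. Over the integers strictness gains
  a full unit at each side.\<close>

lemma lattice_of_interior_hull_less:
  assumes "\<And>x y. (x, y) \<in> Z \<Longrightarrow> p * x + q * y \<le> (r::int)" "p \<noteq> 0 \<or> q \<noteq> 0"
    "(x, y) \<in> lattice_of (interior (convex hull (emb ` Z)))"
  shows "p * x + q * y < r"
proof -
  have "(of_int p, of_int q) \<noteq> (0 :: real \<times> real)" using assms(2) by (auto simp: zero_prod_def)
  then have "interior (convex hull (emb ` Z)) \<subseteq> {v. (of_int p, of_int q) \<bullet> v < of_int r}"
    using interior_mono[OF convex_hull_emb_le[of Z p q r, OF assms(1)]] by simp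
  then show ?thesis using assms(3) unfolding lattice_of_def by (auto simp: emb_functional_less_iff)
qed

lemma mem_lattice_of_hull: "z \<in> Z \<Longrightarrow> z \<in> lattice_of (convex hull (emb ` Z))"
  unfolding lattice_of_def by (simp add: hull_inc)

lemma convex_hull_emb_eqI:
  assumes "V \<subseteq> Z" "Z \<subseteq> lattice_of (convex hull (emb ` V))"
  shows "convex hull (emb ` Z) = convex hull (emb ` V)"
proof
  show "convex hull (emb ` Z) \<subseteq> convex hull (emb ` V)"
    using assms(2) by (intro hull_minimal convex_convex_hull) (auto simp: lattice_of_def)
  show "convex hull (emb ` V) \<subseteq> convex hull (emb ` Z)" using assms(1) by (intro hull_mono image_mono)
qed

lemma unimodular_equivD:
  assumes "P \<simeq> K"
  shows "\<exists>U. int_unimodular U \<and> lattice_of K = U ` lattice_of P \<and> lattice_of (interior K) = U ` lattice_of (interior P)"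
proof -
  obtain \<phi> where "unimodular \<phi>" and K: "K = \<phi> ` P" using assms unfolding unimodular_equiv_def by blast
  then obtain U where U: "realizes \<phi> U" unfolding unimodular_iff_realizes by blast
  show ?thesis unfolding K realizes_interior[OF U] realizes_lattice_of[OF U] using realizes_int_unimodular[OF U] by blast
qed

lemma change_frame:
  assumes P: "P = convex hull (emb ` lattice_of P)" and U: "int_unimodular U"
  shows "P \<simeq> convex hull (emb ` U ` lattice_of P)"
    and "lattice_of (convex hull (emb ` U ` lattice_of P)) = U ` lattice_of P"
    and "lattice_of (interior (convex hull (emb ` U ` lattice_of P))) = U ` lattice_of (interior P)"
proof -
  obtain \<phi> where \<phi>: "realizes \<phi> U" using realizes_exists[OF U] by blast
  have "\<phi> ` P = \<phi> ` (convex hull (emb ` lattice_of P))" using P by simp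
  then have K: "convex hull (emb ` U ` lattice_of P) = \<phi> ` P"
    using realizes_convex_hull[OF \<phi>] realizes_image_emb[OF \<phi>] by simp
  have "unimodular \<phi>" using \<phi> unfolding unimodular_iff_realizes by blast
  then show "P \<simeq> convex hull (emb ` U ` lattice_of P)" unfolding K unimodular_equiv_def by blast
  show "lattice_of (convex hull (emb ` U ` lattice_of P)) = U ` lattice_of P"
    unfolding K by (rule realizes_lattice_of[OF \<phi>])
  show "lattice_of (interior (convex hull (emb ` U ` lattice_of P))) = U ` lattice_of (interior P)"
    unfolding K realizes_interior[OF \<phi>] by (rule realizes_lattice_of[OF \<phi>])
qed

text \<open>The interior of a convex set is convex, so taking the hull of its lattice points adds no
  new ones.\<close>

lemma lattice_of_interior_polygon:
  assumes "convex P"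
  shows "lattice_of (interior_polygon P) = lattice_of (interior P)"
proof
  have "interior_polygon P \<subseteq> interior P" unfolding interior_polygon_eq
    using assms by (intro hull_minimal) (auto simp: lattice_of_def)
  then show "lattice_of (interior_polygon P) \<subseteq> lattice_of (interior P)" unfolding lattice_of_def by auto
  show "lattice_of (interior P) \<subseteq> lattice_of (interior_polygon P)"
    unfolding interior_polygon_eq using mem_lattice_of_hull by blast
qed

lemma vertex_hull_eq:
  "convex hull {(0, 0), (of_int a, 0), (0, 1), (of_int b, 1)} = convex hull (emb ` {(0, 0), (a, 0), (0, 1), (b, 1)})"
  "convex hull {(0, 0), (2, 0), (0, 2)} = convex hull (emb ` {(0, 0), (2, 0), (0, 2)})"
  "convex hull {(0, 0), (4, 0), (0, 2)} = convex hull (emb ` {(0, 0), (4, 0), (0, 2)})"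
  by (simp_all add: emb_apply)

lemma lattice_size_interior_polygon_empty:
  assumes "lattice_of (interior P) = {}"
  shows "lattice_size (interior_polygon P) = -2"
  unfolding interior_polygon_eq assms by (simp add: lattice_size_empty)

lemma transported_lattice_size:
  assumes P: "P = convex hull (emb ` lattice_of P)" "finite (lattice_of P)" and U: "int_unimodular U"
    and n: "fits (U ` lattice_of P) n" "\<And>e. fits (U ` lattice_of P) e \<Longrightarrow> n \<le> e" and ne: "lattice_of P \<noteq> {}"
  shows "lattice_size P = n"
proof -
  have "lattice_size (convex hull (emb ` lattice_of P)) = n"
    by (rule lattice_size_eqI[OF P(2)]) (use n ne fits_image_iff[OF U] in blast)+
  then show ?thesis using P(1) by simp
qed

text \<open>If \<open>a = b\<close>, the lower bound comes from the box with sides \<open>a\<close>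
  and 1; otherwise row 0 of length \<open>a\<close> already gives it.\<close>

lemma trapezoid_values:
  assumes P: "P = convex hull (emb ` lattice_of P)" "finite (lattice_of P)" and t: "is_trapezoid P a b"
  shows "lattice_size (interior_polygon P) = -2 \<and> (a = b \<longrightarrow> lattice_size P = a + 1) \<and> (a > b \<longrightarrow> lattice_size P = a)"
proof -
  have ab: "(a = 1 \<and> b = 1) \<or> (a \<ge> 2 \<and> a \<ge> b \<and> b \<ge> 0)" and eq: "P \<simeq> convex hull (emb ` {(0, 0), (a, 0), (0, 1), (b, 1)})"
    using t unfolding is_trapezoid_def vertex_hull_eq by auto
  define Z :: "(int \<times> int) set" where "Z = {(0, 0), (a, 0), (0, 1), (b, 1)}"
  define K where "K = convex hull (emb ` Z)"
  obtain U where U: "int_unimodular U" "lattice_of K = U ` lattice_of P" "lattice_of (interior K) = U ` lattice_of (interior P)"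
    using unimodular_equivD[OF eq] unfolding K_def Z_def by blast
  have "lattice_of (interior K) = {}"
  proof -
    have "False" if xy: "(x, y) \<in> lattice_of (interior K)" for x y
    proof -
      have "0 * x + 1 * y < 1" using xy unfolding K_def
        by (rule lattice_of_interior_hull_less[rotated 2]) (auto simp: Z_def)
      moreover have "0 * x + (-1) * y < 0" using xy unfolding K_def
        by (rule lattice_of_interior_hull_less[rotated 2]) (auto simp: Z_def)
      ultimately show False by simp
    qed
    then show ?thesis by auto
  qed
  then have "lattice_of (interior P) = {}" using U(3) by simp
  then have 1: "lattice_size (interior_polygon P) = -2" by (rule lattice_size_interior_polygon_empty)
  have mem: "z \<in> lattice_of K" if "z \<in> Z" for z using that unfolding K_def by (rule mem_lattice_of_hull)
  then have ne: "lattice_of P \<noteq> {}" using U(2) unfolding Z_def by auto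
  have pos: "0 \<le> x \<and> 0 \<le> y" if xy: "(x, y) \<in> lattice_of K" for x y
  proof -
    have "(-1) * x + 0 * y \<le> 0" using xy unfolding K_def
      by (rule lattice_of_hull_le[rotated]) (use ab in \<open>auto simp: Z_def\<close>)
    moreover have "0 * x + (-1) * y \<le> 0" using xy unfolding K_def
      by (rule lattice_of_hull_le[rotated]) (use ab in \<open>auto simp: Z_def\<close>)
    ultimately show ?thesis by simp
  qed
  have 2: "lattice_size P = a + 1" if "a = b"
  proof (rule transported_lattice_size[OF P U(1) _ _ ne])
    have "1 * x + 1 * y \<le> a + 1" if xy: "(x, y) \<in> lattice_of K" for x y
      using xy unfolding K_def by (rule lattice_of_hull_le[rotated]) (use \<open>a = b\<close> ab in \<open>auto simp: Z_def\<close>)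
    then have "fits (lattice_of K) (a + 1)" using pos by (intro fits_simplexI[of _ 0 0 "a + 1"]) auto
    then show "fits (U ` lattice_of P) (a + 1)" using U(2) by simp
    show "a + 1 \<le> e" if "fits (U ` lattice_of P) e" for e
    proof (rule fits_box_le[of "lattice_of K" e a 1 0 0])
      show "(0 + p, 0 + q) \<in> lattice_of K" if "p \<in> {0, a}" "q \<in> {0, 1}" for p q
        using that \<open>a = b\<close> by (intro mem) (auto simp: Z_def)
    qed (use that U(2) ab in auto)
  qed
  have 3: "lattice_size P = a" if "a > b"
  proof (rule transported_lattice_size[OF P U(1) _ _ ne])
    have "1 * x + 1 * y \<le> a" if xy: "(x, y) \<in> lattice_of K" for x y
      using xy unfolding K_def by (rule lattice_of_hull_le[rotated]) (use \<open>a > b\<close> ab in \<open>auto simp: Z_def\<close>)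
    then have "fits (lattice_of K) a" using pos by (intro fits_simplexI[of _ 0 0 a]) auto
    then show "fits (U ` lattice_of P) a" using U(2) by simp
    show "a \<le> e" if "fits (U ` lattice_of P) e" for e
      using fits_segment_le[of "lattice_of K" e 0 0 a] that U(2) mem ab unfolding Z_def by auto
  qed
  show ?thesis using 1 2 3 by blast
qed

lemma double_simplex_values:
  assumes P: "P = convex hull (emb ` lattice_of P)" "finite (lattice_of P)"
    and eq: "P \<simeq> convex hull {(0, 0), (2, 0), (0, 2)}"
  shows "lattice_size (interior_polygon P) = -2 \<and> lattice_size P = 2"
proof -
  define Z :: "(int \<times> int) set" where "Z = {(0, 0), (2, 0), (0, 2)}"
  define K where "K = convex hull (emb ` Z)"
  obtain U where U: "int_unimodular U" "lattice_of K = U ` lattice_of P" "lattice_of (interior K) = U ` lattice_of (interior P)"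
    using unimodular_equivD[OF eq[unfolded vertex_hull_eq]] unfolding K_def Z_def by blast
  have "lattice_of (interior K) = {}"
  proof -
    have "False" if xy: "(x, y) \<in> lattice_of (interior K)" for x y
    proof -
      have "(-1) * x + 0 * y < 0" using xy unfolding K_def
        by (rule lattice_of_interior_hull_less[rotated 2]) (auto simp: Z_def)
      moreover have "0 * x + (-1) * y < 0" using xy unfolding K_def
        by (rule lattice_of_interior_hull_less[rotated 2]) (auto simp: Z_def)
      moreover have "1 * x + 1 * y < 2" using xy unfolding K_def
        by (rule lattice_of_interior_hull_less[rotated 2]) (auto simp: Z_def)
      ultimately show False by simp
    qed
    then show ?thesis by auto
  qed
  then have "lattice_of (interior P) = {}" using U(3) by simp
  then have 1: "lattice_size (interior_polygon P) = -2" by (rule lattice_size_interior_polygon_empty)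
  have mem: "z \<in> lattice_of K" if "z \<in> Z" for z using that unfolding K_def by (rule mem_lattice_of_hull)
  then have ne: "lattice_of P \<noteq> {}" using U(2) unfolding Z_def by auto
  have bnd: "0 \<le> x \<and> 0 \<le> y \<and> x + y \<le> 2" if xy: "(x, y) \<in> lattice_of K" for x y
  proof -
    have "(-1) * x + 0 * y \<le> 0" using xy unfolding K_def
      by (rule lattice_of_hull_le[rotated]) (auto simp: Z_def)
    moreover have "0 * x + (-1) * y \<le> 0" using xy unfolding K_def
      by (rule lattice_of_hull_le[rotated]) (auto simp: Z_def)
    moreover have "1 * x + 1 * y \<le> 2" using xy unfolding K_def
      by (rule lattice_of_hull_le[rotated]) (auto simp: Z_def)
    ultimately show ?thesis by simp
  qed
  have "lattice_size P = 2"
  proof (rule transported_lattice_size[OF P U(1) _ _ ne])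
    have "fits (lattice_of K) 2" using bnd by (intro fits_simplexI[of _ 0 0 2]) auto
    then show "fits (U ` lattice_of P) 2" using U(2) by simp
    show "2 \<le> e" if "fits (U ` lattice_of P) e" for e
      using fits_segment_le[of "lattice_of K" e 0 0 2] that U(2) mem unfolding Z_def by auto
  qed
  then show ?thesis using 1 by blast
qed

lemma transported_interior_size:
  assumes P: "finite (lattice_of P)" and U: "int_unimodular U"
    and n: "fits (U ` lattice_of (interior P)) n" "\<And>e. fits (U ` lattice_of (interior P)) e \<Longrightarrow> n \<le> e"
    and ne: "lattice_of (interior P) \<noteq> {}"
  shows "lattice_size (interior_polygon P) = n"
  unfolding interior_polygon_eq
proof (rule lattice_size_eqI)
  show "finite (lattice_of (interior P))"
    using P by (rule rev_finite_subset) (use interior_subset in \<open>auto simp: lattice_of_def\<close>)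
qed (use n ne fits_image_iff[OF U] in blast)+

lemma flat_triangle_values:
  assumes P: "P = convex hull (emb ` lattice_of P)" "finite (lattice_of P)"
    and eq: "P \<simeq> convex hull {(0, 0), (4, 0), (0, 2)}"
  shows "lattice_size (interior_polygon P) = 0 \<and> lattice_size P = 4"
proof -
  define Z :: "(int \<times> int) set" where "Z = {(0, 0), (4, 0), (0, 2)}"
  define K where "K = convex hull (emb ` Z)"
  obtain U where U: "int_unimodular U" "lattice_of K = U ` lattice_of P" "lattice_of (interior K) = U ` lattice_of (interior P)"
    using unimodular_equivD[OF eq[unfolded vertex_hull_eq]] unfolding K_def Z_def by blast
  have conv: "convex K" unfolding K_def by (rule convex_convex_hull)
  have mem: "z \<in> lattice_of K" if "z \<in> Z" for z using that unfolding K_def by (rule mem_lattice_of_hull)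
  then have v: "(0, 0) \<in> lattice_of K" "(4, 0) \<in> lattice_of K" "(0, 2) \<in> lattice_of K" unfolding Z_def by auto
  then have ne: "lattice_of P \<noteq> {}" using U(2) by auto
  have sub: "x = 1 \<and> y = 1" if xy: "(x, y) \<in> lattice_of (interior K)" for x y
  proof -
    have "(-1) * x + 0 * y < 0" using xy unfolding K_def
      by (rule lattice_of_interior_hull_less[rotated 2]) (auto simp: Z_def)
    moreover have "0 * x + (-1) * y < 0" using xy unfolding K_def
      by (rule lattice_of_interior_hull_less[rotated 2]) (auto simp: Z_def)
    moreover have "1 * x + 2 * y < 4" using xy unfolding K_def
      by (rule lattice_of_interior_hull_less[rotated 2]) (auto simp: Z_def)
    ultimately show ?thesis by auto
  qed
  \<comment> \<open>Relative to \<open>(1, 1)\<close> the corners have sum zero with weights 1, 1,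
    2, so a supporting functional there would vanish at all three and be zero.\<close>
  have "(1, 1) \<in> lattice_of (interior K)"
  proof (rule ccontr)
    assume "(1, 1) \<notin> lattice_of (interior K)"
    moreover have "(1, 1) \<in> lattice_of K"
      by (rule lattice_of_convex_comb[OF conv v, of 1 1 2]) auto
    ultimately obtain a b :: real where ab: "a \<noteq> 0 \<or> b \<noteq> 0"
      and s: "\<And>x y. (x, y) \<in> lattice_of K \<Longrightarrow> 0 \<le> a * of_int (x - 1) + b * of_int (y - 1)"
      using lattice_supporting_functional[OF conv, of 1 1] by blast
    show False using s[OF v(1)] s[OF v(2)] s[OF v(3)] ab by auto
  qed
  then have I: "U ` lattice_of (interior P) = {(1, 1)}" using sub U(3) by auto
  have 1: "lattice_size (interior_polygon P) = 0"
  proof (rule transported_interior_size[OF P(2) U(1)])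
    show "fits (U ` lattice_of (interior P)) 0" unfolding I by (rule fits_simplexI[of _ 1 1 2]) auto
    show "0 \<le> e" if "fits (U ` lattice_of (interior P)) e" for e
      using that I by (intro fits_imp_nonneg) auto
    show "lattice_of (interior P) \<noteq> {}" using I by auto
  qed
  have bnd: "0 \<le> x \<and> 0 \<le> y \<and> x + y \<le> 4" if xy: "(x, y) \<in> lattice_of K" for x y
  proof -
    have "(-1) * x + 0 * y \<le> 0" using xy unfolding K_def
      by (rule lattice_of_hull_le[rotated]) (auto simp: Z_def)
    moreover have "0 * x + (-1) * y \<le> 0" using xy unfolding K_def
      by (rule lattice_of_hull_le[rotated]) (auto simp: Z_def)
    moreover have "1 * x + 1 * y \<le> 4" using xy unfolding K_def
      by (rule lattice_of_hull_le[rotated]) (auto simp: Z_def)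
    ultimately show ?thesis by simp
  qed
  have "lattice_size P = 4"
  proof (rule transported_lattice_size[OF P U(1) _ _ ne])
    have "fits (lattice_of K) 4" using bnd by (intro fits_simplexI[of _ 0 0 4]) auto
    then show "fits (U ` lattice_of P) 4" using U(2) by simp
    show "4 \<le> e" if "fits (U ` lattice_of P) e" for e
      using fits_segment_le[of "lattice_of K" e 0 0 4] that U(2) v by auto
  qed
  then show ?thesis using 1 by blast
qed

lemma rectangle_values:
  assumes P: "P = convex hull (emb ` lattice_of P)" "finite (lattice_of P)" and r: "is_rectangle P a b"
  shows "lattice_size (interior_polygon P) = a + b - 4 \<and> lattice_size P = a + b"
proof -
  define K where "K = {0..real_of_int a} \<times> {0..real_of_int b}"
  have ab: "2 \<le> a" "2 \<le> b" and eq: "P \<simeq> K" using r unfolding is_rectangle_def K_def by auto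
  obtain U where U: "int_unimodular U" "lattice_of K = U ` lattice_of P" "lattice_of (interior K) = U ` lattice_of (interior P)"
    using unimodular_equivD[OF eq] by blast
  have K: "lattice_of K = {0..a} \<times> {0..b}" unfolding lattice_of_def K_def by (auto simp: emb_def)
  have I: "lattice_of (interior K) = {1..a - 1} \<times> {1..b - 1}"
    unfolding lattice_of_def K_def interior_Times by (auto simp: emb_def)
  have "lattice_size P = a + b"
  proof (rule transported_lattice_size[OF P U(1)])
    show "fits (U ` lattice_of P) (a + b)" unfolding U(2)[symmetric] K
      by (rule fits_simplexI[of _ 0 0 "a + b"]) auto
    show "a + b \<le> e" if "fits (U ` lattice_of P) e" for e
      using that unfolding U(2)[symmetric] K
      by (rule fits_box_le[where x = 0 and y = 0]) (use ab in auto)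
    show "lattice_of P \<noteq> {}" using U(2) K ab by auto
  qed
  moreover have "lattice_size (interior_polygon P) = a + b - 4"
  proof (rule transported_interior_size[OF P(2) U(1)])
    show "fits (U ` lattice_of (interior P)) (a + b - 4)" unfolding U(3)[symmetric] I
      by (rule fits_simplexI[of _ 1 1 "a + b - 2"]) auto
    show "a + b - 4 \<le> e" if "fits (U ` lattice_of (interior P)) e" for e
    proof -
      have "(a - 2) + (b - 2) \<le> e" using that unfolding U(3)[symmetric] I
        by (rule fits_box_le[where x = 1 and y = 1]) (use ab in auto)
      then show ?thesis by simp
    qed
    show "lattice_of (interior P) \<noteq> {}" using U(3) I ab by auto
  qed
  ultimately show ?thesis by blast
qed

subsection \<open>Edges\<close>

lemma int_line_eq: "int_line p q r = {v. (of_int p, of_int q) \<bullet> v = of_int r}"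
  unfolding int_line_def by (auto simp: inner_prod_def)

lemma emb_in_int_line: "emb (x, y) \<in> int_line p q r \<longleftrightarrow> p * x + q * y = r"
proof -
  have "emb (x, y) \<in> int_line p q r \<longleftrightarrow> real_of_int (p * x + q * y) = of_int r"
    unfolding int_line_def by (simp add: emb_apply)
  then show ?thesis by (simp only: of_int_eq_iff)
qed

lemma aff_dim_int_line:
  assumes "p \<noteq> 0 \<or> q \<noteq> 0"
  shows "aff_dim (int_line p q r) = 1"
proof -
  have "(of_int p, of_int q) \<noteq> (0 :: real \<times> real)" using assms by (auto simp: zero_prod_def)
  then show ?thesis unfolding int_line_eq by (simp add: aff_dim_hyperplane)
qed

lemma planar_lattice_of:
  assumes P: "P = convex hull (emb ` lattice_of P)" and dim: "aff_dim P = 2"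
  shows "planar (lattice_of P)"
  unfolding planar_def
proof (intro conjI allI impI)
  show "lattice_of P \<noteq> {}" using P dim by auto
  fix U assume "int_unimodular U"
  then obtain k l m n e f where det: "k * n - l * m = 1 \<or> k * n - l * m = -1" and U: "U = aff_map k l m n e f"
    unfolding int_unimodular_def by blast
  show "\<exists>z\<in>lattice_of P. snd (U z) \<noteq> 0"
  proof (rule ccontr)
    assume c: "\<not> ?thesis"
    have "emb ` lattice_of P \<subseteq> int_line m n (- f)"
    proof
      fix v assume "v \<in> emb ` lattice_of P"
      then obtain x y where "(x, y) \<in> lattice_of P" "v = emb (x, y)" by auto
      then show "v \<in> int_line m n (- f)" using c unfolding U by (force simp: emb_in_int_line)
    qed
    then have "P \<subseteq> int_line m n (- f)"
      using P unfolding int_line_eq by (metis convex_hyperplane subset_hull)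
    then have "aff_dim P \<le> aff_dim (int_line m n (- f))" by (rule aff_dim_subset)
    also have "\<dots> = 1" using det by (intro aff_dim_int_line) auto
    finally show False using dim by simp
  qed
qed

text \<open>The line cuts out a face. Two distinct points on it bound the dimension from below and
  the line bounds it from above, so the face is an edge spanning the whole line.\<close>

lemma edge_on_line:
  assumes pq: "p \<noteq> 0 \<or> q \<noteq> 0" and ge: "\<And>x y. (x, y) \<in> Z \<Longrightarrow> r \<le> p * x + q * y"
    and S: "S = convex hull (emb ` Z)"
    and u: "u \<in> lattice_of S" "emb u \<in> int_line p q r" and w: "w \<in> lattice_of S" "emb w \<in> int_line p q r" "u \<noteq> w"
  shows "(S \<inter> int_line p q r) edge_of S" "affine hull (S \<inter> int_line p q r) = int_line p q r"
proof -
  let ?F = "S \<inter> int_line p q r"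
  have "S \<subseteq> {v. (of_int (- p), of_int (- q)) \<bullet> v \<le> of_int (- r)}"
    unfolding S using ge by (intro convex_hull_emb_le) force
  then have ge': "of_int r \<le> (of_int p, of_int q) \<bullet> v" if "v \<in> S" for v
    using that by (force simp: inner_prod_def)
  have face: "?F face_of S" unfolding int_line_eq
    by (rule face_of_Int_supporting_hyperplane_ge) (use ge' S in auto)
  have "{emb u, emb w} \<subseteq> ?F" using u w unfolding lattice_of_def by auto
  then have "aff_dim {emb u, emb w} \<le> aff_dim ?F" by (rule aff_dim_subset)
  moreover have "emb u \<noteq> emb w" using w(3) inj_emb by (simp add: inj_eq)
  ultimately have "1 \<le> aff_dim ?F" by simp
  moreover have "aff_dim ?F \<le> 1" using aff_dim_subset[of ?F "int_line p q r"] aff_dim_int_line[OF pq] by simp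
  ultimately have dim: "aff_dim ?F = 1" by simp
  then show "?F edge_of S" using face unfolding edge_of_def by simp
  have aff: "affine (int_line p q r)" unfolding int_line_eq by (rule affine_hyperplane)
  show "affine hull ?F = int_line p q r"
  proof (rule affine_dim_equal[OF affine_affine_hull aff])
    show "affine hull ?F \<noteq> {}" using u unfolding lattice_of_def by auto
    show "affine hull ?F \<subseteq> int_line p q r" using aff by (intro hull_minimal) auto
    show "aff_dim (affine hull ?F) = aff_dim (int_line p q r)" using dim aff_dim_int_line[OF pq] by simp
  qed
qed

section \<open>Counting lattice points on edges\<close>

lemma finite_row:
  assumes "finite S"
  shows "finite {x. (x, r) \<in> S}"
proof -
  have "finite ((\<lambda>x. (x, r)) ` {x. (x, r) \<in> S})" using assms by (rule rev_finite_subset) auto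
  then show ?thesis by (rule finite_imageD) (auto simp: inj_on_def)
qed

lemma num_int_points_eq_card_row:
  assumes "int_unimodular U" "\<And>x y. (x, y) \<in> lattice_of S \<Longrightarrow> snd (U (x, y)) = r"
  shows "num_int_points S = int (card {x. (x, r) \<in> U ` lattice_of S})"
proof -
  have "card (S \<inter> int_points) = card (lattice_of S)"
    unfolding Int_int_points using inj_emb by (intro card_image) (auto simp: inj_on_def)
  also have "\<dots> = card (U ` lattice_of S)"
    using int_unimodular_inj[OF assms(1)] by (intro card_image[symmetric]) (auto simp: inj_on_def)
  also have "U ` lattice_of S = (\<lambda>x. (x, r)) ` {x. (x, r) \<in> U ` lattice_of S}"
  proof (intro set_eqI iffI)
    fix z assume z: "z \<in> U ` lattice_of S"
    then have "snd z = r" using assms(2) by force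
    then have "z = (fst z, r)" by (simp add: prod_eq_iff)
    then show "z \<in> (\<lambda>x. (x, r)) ` {x. (x, r) \<in> U ` lattice_of S}" using z by (metis image_eqI mem_Collect_eq)
  qed auto
  also have "card \<dots> = card {x. (x, r) \<in> U ` lattice_of S}" by (intro card_image) (auto simp: inj_on_def)
  finally show ?thesis unfolding num_int_points_def by simp
qed

text \<open>The edges are rows 0 and 1 of the frame, pulled back to the lines
  \<open>m * x + n * y = - f\<close> and \<open>1 - f\<close> with \<open>(m, n)\<close> the second
  matrix row. For \<open>d = 0\<close> row 1 would be a single point, hence the assumption on
  \<open>d\<close>.\<close>

lemma long_edge_pair_of_long_axis:
  assumes P: "P = convex hull (emb ` lattice_of P)" "finite (lattice_of P)" "convex P"
    and la: "long_axis (lattice_of P) (lattice_of (interior P)) d" and d: "1 \<le> d"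
    and min: "\<not> fits (lattice_of (interior P)) (d - 1)"
  shows "\<exists>\<tau> \<tau>'. long_edge_pair P \<tau> \<tau>'"
proof -
  define D where "D = lattice_of P"
  define I where "I = lattice_of (interior P)"
  obtain U L where U: "int_unimodular U" and L: "d + 4 \<le> L" and D0: "(0, 0) \<in> U ` D" "(L, 0) \<in> U ` D" and I1: "(1, 1) \<in> U ` I"
    and Dpos: "\<forall>x y. (x, y) \<in> U ` D \<longrightarrow> 0 \<le> x \<and> 0 \<le> y"
    and Ib: "\<forall>x y. (x, y) \<in> U ` I \<longrightarrow> 1 \<le> x \<and> 1 \<le> y \<and> x + y \<le> d + 2"
    using la unfolding long_axis_def D_def I_def by blast
  have ab: "absorbs (U ` D) (U ` I)"
    unfolding D_def I_def by (rule absorbs_image[OF U absorbs_lattice_of[OF P(3)]])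
  \<comment> \<open>Otherwise row 1 of \<open>I\<close> is only \<open>(1, 1)\<close>, and the row
    bound with \<open>l = 0\<close> makes \<open>I\<close> fit size 0, below the minimal size
    \<open>d\<close>.\<close>
  have I2: "(2, 1) \<in> U ` I"
  proof (rule ccontr)
    assume c: "(2, 1) \<notin> U ` I"
    have "(0, 1) \<notin> U ` I" using Ib by force
    then have "1 \<le> x \<and> x + y \<le> 0 + 2" if "(x, y) \<in> U ` I" for x y
      using row_bound_interior[OF ab D0, of 0 x y] I1 c Ib L d that by simp
    then have "fits (U ` I) 0" using Ib by (intro fits_simplexI[of _ 1 1 2]) force+
    then have "fits I (d - 1)" using fits_image_iff[OF U] fits_mono[of I 0 "d - 1"] d by simp
    then show False using min unfolding I_def by simp
  qed
  obtain k l m n e f where det: "k * n - l * m = 1 \<or> k * n - l * m = -1" and Ueq: "U = aff_map k l m n e f"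
    using U unfolding int_unimodular_def by blast
  have mn: "m \<noteq> 0 \<or> n \<noteq> 0" using det by auto
  have cop: "coprime m n"
  proof (rule coprimeI)
    fix c assume "c dvd m" "c dvd n"
    then have "c dvd k * n - l * m" by simp
    then show "is_unit c" using det by auto
  qed
  have sndU: "snd (U (x, y)) = m * x + n * y + f" for x y unfolding Ueq by simp
  define \<Gamma> where "\<Gamma> = interior_polygon P"
  have \<Gamma>: "\<Gamma> = convex hull (emb ` I)" unfolding \<Gamma>_def interior_polygon_eq I_def ..
  have lat\<Gamma>: "lattice_of \<Gamma> = I" unfolding \<Gamma>_def I_def by (rule lattice_of_interior_polygon[OF P(3)])
  define \<tau> where "\<tau> = P \<inter> int_line m n (- f)"
  define \<tau>' where "\<tau>' = \<Gamma> \<inter> int_line m n (1 - f)"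
  have lat\<tau>: "(x, y) \<in> lattice_of \<tau> \<longleftrightarrow> (x, y) \<in> D \<and> snd (U (x, y)) = 0" for x y
  proof -
    have "(x, y) \<in> lattice_of \<tau> \<longleftrightarrow> (x, y) \<in> D \<and> emb (x, y) \<in> int_line m n (- f)"
      unfolding \<tau>_def lattice_of_def D_def by simp
    then show ?thesis unfolding emb_in_int_line sndU by auto
  qed
  have lat\<tau>': "(x, y) \<in> lattice_of \<tau>' \<longleftrightarrow> (x, y) \<in> I \<and> snd (U (x, y)) = 1" for x y
  proof -
    have "(x, y) \<in> lattice_of \<tau>' \<longleftrightarrow> (x, y) \<in> lattice_of \<Gamma> \<and> emb (x, y) \<in> int_line m n (1 - f)"
      unfolding \<tau>'_def lattice_of_def by simp
    then show ?thesis unfolding emb_in_int_line sndU lat\<Gamma> by auto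
  qed
  have on_row: "\<exists>z\<in>S. U z = (a, r) \<and> emb z \<in> int_line m n (r - f)" if ar: "(a, r) \<in> U ` S" for a r S
  proof -
    obtain z where z: "z \<in> S" "U z = (a, r)" using ar by (metis imageE)
    obtain x y where xy: "z = (x, y)" by fastforce
    have "m * x + n * y + f = r" using z(2) sndU[of x y] unfolding xy by simp
    then have "emb z \<in> int_line m n (r - f)" unfolding xy emb_in_int_line by simp
    then show ?thesis using z by blast
  qed
  have e1: "\<tau> edge_of P" "affine hull \<tau> = int_line m n (- f)"
  proof -
    obtain u where u: "u \<in> D" "U u = (0, 0)" "emb u \<in> int_line m n (- f)" using on_row[OF D0(1)] by auto
    obtain w where w: "w \<in> D" "U w = (L, 0)" "emb w \<in> int_line m n (- f)" using on_row[OF D0(2)] by auto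
    have "- f \<le> m * x + n * y" if "(x, y) \<in> D" for x y
    proof -
      have "(fst (U (x, y)), snd (U (x, y))) \<in> U ` D" using that by simp
      then show ?thesis using Dpos sndU[of x y] by fastforce
    qed
    moreover have "u \<noteq> w" using u(2) w(2) L d by auto
    ultimately show "\<tau> edge_of P" "affine hull \<tau> = int_line m n (- f)"
      unfolding \<tau>_def using edge_on_line[OF mn _ P(1), of "- f" u w] u w unfolding D_def by blast+
  qed
  have e2: "\<tau>' edge_of \<Gamma>" "affine hull \<tau>' = int_line m n (1 - f)"
  proof -
    obtain u where u: "u \<in> I" "U u = (1, 1)" "emb u \<in> int_line m n (1 - f)" using on_row[OF I1] by auto
    obtain w where w: "w \<in> I" "U w = (2, 1)" "emb w \<in> int_line m n (1 - f)" using on_row[OF I2] by auto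
    have "1 - f \<le> m * x + n * y" if "(x, y) \<in> I" for x y
    proof -
      have "(fst (U (x, y)), snd (U (x, y))) \<in> U ` I" using that by simp
      then show ?thesis using Ib sndU[of x y] by fastforce
    qed
    moreover have "u \<noteq> w" using u(2) w(2) by auto
    ultimately show "\<tau>' edge_of \<Gamma>" "affine hull \<tau>' = int_line m n (1 - f)"
      unfolding \<tau>'_def using edge_on_line[OF mn _ \<Gamma>, of "1 - f" u w] u w unfolding lat\<Gamma> by blast+
  qed
  have n1: "L + 1 \<le> num_int_points \<tau>"
  proof -
    have row: "(x, 0) \<in> U ` lattice_of \<tau>" if "0 \<le> x" "x \<le> L" for x
    proof -
      have "convex (convex hull (emb ` U ` D))" by (rule convex_convex_hull)
      from lattice_of_convex_comb[OF this, of 0 0 L 0 0 0 "L - x" x 0 x 0]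
      have "(x, 0) \<in> U ` D" using that D0 L d change_frame(2)[OF P(1) U] unfolding D_def by simp
      then obtain z where z: "z \<in> D" "U z = (x, 0)" by (metis imageE)
      then have "z \<in> lattice_of \<tau>" using lat\<tau>[of "fst z" "snd z"] by simp
      then show ?thesis using z(2) by (metis image_eqI)
    qed
    have "finite (lattice_of \<tau>)" using P(2) by (rule rev_finite_subset) (auto simp: \<tau>_def lattice_of_def)
    then have fin: "finite {x. (x, 0) \<in> U ` lattice_of \<tau>}" by (intro finite_row finite_imageI)
    have "card {0..L} \<le> card {x. (x, 0) \<in> U ` lattice_of \<tau>}" using row by (intro card_mono fin) auto
    moreover have "num_int_points \<tau> = int (card {x. (x, 0) \<in> U ` lattice_of \<tau>})"
      by (rule num_int_points_eq_card_row[OF U]) (use lat\<tau> in blast)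
    ultimately show ?thesis by simp
  qed
  have n2: "num_int_points \<tau>' \<le> d + 1"
  proof -
    have "{x. (x, 1) \<in> U ` lattice_of \<tau>'} \<subseteq> {1..d + 1}"
    proof
      fix x assume "x \<in> {x. (x, 1) \<in> U ` lattice_of \<tau>'}"
      then obtain z where "z \<in> lattice_of \<tau>'" "U z = (x, 1)" by (metis imageE mem_Collect_eq)
      then have "(x, 1) \<in> U ` I" using lat\<tau>'[of "fst z" "snd z"] by (metis image_eqI prod.collapse)
      then show "x \<in> {1..d + 1}" using Ib by fastforce
    qed
    then have "card {x. (x, 1) \<in> U ` lattice_of \<tau>'} \<le> card {1..d + 1}" by (intro card_mono) auto
    moreover have "num_int_points \<tau>' = int (card {x. (x, 1) \<in> U ` lattice_of \<tau>'})"
      by (rule num_int_points_eq_card_row[OF U]) (use lat\<tau>' in blast)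
    ultimately show ?thesis using d by simp
  qed
  have "at_integral_distance (affine hull \<tau>) (affine hull \<tau>') 1"
    unfolding at_integral_distance_def e1(2) e2(2)
    by (intro exI[of _ m] exI[of _ n] exI[of _ "- f"] exI[of _ "1 - f"]) (use cop in auto)
  then have "long_edge_pair P \<tau> \<tau>'"
    unfolding long_edge_pair_def \<Gamma>_def[symmetric] using e1(1) e2(1) n1 n2 L by simp
  then show ?thesis by blast
qed

lemma interval_of_convex:
  fixes R :: "int set"
  assumes "finite R" "R \<noteq> {}" "\<And>x y z. x \<in> R \<Longrightarrow> y \<in> R \<Longrightarrow> x \<le> z \<Longrightarrow> z \<le> y \<Longrightarrow> z \<in> R"
  shows "\<exists>m M. R = {m..M} \<and> m \<le> M \<and> int (card R) = M - m + 1"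
proof -
  have "R = {Min R..Max R}"
  proof (intro equalityI subsetI)
    show "x \<in> {Min R..Max R}" if "x \<in> R" for x using that assms(1) by simp
    show "x \<in> R" if "x \<in> {Min R..Max R}" for x
      using assms(3)[OF Min_in[OF assms(1,2)] Max_in[OF assms(1,2)]] that by simp
  qed
  moreover have "Min R \<le> Max R" using assms by simp
  moreover have "int (card {Min R..Max R}) = Max R - Min R + 1" using \<open>Min R \<le> Max R\<close> by simp
  ultimately show ?thesis by metis
qed

lemma long_rows:
  assumes ab: "absorbs D I" and D: "\<And>x y. (x, y) \<in> D \<Longrightarrow> 0 \<le> y" and I: "\<And>x y. (x, y) \<in> I \<Longrightarrow> 1 \<le> y"
    and row0: "\<And>x. (x, 0) \<in> D \<longleftrightarrow> x \<in> {m..M}" and row1: "\<And>x. (x, 1) \<in> I \<longleftrightarrow> x \<in> {m'..M'}"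
    and le: "m' \<le> M'" "M' - m' + 4 \<le> M - m"
  shows "fits D (M - m)" "fits D e \<Longrightarrow> M - m \<le> e" "fits I (M' - m')" "fits I e \<Longrightarrow> M' - m' \<le> e"
proof -
  have mem: "(m, 0) \<in> D" "(M, 0) \<in> D" "(m', 1) \<in> I" "(M', 1) \<in> I" using row0 row1 le by auto
  show "M - m \<le> e" if "fits D e" using fits_segment_le[OF that, of m 0 "M - m"] mem le by simp
  show "M' - m' \<le> e" if "fits I e" using fits_segment_le[OF that, of m' 1 "M' - m'"] mem le by simp
  \<comment> \<open>The shear by \<open>s\<close> with a translation makes row 0 of \<open>D\<close>
    start at 0 and row 1 of \<open>I\<close> start at 1, the position assumed in the row
    bounds.\<close>
  define s where "s = m' - 1 - m"
  define W where "W = aff_map 1 (- s) 0 1 (- m) 0"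
  have W: "int_unimodular W" unfolding W_def by (rule int_unimodular_aff_map) simp
  have abW: "absorbs (W ` D) (W ` I)" by (rule absorbs_image[OF W ab])
  have WD: "(x, y) \<in> W ` D \<longleftrightarrow> (x + s * y + m, y) \<in> D" for x y
    unfolding W_def by (auto simp: image_iff algebra_simps intro: bexI[rotated])
  have WI: "(x, y) \<in> W ` I \<longleftrightarrow> (x + s * y + m, y) \<in> I" for x y
    unfolding W_def by (auto simp: image_iff algebra_simps intro: bexI[rotated])
  define L l where "L = M - m" and "l = M' - m'"
  have c: "(0, 0) \<in> W ` D" "(L, 0) \<in> W ` D" "(1, 1) \<in> W ` I" "(l + 1, 1) \<in> W ` I" "(0, 1) \<notin> W ` I" "(l + 2, 1) \<notin> W ` I"
    unfolding WD WI L_def l_def s_def using mem row1 by auto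
  have Ll: "0 \<le> l" "l + 4 \<le> L" using le unfolding L_def l_def by auto
  have "fits (W ` D) L"
  proof (rule fits_simplexI[of _ 0 0 L])
    fix x y assume xy: "(x, y) \<in> W ` D"
    then have "0 \<le> y" using D unfolding WD by blast
    show "0 \<le> x \<and> 0 \<le> y \<and> x + y \<le> L"
    proof (cases "y = 0")
      case True
      then show ?thesis using xy row0 unfolding WD L_def by auto
    next
      case False
      then show ?thesis using row_bound[OF abW c Ll xy] \<open>0 \<le> y\<close> by simp
    qed
  qed simp
  then show "fits D (M - m)" using fits_image_iff[OF W] unfolding L_def by simp
  have "fits (W ` I) l"
  proof (rule fits_simplexI[of _ 1 1 "l + 2"])
    fix x y assume xy: "(x, y) \<in> W ` I"
    then have "1 \<le> y" using I unfolding WI by blast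
    then show "1 \<le> x \<and> 1 \<le> y \<and> x + y \<le> l + 2" using row_bound_interior[OF abW c Ll xy] by simp
  qed simp
  then show "fits I (M' - m')" using fits_image_iff[OF W] unfolding l_def by simp
qed

text \<open>A segment joining points strictly on both sides crosses the line inside
  \<open>P\<close>, hence in the face; the face property then puts its ends on the line too.\<close>

lemma face_one_side:
  fixes P :: "(real \<times> real) set"
  assumes "convex P" "\<tau> face_of P" "affine hull \<tau> = {v. a \<bullet> v = c}"
  shows "(\<forall>v\<in>P. c \<le> a \<bullet> v) \<or> (\<forall>v\<in>P. a \<bullet> v \<le> c)"
proof (rule ccontr)
  assume "\<not> ?thesis"
  then obtain u w where uw: "u \<in> P" "w \<in> P" "a \<bullet> u < c" "c < a \<bullet> w" by (auto simp: not_le)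
  define t where "t = (c - a \<bullet> u) / (a \<bullet> w - a \<bullet> u)"
  have t: "0 < t" "t < 1" using uw unfolding t_def by (auto simp: field_simps)
  define x where "x = (1 - t) *\<^sub>R u + t *\<^sub>R w"
  have "u \<noteq> w" using uw by auto
  then have xs: "x \<in> open_segment u w" using t unfolding in_segment x_def by auto
  have "x \<in> P" unfolding x_def using assms(1) uw t by (intro convexD) auto
  moreover have "a \<bullet> x = c"
  proof -
    have "a \<bullet> x = a \<bullet> u + t * (a \<bullet> w - a \<bullet> u)" unfolding x_def by (simp add: inner_add_right algebra_simps)
    also have "\<dots> = c" using uw unfolding t_def by simp
    finally show ?thesis .
  qed
  ultimately have "x \<in> \<tau>" using face_of_imp_eq_affine_Int[OF assms(1,2)] assms(3) by auto
  then have "u \<in> \<tau>" using assms(2) xs uw unfolding face_of_def by blast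
  then have "u \<in> affine hull \<tau>" by (rule hull_inc)
  then show False using assms(3) uw by simp
qed

lemma long_edge_values:
  assumes P: "P = convex hull (emb ` lattice_of P)" "finite (lattice_of P)" "convex P"
    and le: "long_edge_pair P \<tau> \<tau>'"
  shows "lattice_size (interior_polygon P) = num_int_points \<tau>' - 1 \<and> lattice_size P = num_int_points \<tau> - 1"
proof -
  define D where "D = lattice_of P"
  define I where "I = lattice_of (interior P)"
  define \<Gamma> where "\<Gamma> = interior_polygon P"
  have \<Gamma>: "\<Gamma> = convex hull (emb ` I)" unfolding \<Gamma>_def interior_polygon_eq I_def ..
  have lat\<Gamma>: "lattice_of \<Gamma> = I" unfolding \<Gamma>_def I_def by (rule lattice_of_interior_polygon[OF P(3)])
  have ID: "I \<subseteq> D" unfolding I_def D_def lattice_of_def using interior_subset by auto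
  have finI: "finite I" using ID P(2) unfolding D_def by (rule finite_subset)
  have e1: "\<tau> face_of P" "aff_dim \<tau> = 1" and e2: "\<tau>' face_of \<Gamma>" "aff_dim \<tau>' = 1"
    and dist: "at_integral_distance (affine hull \<tau>) (affine hull \<tau>') 1"
    and num: "num_int_points \<tau> - num_int_points \<tau>' \<ge> 4"
    using le unfolding long_edge_pair_def edge_of_def \<Gamma>_def by auto
  obtain a b c c' where cop: "coprime a b" and l1: "affine hull \<tau> = int_line a b c"
    and l2: "affine hull \<tau>' = int_line a b c'" and cc: "1 = \<bar>c - c'\<bar>"
    using dist unfolding at_integral_distance_def by blast
  have ab0: "a \<noteq> 0 \<or> b \<noteq> 0" using cop by auto
  have \<tau>: "\<tau> = int_line a b c \<inter> P" using face_of_imp_eq_affine_Int[OF P(3) e1(1)] l1 by simp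
  have \<tau>': "\<tau>' = int_line a b c' \<inter> \<Gamma>"
    using face_of_imp_eq_affine_Int[OF _ e2(1)] l2 \<Gamma> convex_convex_hull by metis
  \<comment> \<open>A face of the hull of finitely many points is the hull of some of them, so an
    edge contains a lattice point.\<close>
  have ne: "lattice_of \<tau> \<noteq> {}" and ne': "lattice_of \<tau>' \<noteq> {}"
  proof -
    have "compact (emb ` D)" using P(2) unfolding D_def by (intro finite_imp_compact finite_imageI)
    moreover have "\<tau> face_of convex hull (emb ` D)" using e1(1) P(1) unfolding D_def by simp
    ultimately obtain S where S: "S \<subseteq> emb ` D" "\<tau> = convex hull S" by (rule face_of_convex_hull_subset)
    have "S \<noteq> {}" using S(2) e1(2) by auto
    then obtain z where "emb z \<in> S" using S(1) by blast
    then have "emb z \<in> \<tau>" using S(2) by (simp add: hull_inc)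
    then show "lattice_of \<tau> \<noteq> {}" unfolding lattice_of_def by blast
    have "compact (emb ` I)" using finI by (intro finite_imp_compact finite_imageI)
    moreover have "\<tau>' face_of convex hull (emb ` I)" using e2(1) \<Gamma> by simp
    ultimately obtain S' where S': "S' \<subseteq> emb ` I" "\<tau>' = convex hull S'" by (rule face_of_convex_hull_subset)
    have "S' \<noteq> {}" using S'(2) e2(2) by auto
    then obtain z where "emb z \<in> S'" using S'(1) by blast
    then have "emb z \<in> \<tau>'" using S'(2) by (simp add: hull_inc)
    then show "lattice_of \<tau>' \<noteq> {}" unfolding lattice_of_def by blast
  qed
  \<comment> \<open>\<sigma> orients the normal \<open>(a, b)\<close> so that it points from the
    edge into \<open>P\<close>.\<close>
  obtain \<sigma> where \<sigma>: "\<sigma> = 1 \<or> \<sigma> = -1" and side: "\<And>x y. (x, y) \<in> D \<Longrightarrow> 0 \<le> \<sigma> * (a * x + b * y - c)"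
  proof -
    have "(\<forall>v\<in>P. of_int c \<le> (of_int a, of_int b) \<bullet> v) \<or> (\<forall>v\<in>P. (of_int a, of_int b) \<bullet> v \<le> of_int c)"
      by (rule face_one_side[OF P(3) e1(1)]) (simp add: l1 int_line_eq)
    then show thesis
    proof
      assume H: "\<forall>v\<in>P. of_int c \<le> (of_int a, of_int b) \<bullet> v"
      have "0 \<le> 1 * (a * x + b * y - c)" if "(x, y) \<in> D" for x y
        using H that emb_functional_less_iff[of a b x y c] unfolding D_def lattice_of_def by fastforce
      then show thesis by (intro that[of 1]) auto
    next
      assume H: "\<forall>v\<in>P. (of_int a, of_int b) \<bullet> v \<le> of_int c"
      have "0 \<le> (-1) * (a * x + b * y - c)" if "(x, y) \<in> D" for x y
        using H that emb_functional_le_iff[of a b x y c] unfolding D_def lattice_of_def by fastforce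
      then show thesis by (intro that[of "-1"]) auto
    qed
  qed
  have sideI: "0 < \<sigma> * (a * x + b * y - c)" if "(x, y) \<in> I" for x y
  proof -
    have "(x, y) \<in> lattice_of (interior (convex hull (emb ` D)))" using that P(1) unfolding I_def D_def by simp
    then have "(- \<sigma> * a) * x + (- \<sigma> * b) * y < - \<sigma> * c"
      by (rule lattice_of_interior_hull_less[rotated 2])
         (use side ab0 \<sigma> in \<open>force simp: algebra_simps\<close>)+
    then show ?thesis by (simp add: algebra_simps)
  qed
  \<comment> \<open>Bezout coefficients complete the normal to a unimodular matrix; the second
    coordinate then measures the integral distance from the edge.\<close>
  obtain p q where pq: "p * a + q * b = 1" using bezout_int[of a b] cop by auto
  define U where "U = aff_map q (- p) (\<sigma> * a) (\<sigma> * b) 0 (- \<sigma> * c)"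
  have "q * (\<sigma> * b) - - p * (\<sigma> * a) = \<sigma> * (p * a + q * b)" by (simp add: algebra_simps)
  then have U: "int_unimodular U" unfolding U_def using pq \<sigma> by (intro int_unimodular_aff_map) simp
  have sndU: "snd (U (x, y)) = \<sigma> * (a * x + b * y - c)" for x y unfolding U_def by (simp add: algebra_simps)
  have lat\<tau>: "(x, y) \<in> lattice_of \<tau> \<longleftrightarrow> (x, y) \<in> D \<and> snd (U (x, y)) = 0" for x y
  proof -
    have "(x, y) \<in> lattice_of \<tau> \<longleftrightarrow> (x, y) \<in> D \<and> emb (x, y) \<in> int_line a b c"
      unfolding \<tau> lattice_of_def D_def by auto
    then show ?thesis unfolding emb_in_int_line sndU using \<sigma> by auto
  qed
  have \<tau>'I: "(x, y) \<in> lattice_of \<tau>' \<longleftrightarrow> (x, y) \<in> I \<and> a * x + b * y = c'" for x y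
  proof -
    have "(x, y) \<in> lattice_of \<tau>' \<longleftrightarrow> (x, y) \<in> lattice_of \<Gamma> \<and> emb (x, y) \<in> int_line a b c'"
      unfolding \<tau>' lattice_of_def by auto
    then show ?thesis unfolding emb_in_int_line lat\<Gamma> .
  qed
  obtain x0 y0 where "(x0, y0) \<in> lattice_of \<tau>'" using ne' by auto
  \<comment> \<open>Interior lattice points lie strictly on the inner side, so at integral distance
    1 the edge \<tau>' is row 1, not row -1.\<close>
  then have "0 < \<sigma> * (c' - c)" using sideI[of x0 y0] \<tau>'I by auto
  then have c': "c' - c = \<sigma>" using \<sigma> cc by auto
  have lat\<tau>': "(x, y) \<in> lattice_of \<tau>' \<longleftrightarrow> (x, y) \<in> I \<and> snd (U (x, y)) = 1" for x y
    unfolding \<tau>'I sndU using \<sigma> c' by auto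
  define R0 where "R0 = {x. (x, 0) \<in> U ` lattice_of \<tau>}"
  define R1 where "R1 = {x. (x, 1) \<in> U ` lattice_of \<tau>'}"
  have row_iff: "(x, r) \<in> U ` T \<longleftrightarrow> (x, r) \<in> U ` S"
    if "\<And>x y. (x, y) \<in> T \<longleftrightarrow> (x, y) \<in> S \<and> snd (U (x, y)) = r" for x r S T
  proof
    assume "(x, r) \<in> U ` T"
    then obtain z where "z \<in> T" "U z = (x, r)" by (metis imageE)
    then show "(x, r) \<in> U ` S" using that[of "fst z" "snd z"] by (metis image_eqI prod.collapse)
  next
    assume "(x, r) \<in> U ` S"
    then obtain z where "z \<in> S" "U z = (x, r)" by (metis imageE)
    then show "(x, r) \<in> U ` T" using that[of "fst z" "snd z"] by (metis image_eqI prod.collapse snd_conv)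
  qed
  have R0: "x \<in> R0 \<longleftrightarrow> (x, 0) \<in> U ` D" for x unfolding R0_def mem_Collect_eq by (rule row_iff[OF lat\<tau>])
  have R1: "x \<in> R1 \<longleftrightarrow> (x, 1) \<in> U ` I" for x unfolding R1_def mem_Collect_eq by (rule row_iff[OF lat\<tau>'])
  define K where "K = convex hull (emb ` U ` D)"
  have KD: "lattice_of K = U ` D" and KI: "lattice_of (interior K) = U ` I"
    using change_frame(2,3)[OF P(1) U] unfolding K_def D_def I_def by auto
  have convK: "convex K" unfolding K_def by (rule convex_convex_hull)
  have between: "(z, r) \<in> lattice_of S" if "convex S" "(x, r) \<in> lattice_of S" "(y, r) \<in> lattice_of S" "x \<le> z" "z \<le> y"
    for S x y z r
  proof (cases "x = y")
    case False
    then show ?thesis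
      using lattice_of_convex_comb[OF that(1,2,3,3), of "y - z" "z - x" 0 z r] that(4,5)
      by (simp add: algebra_simps)
  qed (use that in auto)
  have "R0 = {x. (x, 0) \<in> U ` D}" using R0 by blast
  then have finR0: "finite R0" using P(2) unfolding D_def by (simp add: finite_row)
  have "R1 = {x. (x, 1) \<in> U ` I}" using R1 by blast
  then have finR1: "finite R1" using finI by (simp add: finite_row)
  have neR0: "R0 \<noteq> {}"
  proof -
    obtain x y where "(x, y) \<in> lattice_of \<tau>" using ne by auto
    then have "fst (U (x, y)) \<in> R0" using lat\<tau>[of x y] unfolding R0_def
      by (metis (mono_tags, lifting) image_eqI mem_Collect_eq prod.collapse)
    then show ?thesis by blast
  qed
  have neR1: "R1 \<noteq> {}"
  proof -
    obtain x y where "(x, y) \<in> lattice_of \<tau>'" using ne' by auto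
    then have "fst (U (x, y)) \<in> R1" using lat\<tau>'[of x y] unfolding R1_def
      by (metis (mono_tags, lifting) image_eqI mem_Collect_eq prod.collapse)
    then show ?thesis by blast
  qed
  obtain m M where m: "R0 = {m..M}" "m \<le> M" "int (card R0) = M - m + 1"
  proof -
    have "z \<in> R0" if "x \<in> R0" "y \<in> R0" "x \<le> z" "z \<le> y" for x y z
      using between[OF convK, of x 0 y z] that unfolding R0 KD by simp
    then show thesis using interval_of_convex[OF finR0 neR0] that by blast
  qed
  obtain m' M' where m': "R1 = {m'..M'}" "m' \<le> M'" "int (card R1) = M' - m' + 1"
  proof -
    have "z \<in> R1" if "x \<in> R1" "y \<in> R1" "x \<le> z" "z \<le> y" for x y z
      using between[OF convex_interior[OF convK], of x 1 y z] that unfolding R1 KI by simp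
    then show thesis using interval_of_convex[OF finR1 neR1] that by blast
  qed
  have "num_int_points \<tau> = int (card R0)"
    unfolding R0_def by (rule num_int_points_eq_card_row[OF U]) (use lat\<tau> in blast)
  then have n0: "num_int_points \<tau> = M - m + 1" using m(3) by simp
  have "num_int_points \<tau>' = int (card R1)"
    unfolding R1_def by (rule num_int_points_eq_card_row[OF U]) (use lat\<tau>' in blast)
  then have n1: "num_int_points \<tau>' = M' - m' + 1" using m'(3) by simp
  have abU: "absorbs (U ` D) (U ` I)" using absorbs_lattice_of[OF convK] unfolding KD KI .
  have UD: "0 \<le> y" if xy: "(x, y) \<in> U ` D" for x y
  proof -
    obtain z where z: "z \<in> D" "U z = (x, y)" using xy by (metis imageE)
    then show ?thesis using side[of "fst z" "snd z"] sndU[of "fst z" "snd z"] by simp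
  qed
  have UI: "1 \<le> y" if xy: "(x, y) \<in> U ` I" for x y
  proof -
    obtain z where z: "z \<in> I" "U z = (x, y)" using xy by (metis imageE)
    then show ?thesis using sideI[of "fst z" "snd z"] sndU[of "fst z" "snd z"] by simp
  qed
  have gap: "M' - m' + 4 \<le> M - m" using num n0 n1 by simp
  have row0: "(x, 0) \<in> U ` D \<longleftrightarrow> x \<in> {m..M}" for x using R0 m(1) by simp
  have row1: "(x, 1) \<in> U ` I \<longleftrightarrow> x \<in> {m'..M'}" for x using R1 m'(1) by simp
  note rows = long_rows[OF abU UD UI row0 row1 m'(2) gap]
  have "lattice_size P = M - m"
  proof (rule transported_lattice_size[OF P(1,2) U])
    show "lattice_of P \<noteq> {}" using ne \<tau> unfolding lattice_of_def by auto
  qed (use rows in \<open>auto simp: D_def\<close>)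
  moreover have "lattice_size (interior_polygon P) = M' - m'"
  proof (rule transported_interior_size[OF P(2) U])
    show "lattice_of (interior P) \<noteq> {}" using ne' \<tau>'I unfolding I_def by auto
  qed (use rows in \<open>auto simp: I_def\<close>)
  ultimately show ?thesis using n0 n1 by simp
qed

subsection \<open>The generic case\<close>

text \<open>Each of the three sides moves inwards by one unit for interior lattice points, which
  accounts for the 3.\<close>

lemma fits_interior:
  assumes P: "P = convex hull (emb ` lattice_of P)" and e: "fits (lattice_of P) e"
  shows "fits (lattice_of (interior P)) (e - 3)"
proof -
  obtain U where U: "int_unimodular U" "\<forall>z\<in>lattice_of P. 0 \<le> fst (U z) \<and> 0 \<le> snd (U z) \<and> fst (U z) + snd (U z) \<le> e"
    using e unfolding fits_def by blast
  have b: "0 \<le> x \<and> 0 \<le> y \<and> x + y \<le> e" if "(x, y) \<in> U ` lattice_of P" for x y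
    using that U(2) by (metis fst_conv imageE snd_conv)
  have "fits (U ` lattice_of (interior P)) (e - 3)"
  proof (rule fits_simplexI[of _ 1 1 "e - 1"])
    fix x y assume "(x, y) \<in> U ` lattice_of (interior P)"
    then have xy: "(x, y) \<in> lattice_of (interior (convex hull (emb ` U ` lattice_of P)))"
      using change_frame(3)[OF P U(1)] by simp
    have "(-1) * x + 0 * y < 0" using xy
      by (rule lattice_of_interior_hull_less[rotated 2]) (use b in force)+
    moreover have "0 * x + (-1) * y < 0" using xy
      by (rule lattice_of_interior_hull_less[rotated 2]) (use b in force)+
    moreover have "1 * x + 1 * y < e" using xy
      by (rule lattice_of_interior_hull_less[rotated 2]) (use b in force)+
    ultimately show "1 \<le> x \<and> 1 \<le> y \<and> x + y \<le> e - 1" by simp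
  qed simp
  then show ?thesis using fits_image_iff[OF U(1)] by simp
qed

lemma unimodular_equiv_hullI:
  assumes P: "P = convex hull (emb ` lattice_of P)" and U: "int_unimodular U"
    and V: "V \<subseteq> U ` lattice_of P" "U ` lattice_of P \<subseteq> lattice_of (convex hull (emb ` V))"
  shows "P \<simeq> convex hull (emb ` V)"
  using change_frame(1)[OF P U] convex_hull_emb_eqI[OF V] by simp

lemma is_trapezoidI:
  assumes P: "P = convex hull (emb ` lattice_of P)" and ab: "a = 1 \<and> b = 1 \<or> 2 \<le> a \<and> b \<le> a \<and> 0 \<le> b"
    and t: "equiv_to (trapezoidal a b) (lattice_of P)"
  shows "is_trapezoid P a b"
proof -
  define Z :: "(int \<times> int) set" where "Z = {(0, 0), (a, 0), (0, 1), (b, 1)}"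
  obtain U where U: "int_unimodular U" "trapezoidal a b (U ` lattice_of P)" using t unfolding equiv_to_def by blast
  have Z: "(0, 0) \<in> lattice_of (convex hull (emb ` Z))" "(a, 0) \<in> lattice_of (convex hull (emb ` Z))"
    "(0, 1) \<in> lattice_of (convex hull (emb ` Z))" "(b, 1) \<in> lattice_of (convex hull (emb ` Z))"
    by (rule mem_lattice_of_hull, simp add: Z_def)+
  have "P \<simeq> convex hull (emb ` Z)"
  proof (rule unimodular_equiv_hullI[OF P U(1)])
    show "Z \<subseteq> U ` lattice_of P" using U(2) unfolding trapezoidal_def Z_def by simp
    show "U ` lattice_of P \<subseteq> lattice_of (convex hull (emb ` Z))"
    proof
      fix z assume z: "z \<in> U ` lattice_of P"
      obtain x y where xy: "z = (x, y)" by fastforce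
      have *: "0 \<le> x" "y = 0 \<and> x \<le> a \<or> y = 1 \<and> x \<le> b" using U(2) z xy unfolding trapezoidal_def by auto
      from *(2) show "z \<in> lattice_of (convex hull (emb ` Z))"
      proof
        assume y: "y = 0 \<and> x \<le> a"
        show ?thesis unfolding xy
          by (rule lattice_of_convex_comb[OF convex_convex_hull Z(1,2,2), of "a - x" x 0])
             (use y * ab in \<open>auto simp: algebra_simps\<close>)
      next
        assume y: "y = 1 \<and> x \<le> b"
        show ?thesis
        \<comment> \<open>If \<open>b = 0\<close>, row 1 is a single point and the weights
          \<open>b - x\<close> and \<open>x\<close> would both be zero.\<close>
        proof (cases "b = 0")
          case True
          then show ?thesis using y * Z(3) xy by simp
        next
          case False
          then show ?thesis unfolding xy
            by (intro lattice_of_convex_comb[OF convex_convex_hull Z(3,4,4), of "b - x" x 0])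
               (use y * ab in \<open>auto simp: algebra_simps\<close>)
        qed
      qed
    qed
  qed
  then show ?thesis unfolding is_trapezoid_def vertex_hull_eq Z_def using ab by simp
qed

lemma double_simplex_equivI:
  assumes P: "P = convex hull (emb ` lattice_of P)" and t: "equiv_to double_simplex (lattice_of P)"
  shows "P \<simeq> convex hull {(0, 0), (2, 0), (0, 2)}"
proof -
  define Z :: "(int \<times> int) set" where "Z = {(0, 0), (2, 0), (0, 2)}"
  obtain U where U: "int_unimodular U" "double_simplex (U ` lattice_of P)" using t unfolding equiv_to_def by blast
  have Z: "(0, 0) \<in> lattice_of (convex hull (emb ` Z))" "(2, 0) \<in> lattice_of (convex hull (emb ` Z))"
    "(0, 2) \<in> lattice_of (convex hull (emb ` Z))"
    by (rule mem_lattice_of_hull, simp add: Z_def)+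
  have "P \<simeq> convex hull (emb ` Z)"
  proof (rule unimodular_equiv_hullI[OF P U(1)])
    show "Z \<subseteq> U ` lattice_of P" using U(2) unfolding double_simplex_def Z_def by simp
    show "U ` lattice_of P \<subseteq> lattice_of (convex hull (emb ` Z))"
    proof
      fix z assume z: "z \<in> U ` lattice_of P"
      obtain x y where xy: "z = (x, y)" by fastforce
      have "0 \<le> x" "0 \<le> y" "x + y \<le> 2" using U(2) z xy unfolding double_simplex_def by auto
      then show "z \<in> lattice_of (convex hull (emb ` Z))" unfolding xy
        by (intro lattice_of_convex_comb[OF convex_convex_hull Z, of "2 - x - y" x y]) auto
    qed
  qed
  then show ?thesis unfolding vertex_hull_eq Z_def .
qed

lemma flat_triangle_equivI:
  assumes P: "P = convex hull (emb ` lattice_of P)" "convex P"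
    and la: "long_axis (lattice_of P) (lattice_of (interior P)) 0"
  shows "P \<simeq> convex hull {(0, 0), (4, 0), (0, 2)}"
proof -
  define Z :: "(int \<times> int) set" where "Z = {(0, 0), (4, 0), (0, 2)}"
  define D where "D = lattice_of P"
  define I where "I = lattice_of (interior P)"
  obtain U L where U: "int_unimodular U" and L: "0 + 4 \<le> L" and D0: "(0, 0) \<in> U ` D" "(L, 0) \<in> U ` D" and I1: "(1, 1) \<in> U ` I"
    and Dpos: "\<forall>x y. (x, y) \<in> U ` D \<longrightarrow> 0 \<le> x \<and> 0 \<le> y"
    and Ib: "\<forall>x y. (x, y) \<in> U ` I \<longrightarrow> 1 \<le> x \<and> 1 \<le> y \<and> x + y \<le> 0 + 2"
    using la unfolding long_axis_def D_def I_def by blast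
  have ab: "absorbs (U ` D) (U ` I)"
    unfolding D_def I_def by (rule absorbs_image[OF U absorbs_lattice_of[OF P(2)]])
  have I2: "(2, 1) \<notin> U ` I" using Ib by force
  \<comment> \<open>If \<open>D\<close> stayed at height at most 1, the interior would lie strictly
    below height 1 and could not contain \<open>(1, 1)\<close>.\<close>
  obtain w h where w: "(w, h) \<in> U ` D" "2 \<le> h"
  proof -
    have "\<exists>w h. (w, h) \<in> U ` D \<and> 2 \<le> h"
    proof (rule ccontr)
      assume c: "\<not> ?thesis"
      have "(1, 1) \<in> lattice_of (interior (convex hull (emb ` U ` D)))"
        using I1 change_frame(3)[OF P(1) U] unfolding D_def I_def by simp
      then have "0 * 1 + 1 * 1 < (1::int)"
        by (rule lattice_of_interior_hull_less[rotated 2]) (use c in force)+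
      then show False by simp
    qed
    then show thesis using that by blast
  qed
  have L4: "4 \<le> L" using L by simp
  have pos: "\<And>x y. (x, y) \<in> U ` D \<Longrightarrow> 0 \<le> x \<and> 0 \<le> y" using Dpos by blast
  note tri = triangle_of_long_axis[OF ab I1 I2 D0(2) L4 pos w]
  have Z: "(0, 0) \<in> lattice_of (convex hull (emb ` Z))" "(4, 0) \<in> lattice_of (convex hull (emb ` Z))"
    "(0, 2) \<in> lattice_of (convex hull (emb ` Z))"
    by (rule mem_lattice_of_hull, simp add: Z_def)+
  have "P \<simeq> convex hull (emb ` Z)"
  proof (rule unimodular_equiv_hullI[OF P(1) U])
    show "Z \<subseteq> U ` lattice_of P" using tri(1,2) D0 unfolding Z_def D_def by simp
    show "U ` lattice_of P \<subseteq> lattice_of (convex hull (emb ` Z))"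
    proof
      fix z assume z: "z \<in> U ` lattice_of P"
      obtain x y where xy: "z = (x, y)" by fastforce
      have "0 \<le> x" "0 \<le> y" "x + 2 * y \<le> 4" using tri(3)[of x y] pos[of x y] z xy unfolding D_def by auto
      then show "z \<in> lattice_of (convex hull (emb ` Z))" unfolding xy
        by (intro lattice_of_convex_comb[OF convex_convex_hull Z, of "4 - x - 2 * y" x "2 * y"]) auto
    qed
  qed
  then show ?thesis unfolding vertex_hull_eq Z_def .
qed

lemma is_rectangleI:
  assumes P: "P = convex hull (emb ` lattice_of P)" and r: "rectangular (lattice_of P)"
  shows "\<exists>a b. is_rectangle P a b"
proof -
  obtain U a b where U: "int_unimodular U" and ab: "2 \<le> a" "2 \<le> b"
    and c: "{(0, 0), (a, 0), (0, b), (a, b)} \<subseteq> U ` lattice_of P"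
    and box: "\<forall>x y. (x, y) \<in> U ` lattice_of P \<longrightarrow> 0 \<le> x \<and> x \<le> a \<and> 0 \<le> y \<and> y \<le> b"
    using r unfolding rectangular_def by blast
  define Z where "Z = {0, a} \<times> {0, b}"
  have emb: "emb ` Z = {0, real_of_int a} \<times> {0, real_of_int b}" unfolding Z_def by (auto simp: emb_def image_iff)
  have hull: "convex hull (emb ` Z) = {0..real_of_int a} \<times> {0..real_of_int b}"
    unfolding emb convex_hull_Times segment_convex_hull[symmetric] using ab by (simp add: closed_segment_eq_real_ivl)
  have "P \<simeq> convex hull (emb ` Z)"
  proof (rule unimodular_equiv_hullI[OF P U])
    show "Z \<subseteq> U ` lattice_of P" using c unfolding Z_def by auto
    show "U ` lattice_of P \<subseteq> lattice_of (convex hull (emb ` Z))"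
    proof
      fix z assume z: "z \<in> U ` lattice_of P"
      obtain x y where "z = (x, y)" by fastforce
      then show "z \<in> lattice_of (convex hull (emb ` Z))"
        using box z unfolding hull lattice_of_def by (auto simp: emb_apply)
    qed
  qed
  then show ?thesis unfolding hull is_rectangle_def using ab by blast
qed

text \<open>Without interior lattice points the formula demands size 1: the classification leaves
  only that, and planarity excludes size 0. Otherwise \<open>axis_or_rectangle\<close> gives the
  upper bound, since each of its outcomes is excluded here, and \<open>fits_interior\<close> the
  lower one.\<close>

lemma generic_values:
  assumes P: "P = convex hull (emb ` lattice_of P)" "finite (lattice_of P)" "convex P" and dim: "aff_dim P = 2"
    and no1: "\<not> (\<exists>a b. is_trapezoid P a b)" and no2: "\<not> P \<simeq> convex hull {(0, 0), (2, 0), (0, 2)}"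
    and no3: "\<not> P \<simeq> convex hull {(0, 0), (4, 0), (0, 2)}" and no4: "\<not> (\<exists>a b. is_rectangle P a b)"
    and no5: "\<not> (\<exists>\<tau> \<tau>'. long_edge_pair P \<tau> \<tau>')"
  shows "lattice_size P = lattice_size (interior_polygon P) + 3"
proof -
  define D where "D = lattice_of P"
  define I where "I = lattice_of (interior P)"
  have pl: "planar D" unfolding D_def by (rule planar_lattice_of[OF P(1) dim])
  have finD: "finite D" and neD: "D \<noteq> {}" using P(2) pl unfolding D_def planar_def by auto
  have lsP: "lattice_size P \<le> e \<longleftrightarrow> fits D e" for e
    using lattice_size_le_iff[OF finD neD] P(1) unfolding D_def by simp
  have ab: "absorbs D I" unfolding D_def I_def by (rule absorbs_lattice_of[OF P(3)])
  then have finI: "finite I" using finD unfolding absorbs_def by (auto intro: finite_subset)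
  show ?thesis
  proof (cases "I = {}")
    case True
    then have 1: "lattice_size (interior_polygon P) = -2" unfolding I_def by (rule lattice_size_interior_polygon_empty)
    have "hollow D" unfolding hollow_def using P(3) True unfolding D_def I_def by blast
    from hollow_classification[OF this finD pl] have "fits D 1"
      using is_trapezoidI[OF P(1)] double_simplex_equivI[OF P(1)] no1 no2 unfolding D_def by blast
    then have "lattice_size P \<le> 1" using lsP by simp
    moreover have "\<not> lattice_size P \<le> 0"
    proof
      assume "lattice_size P \<le> 0"
      then obtain U where U: "int_unimodular U" "\<forall>z\<in>D. 0 \<le> fst (U z) \<and> 0 \<le> snd (U z) \<and> fst (U z) + snd (U z) \<le> 0"
        unfolding lsP fits_def by blast
      obtain z where "z \<in> D" "snd (U z) \<noteq> 0" using pl U(1) unfolding planar_def by blast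
      then show False using U(2) by fastforce
    qed
    ultimately show ?thesis using 1 by simp
  next
    case False
    define d where "d = lattice_size (interior_polygon P)"
    have lsI: "d \<le> e \<longleftrightarrow> fits I e" for e
      unfolding d_def interior_polygon_eq using lattice_size_le_iff[OF finI False] unfolding I_def by simp
    have fI: "fits I d" and nfI: "\<not> fits I (d - 1)" using lsI[of d] lsI[of "d - 1"] by auto
    have d0: "0 \<le> d" using fits_imp_nonneg[OF fI False] .
    have "fits D (d + 3)"
    proof (rule ccontr)
      assume "\<not> fits D (d + 3)"
      from axis_or_rectangle[OF ab finD False fI nfI this] show False
      proof
        assume la: "long_axis D I d"
        show False
        proof (cases "d = 0")
          case True
          then show False using flat_triangle_equivI[OF P(1,3)] la no3 unfolding D_def I_def by simp
        next
          case False
          then show False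
            using long_edge_pair_of_long_axis[OF P, of d] la nfI no5 d0 unfolding D_def I_def by simp
        qed
      next
        assume "rectangular D"
        then show False using is_rectangleI[OF P(1)] no4 unfolding D_def by blast
      qed
    qed
    then have "lattice_size P \<le> d + 3" using lsP by simp
    moreover have "fits D (lattice_size P)" using lsP by blast
    then have "d \<le> lattice_size P - 3"
      unfolding lsI using fits_interior[OF P(1)] unfolding D_def I_def by blast
    ultimately show ?thesis unfolding d_def by simp
  qed
qed

theorem theorem3:
  fixes \<Delta> :: "(real \<times> real) set"
  assumes "lattice_polygon \<Delta>" and "aff_dim \<Delta> = 2"
  shows
    "(\<not> (\<exists>a b. is_trapezoid \<Delta> a b) \<and>
      \<not> \<Delta> \<simeq> convex hull {(0, 0), (2, 0), (0, 2)} \<and>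
      \<not> \<Delta> \<simeq> convex hull {(0, 0), (4, 0), (0, 2)} \<and>
      \<not> (\<exists>a b. is_rectangle \<Delta> a b) \<and>
      \<not> (\<exists>\<tau> \<tau>'. long_edge_pair \<Delta> \<tau> \<tau>')
        \<longrightarrow> lattice_size \<Delta> = lattice_size (interior_polygon \<Delta>) + 3)
     \<and> (\<forall>a b. is_trapezoid \<Delta> a b \<longrightarrow>
          lattice_size (interior_polygon \<Delta>) = -2 \<and>
          (a = b \<longrightarrow> lattice_size \<Delta> = a + 1) \<and>
          (a > b \<longrightarrow> lattice_size \<Delta> = a))
     \<and> (\<Delta> \<simeq> convex hull {(0, 0), (2, 0), (0, 2)} \<longrightarrow>
          lattice_size (interior_polygon \<Delta>) = -2 \<and> lattice_size \<Delta> = 2)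
     \<and> (\<Delta> \<simeq> convex hull {(0, 0), (4, 0), (0, 2)} \<longrightarrow>
          lattice_size (interior_polygon \<Delta>) = 0 \<and> lattice_size \<Delta> = 4)
     \<and> (\<forall>a b. is_rectangle \<Delta> a b \<longrightarrow>
          lattice_size (interior_polygon \<Delta>) = a + b - 4 \<and> lattice_size \<Delta> = a + b)
     \<and> (\<forall>\<tau> \<tau>'. long_edge_pair \<Delta> \<tau> \<tau>' \<longrightarrow>
          lattice_size (interior_polygon \<Delta>) = num_int_points \<tau>' - 1 \<and>
          lattice_size \<Delta> = num_int_points \<tau> - 1)"
proof -
  note \<Delta> = lattice_polygonD[OF assms(1)]
  show ?thesis
    using generic_values[OF \<Delta> assms(2)] trapezoid_values[OF \<Delta>(1,2)] double_simplex_values[OF \<Delta>(1,2)]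
      flat_triangle_values[OF \<Delta>(1,2)] rectangle_values[OF \<Delta>(1,2)] long_edge_values[OF \<Delta>]
    by blast
qed

end
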